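(* The horizontal cohomology spaces of the differential algebra $(\mathcal A(\mathbf{CPE}),\{D_\mu\}_{\mu\in M})$ are $$H^q_{\mathrm H}(\mathbf{CPE})\cong\begin{cases}0,& q<0,\ 1\le q\le m-2,\ q>m;\\ \mathbb R,& q=0;\\ \ker D_1^{m-1}\cong\mathcal S\cap\mathcal H,& q=m-1;\\ H^{m-1}(\Theta)/\operatorname{im}D_1^{m-1},& q=m,\end{cases}$$ where in degree $m-1$ the isomorphism $H^{m-1}_{\mathrm H}(\mathbf{CPE})\to\mathcal S\cap\mathcal H$ is given by $[J^\mu d_\mu x]\mapsto\big(\delta_{u^1_0}J^1,\ (\delta_{u^\alpha_k}J^1)_{k,\alpha},\ \delta_{p_0}J^1,\ \delta_{p_1}J^1\big)$.
   Context: Fix an integer $m\ge 2$, $M=\{1,\dots,m\}$, $N=\{2,\dots,m\}$. Indices $\lambda,\mu,\nu$ range over $M$, indices $\alpha,\beta$ over $N$; repeated upper/lower indices are summed; $\delta^k_l$ is the Kronecker delta. $\mathbb I=\mathbb Z_+^m$ is the set of multi-indices $\mathrm i=(i^1,\dots,i^m)$; $\mathrm i+(\mu)$ is $\mathrm i$ with its $\mu$-th entry increased by $1$, $(\mu)=0+(\mu)$, $2(\mu)=(\mu)+(\mu)$; $\mathbb I_0=\{\mathrm i: i^1=0\}$, $\mathbb I_1=\{\mathrm i: i^1\in\{0,1\}\}$; $\mathbb J=\mathbb Z_+^{N}$, and we write $\mathrm i=(i^1,\mathrm j)$ with $\mathrm j\in\mathbb J$. The space $\mathbf B$ has coordinates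 $x^\mu$, $u^\mu_{\mathrm i}$, $p_{\mathrm i}$ ($\mathrm i\in\mathbb I$); $\mathcal A(\mathbf B)$ is the algebra of smooth real functions depending on finitely many coordinates; total derivatives $D_\mu=\partial_{x^\mu}+u^\lambda_{\mathrm i+(\mu)}\partial_{u^\lambda_{\mathrm i}}+p_{\mathrm i+(\mu)}\partial_{p_{\mathrm i}}$ (commuting), $D_{\mathrm i}=D_1^{i^1}\cdots D_m^{i^m}$, $\Delta=\sum_{\mu}D_\mu^2$, $\Delta'=\sum_{\alpha\in N}D_\alpha^2$. Let $CE_{\mathrm i}=u^\mu_{\mathrm i+(\mu)}$, $PE_{\mathrm i}=\Delta p_{\mathrm i}+D_{\mathrm i}(u^\lambda_{(\mu)}u^\mu_{(\lambda)})$; $\mathcal J\subset\mathcal A(\mathbf B)$ is the ideal generated by all $CE_{\mathrm i},PE_{\mathrm i}$, and $\mathcal A(\mathbf{CPE})=\mathcal A(\mathbf B)/\mathcal J$ with induced $D_\mu$. Concretely, $\mathcal A(\mathbf{CPE})$ consists of smooth functions of finitely many of $x^\mu$, $u^1_{\mathrm i}$ ($\mathrm i\in\mathbb I_0$), $u^\alpha_{\mathrm i}$ ($\mathrm i\in\mathbb I$), $p_{\mathrm i}$ ($\mathrm i\in\mathbb I_1$), the other variables being expressed recursively via $u^1_{\mathrm k}=-u^\beta_{\mathrm k-(1)+(\beta)}$ ($k^1\ge1$) and $p_{\mathrm k}=-D_{\mathrm k-2(1)}\Phi$ ($k^1\ge2$), with $\Phi=\Delta'p+u^\lambda_{(\mu)}u^\mu_{(\lambda)}$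 where $u^1_{(1)}$ is replaced by $-u^\alpha_{(\alpha)}$. Horizontal forms $\Omega^q_{\mathrm H}(\mathbf{CPE})$: $q$-forms in $dx^\mu$ with skew-symmetric coefficients in $\mathcal A(\mathbf{CPE})$ ($0\le q\le m$; zero otherwise), $d_{\mathrm H}\omega=(D_\mu\omega_{\mu_1\dots\mu_q})dx^\mu\wedge dx^{\mu_1}\wedge\dots\wedge dx^{\mu_q}$, $H^q_{\mathrm H}=\ker/\operatorname{im}$. Auxiliary complex $\Theta^q$: forms in $dx^\alpha$, $\alpha\in N$, only, coefficients in $\mathcal A(\mathbf{CPE})$, differential $d_\Theta\theta=(D_\alpha\theta_{\alpha_1\dots\alpha_q})dx^\alpha\wedge dx^{\alpha_1}\wedge\dots$, cohomology $H^q(\Theta)$; $D_1$ acting coefficientwise induces $D_1^q:H^q(\Theta)\to H^q(\Theta)$. $d_\mu x=(-1)^{\mu-1}dx^1\wedge\dots\wedge\widehat{dx^\mu}\wedge\dots\wedge dx^m$. Partial variational derivatives (with respect to $x^2,\dots,x^m$): for $L\in\mathcal A(\mathbf{CPE})$, $\delta_{u^1_0}L=(-D)_{\mathrm j}\partial_{u^1_{0,\mathrm j}}L$, $\delta_{u^\alpha_k}L=(-D)_{\mathrm j}\partial_{u^\alpha_{k,\mathrm j}}L$, $\delta_{p_k}L=(-D)_{\mathrm j}\partial_{p_{k,\mathrm j}}L$ ($k\in\{0,1\}$ for $p$), summed over $\mathrm j\in\mathbb J$, where $(-D)_{\mathrm j}=\prod_{\alpha\in N}(-D_\alpha)^{j^\alpha}$.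 $\mathcal S$ is the space of finite families $\chi=(\chi_u,(\chi^k_\alpha)_{k\in\mathbb Z_+,\alpha\in N},\chi_{p,0},\chi_{p,1})$ of elements of $\mathcal A(\mathbf{CPE})$ satisfying the linear system $D_1\chi_u+2D_\alpha(u^\alpha_{(1)}\chi_{p,1})=0$; $D_1\chi^k_\alpha+\delta^k_0D_\alpha\chi_u+\chi^{k-1}_\alpha+2(\delta^k_0D_\alpha(u^\beta_{(\beta)}\chi_{p,1})-\delta^k_1u^1_{(\alpha)}\chi_{p,1}+\delta^k_0D_\beta(u^\beta_{(\alpha)}\chi_{p,1}))=0$ ($\chi^{-1}_\alpha:=0$); $D_1\chi_{p,0}-\Delta'\chi_{p,1}=0$; $D_1\chi_{p,1}+\chi_{p,0}=0$. $\mathcal H$ is the Helmholtz space: the families $\chi$ of the same shape which are variational derivatives, i.e. $\chi=(\delta_{u^1_0}L,(\delta_{u^\alpha_k}L),\delta_{p_0}L,\delta_{p_1}L)$ for some $L\in\mathcal A(\mathbf{CPE})$ (equivalently, $\chi$ has self-adjoint linearization, $\chi_*=\chi^*$). *)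

theory Defs
  imports "HOL-Analysis.Analysis"
begin

text \<open>Multi-indices i = (i^1,...,i^m) are functions nat => nat supported in {1..m}.\<close>
type_synonym mi = "nat \<Rightarrow> nat"

definition valid_mi :: "nat \<Rightarrow> mi \<Rightarrow> bool" where
  "valid_mi m i \<longleftrightarrow> (\<forall>k. (k = 0 \<or> m < k) \<longrightarrow> i k = 0)"

definition inc :: "mi \<Rightarrow> nat \<Rightarrow> mi" where
  "inc i \<mu> = i(\<mu> := Suc (i \<mu>))"

definition unit :: "nat \<Rightarrow> mi" where
  "unit \<mu> = inc (\<lambda>_. 0) \<mu>"

definition at1 :: "nat \<Rightarrow> mi" where
  "at1 k = (\<lambda>_. 0)(1 := k)"

text \<open>Coordinates: X mu = x^mu, U lambda i = u^lambda_i, P i = p_i.\<close>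
datatype var = X nat | U nat mi | P mi

definition valid_var :: "nat \<Rightarrow> var \<Rightarrow> bool" where
  "valid_var m v = (case v of
      X \<mu> \<Rightarrow> 1 \<le> \<mu> \<and> \<mu> \<le> m
    | U l i \<Rightarrow> 1 \<le> l \<and> l \<le> m \<and> valid_mi m i
    | P i \<Rightarrow> valid_mi m i)"

definition is_X :: "var \<Rightarrow> bool" where
  "is_X v = (case v of X _ \<Rightarrow> True | _ \<Rightarrow> False)"

definition free_var :: "nat \<Rightarrow> var \<Rightarrow> bool" where
  "free_var m v \<longleftrightarrow> valid_var m v \<and> (case v of
      X _ \<Rightarrow> True
    | U l i \<Rightarrow> (l = 1 \<longrightarrow> i 1 = 0)
    | P i \<Rightarrow> i 1 \<le> 1)"

type_synonym pt = "var \<Rightarrow> real"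
type_synonym fn = "pt \<Rightarrow> real"

definition coord :: "var \<Rightarrow> fn" where
  "coord v = (\<lambda>y. y v)"

definition partial :: "var \<Rightarrow> fn \<Rightarrow> fn" where
  "partial v f = (\<lambda>y. deriv (\<lambda>t. f (y(v := t))) (y v))"

fun pds :: "var list \<Rightarrow> fn \<Rightarrow> fn" where
  "pds [] f = f"
| "pds (v # vs) f = partial v (pds vs f)"

definition AB :: "nat \<Rightarrow> fn set" where
  "AB m = {f. (\<exists>S. finite S \<and> S \<subseteq> {v. valid_var m v} \<and>
                 (\<forall>y z. (\<forall>v\<in>S. y v = z v) \<longrightarrow> f y = f z))
            \<and> (\<forall>vs. continuous_on UNIV (pds vs f)
                   \<and> (\<forall>v y. (\<lambda>t. pds vs f (y(v := t))) differentiable (at (y v))))}"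

definition shiftv :: "nat \<Rightarrow> var \<Rightarrow> var" where
  "shiftv \<mu> v = (case v of X \<nu> \<Rightarrow> X \<nu> | U l i \<Rightarrow> U l (inc i \<mu>) | P i \<Rightarrow> P (inc i \<mu>))"

text \<open>Total derivative D_mu (the sum is finite for f in A(B)).\<close>
definition Dt :: "nat \<Rightarrow> nat \<Rightarrow> fn \<Rightarrow> fn" where
  "Dt m \<mu> f = (\<lambda>y. partial (X \<mu>) f y +
      (\<Sum>v\<in>{v. valid_var m v \<and> \<not> is_X v \<and> partial v f \<noteq> (\<lambda>_. 0)}.
          y (shiftv \<mu> v) * partial v f y))"

definition Dmi :: "nat \<Rightarrow> mi \<Rightarrow> fn \<Rightarrow> fn" where
  "Dmi m i f = foldr (\<lambda>\<mu> g. (Dt m \<mu> ^^ i \<mu>) g) [1..<Suc m] f"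

definition CE :: "nat \<Rightarrow> mi \<Rightarrow> fn" where
  "CE m i = (\<lambda>y. \<Sum>\<mu>=1..m. y (U \<mu> (inc i \<mu>)))"

definition quadU :: "nat \<Rightarrow> fn" where
  "quadU m = (\<lambda>y. \<Sum>l=1..m. \<Sum>\<mu>=1..m. y (U l (unit \<mu>)) * y (U \<mu> (unit l)))"

definition PE :: "nat \<Rightarrow> mi \<Rightarrow> fn" where
  "PE m i = (\<lambda>y. (\<Sum>\<mu>=1..m. y (P (inc (inc i \<mu>) \<mu>))) + Dmi m i (quadU m) y)"

definition gen :: "nat \<Rightarrow> bool \<times> mi \<Rightarrow> fn" where
  "gen m k = (if fst k then PE m (snd k) else CE m (snd k))"

definition Jid :: "nat \<Rightarrow> fn set" where
  "Jid m = {g. \<exists>K a. finite K \<and> K \<subseteq> {k. valid_mi m (snd k)} \<and> (\<forall>k\<in>K. a k \<in> AB m)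
               \<and> g = (\<lambda>y. \<Sum>k\<in>K. a k y * gen m k y)}"

text \<open>Equality in A(CPE) of representatives.\<close>
definition eqJ :: "nat \<Rightarrow> fn \<Rightarrow> fn \<Rightarrow> bool" where
  "eqJ m f g \<longleftrightarrow> (\<lambda>y. f y - g y) \<in> Jid m"

text \<open>The representative of the class of f depending only on the free coordinates of CPE
  (unique by the concrete description of A(CPE)).\<close>
definition nf :: "nat \<Rightarrow> fn \<Rightarrow> fn" where
  "nf m f = (THE g. g \<in> AB m \<and> (\<forall>y z. (\<forall>v. free_var m v \<longrightarrow> y v = z v) \<longrightarrow> g y = g z)
                  \<and> eqJ m f g)"

text \<open>A form assigns to each increasing multi-index I (a finite set) the coefficient of
  dx^{i_1} wedge ... wedge dx^{i_q}.\<close>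
type_synonym form = "nat set \<Rightarrow> fn"

definition formsOn :: "nat \<Rightarrow> nat set \<Rightarrow> nat \<Rightarrow> form set" where
  "formsOn m Idx q = {\<omega>. \<forall>I. (I \<subseteq> Idx \<and> card I = q \<longrightarrow> \<omega> I \<in> AB m)
                              \<and> (\<not> (I \<subseteq> Idx \<and> card I = q) \<longrightarrow> \<omega> I = (\<lambda>_. 0))}"

definition sgn_ins :: "nat \<Rightarrow> nat set \<Rightarrow> real" where
  "sgn_ins \<mu> I = (-1) ^ card {\<nu>\<in>I. \<nu> < \<mu>}"

definition dOn :: "nat \<Rightarrow> nat set \<Rightarrow> form \<Rightarrow> form" where
  "dOn m Idx \<omega> = (\<lambda>I. if I \<subseteq> Idx then
       (\<lambda>y. \<Sum>\<mu>\<in>I. sgn_ins \<mu> (I - {\<mu>}) * Dt m \<mu> (\<omega> (I - {\<mu>})) y) else (\<lambda>_. 0))"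

definition formEqJ :: "nat \<Rightarrow> form \<Rightarrow> form \<Rightarrow> bool" where
  "formEqJ m \<omega> \<eta> \<longleftrightarrow> (\<forall>I. eqJ m (\<omega> I) (\<eta> I))"

definition Mset :: "nat \<Rightarrow> nat set" where "Mset m = {1..m}"
definition Nset :: "nat \<Rightarrow> nat set" where "Nset m = {2..m}"

text \<open>Horizontal complex of CPE (coefficients in A(CPE), via representatives).\<close>
definition Hcocycles :: "nat \<Rightarrow> nat \<Rightarrow> form set" where
  "Hcocycles m q = {\<omega> \<in> formsOn m (Mset m) q. formEqJ m (dOn m (Mset m) \<omega>) (\<lambda>_ _. 0)}"

definition Hcobound :: "nat \<Rightarrow> nat \<Rightarrow> form set" where
  "Hcobound m q = {\<omega> \<in> formsOn m (Mset m) q.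
      if q = 0 then formEqJ m \<omega> (\<lambda>_ _. 0)
      else (\<exists>\<eta> \<in> formsOn m (Mset m) (q - 1). formEqJ m \<omega> (dOn m (Mset m) \<eta>))}"

definition Tcocycles :: "nat \<Rightarrow> nat \<Rightarrow> form set" where
  "Tcocycles m q = {\<theta> \<in> formsOn m (Nset m) q. formEqJ m (dOn m (Nset m) \<theta>) (\<lambda>_ _. 0)}"

definition Tcobound :: "nat \<Rightarrow> nat \<Rightarrow> form set" where
  "Tcobound m q = {\<theta> \<in> formsOn m (Nset m) q.
      if q = 0 then formEqJ m \<theta> (\<lambda>_ _. 0)
      else (\<exists>\<eta> \<in> formsOn m (Nset m) (q - 1). formEqJ m \<theta> (dOn m (Nset m) \<eta>))}"

definition D1form :: "nat \<Rightarrow> form \<Rightarrow> form" where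
  "D1form m \<theta> = (\<lambda>I. Dt m 1 (\<theta> I))"

text \<open>ker D_1^{m-1} (representatives) and H^{m-1}(Theta)/im D_1^{m-1} (denominator).\<close>
definition kerD1 :: "nat \<Rightarrow> form set" where
  "kerD1 m = {\<theta> \<in> Tcocycles m (m - 1). D1form m \<theta> \<in> Tcobound m (m - 1)}"

definition TcoboundPlusImD1 :: "nat \<Rightarrow> form set" where
  "TcoboundPlusImD1 m = {\<theta> \<in> formsOn m (Nset m) (m - 1).
      \<exists>\<beta> \<in> Tcobound m (m - 1). \<exists>\<zeta> \<in> Tcocycles m (m - 1).
         formEqJ m \<theta> (\<lambda>I y. \<beta> I y + D1form m \<zeta> I y)}"

definition fadd :: "form \<Rightarrow> form \<Rightarrow> form" where
  "fadd \<omega> \<eta> = (\<lambda>I y. \<omega> I y + \<eta> I y)"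
definition fscale :: "real \<Rightarrow> form \<Rightarrow> form" where
  "fscale c \<omega> = (\<lambda>I y. c * \<omega> I y)"

text \<open>Families (chi_u, (chi^k_alpha)_{k,alpha}, chi_{p,0}, chi_{p,1}); chi^k_alpha is
  \<open>ck k alpha\<close>.\<close>
type_synonym fam = "fn \<times> (nat \<Rightarrow> nat \<Rightarrow> fn) \<times> fn \<times> fn"

definition famadd :: "fam \<Rightarrow> fam \<Rightarrow> fam" where
  "famadd a b = (case a of (u, c, p0, p1) \<Rightarrow> case b of (u', c', p0', p1') \<Rightarrow>
     (\<lambda>y. u y + u' y, \<lambda>k \<alpha> y. c k \<alpha> y + c' k \<alpha> y, \<lambda>y. p0 y + p0' y, \<lambda>y. p1 y + p1' y))"
definition famscale :: "real \<Rightarrow> fam \<Rightarrow> fam" where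
  "famscale r a = (case a of (u, c, p0, p1) \<Rightarrow>
     (\<lambda>y. r * u y, \<lambda>k \<alpha> y. r * c k \<alpha> y, \<lambda>y. r * p0 y, \<lambda>y. r * p1 y))"

definition Fams :: "nat \<Rightarrow> fam set" where
  "Fams m = {(u, c, p0, p1). u \<in> AB m \<and> p0 \<in> AB m \<and> p1 \<in> AB m
      \<and> (\<forall>k \<alpha>. (\<alpha> \<in> Nset m \<longrightarrow> c k \<alpha> \<in> AB m) \<and> (\<alpha> \<notin> Nset m \<longrightarrow> c k \<alpha> = (\<lambda>_. 0)))
      \<and> (\<exists>K. \<forall>k\<ge>K. \<forall>\<alpha>\<in>Nset m. eqJ m (c k \<alpha>) (\<lambda>_. 0))}"

definition famEqJ :: "nat \<Rightarrow> fam \<Rightarrow> fam \<Rightarrow> bool" where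
  "famEqJ m a b = (case a of (u, c, p0, p1) \<Rightarrow> case b of (u', c', p0', p1') \<Rightarrow>
     eqJ m u u' \<and> (\<forall>k. \<forall>\<alpha>\<in>Nset m. eqJ m (c k \<alpha>) (c' k \<alpha>)) \<and> eqJ m p0 p0' \<and> eqJ m p1 p1')"

definition famZeroJ :: "nat \<Rightarrow> fam set" where
  "famZeroJ m = {a \<in> Fams m. famEqJ m a (\<lambda>_. 0, \<lambda>_ _ _. 0, \<lambda>_. 0, \<lambda>_. 0)}"

definition mulf :: "fn \<Rightarrow> fn \<Rightarrow> fn" where "mulf f g = (\<lambda>y. f y * g y)"

definition Sspace :: "nat \<Rightarrow> fam set" where
  "Sspace m = {(u, c, p0, p1) \<in> Fams m.
     eqJ m (\<lambda>y. Dt m 1 u y + 2 * (\<Sum>\<alpha>\<in>Nset m. Dt m \<alpha> (mulf (coord (U \<alpha> (unit 1))) p1) y)) (\<lambda>_. 0)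
   \<and> (\<forall>k. \<forall>\<alpha>\<in>Nset m. eqJ m (\<lambda>y.
        Dt m 1 (c k \<alpha>) y
        + (if k = 0 then Dt m \<alpha> u y else 0)
        + (if k = 0 then 0 else c (k - 1) \<alpha> y)
        + 2 * ((if k = 0 then Dt m \<alpha> (\<lambda>z. (\<Sum>\<beta>\<in>Nset m. z (U \<beta> (unit \<beta>))) * p1 z) y else 0)
               - (if k = 1 then y (U 1 (unit \<alpha>)) * p1 y else 0)
               + (if k = 0 then (\<Sum>\<beta>\<in>Nset m. Dt m \<beta> (mulf (coord (U \<beta> (unit \<alpha>))) p1) y) else 0)))
        (\<lambda>_. 0))
   \<and> eqJ m (\<lambda>y. Dt m 1 p0 y - (\<Sum>\<alpha>\<in>Nset m. Dt m \<alpha> (Dt m \<alpha> p1) y)) (\<lambda>_. 0)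
   \<and> eqJ m (\<lambda>y. Dt m 1 p1 y + p0 y) (\<lambda>_. 0)}"

text \<open>Partial variational derivatives w.r.t. x^2..x^m, computed on the free-coordinate
  representative of L.\<close>
definition validJ :: "nat \<Rightarrow> mi \<Rightarrow> bool" where
  "validJ m j \<longleftrightarrow> valid_mi m j \<and> j 1 = 0"

definition shiftj :: "var \<Rightarrow> mi \<Rightarrow> var" where
  "shiftj v j = (case v of X \<nu> \<Rightarrow> X \<nu> | U l i \<Rightarrow> U l (\<lambda>k. i k + j k) | P i \<Rightarrow> P (\<lambda>k. i k + j k))"

definition negDj :: "nat \<Rightarrow> mi \<Rightarrow> fn \<Rightarrow> fn" where
  "negDj m j f = foldr (\<lambda>\<alpha> g. ((\<lambda>h y. - Dt m \<alpha> h y) ^^ j \<alpha>) g) [2..<Suc m] f"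

definition vder :: "nat \<Rightarrow> var \<Rightarrow> fn \<Rightarrow> fn" where
  "vder m v L = (let g = nf m L in
     (\<lambda>y. \<Sum>j\<in>{j. validJ m j \<and> partial (shiftj v j) g \<noteq> (\<lambda>_. 0)}.
            negDj m j (partial (shiftj v j) g) y))"

definition vdfam :: "nat \<Rightarrow> fn \<Rightarrow> fam" where
  "vdfam m L = (vder m (U 1 (\<lambda>_. 0)) L,
                \<lambda>k \<alpha>. if \<alpha> \<in> Nset m then vder m (U \<alpha> (at1 k)) L else (\<lambda>_. 0),
                vder m (P (\<lambda>_. 0)) L,
                vder m (P (at1 1)) L)"

definition Hspace :: "nat \<Rightarrow> fam set" where
  "Hspace m = {a \<in> Fams m. \<exists>L \<in> AB m. famEqJ m a (vdfam m L)}"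

section \<open>Linear isomorphism of quotient spaces Z1/E1 and Z2/E2 (via representatives)\<close>

definition quot_iso ::
  "('a \<Rightarrow> 'a \<Rightarrow> 'a) \<Rightarrow> (real \<Rightarrow> 'a \<Rightarrow> 'a) \<Rightarrow> 'a set \<Rightarrow> 'a set \<Rightarrow>
   ('b \<Rightarrow> 'b \<Rightarrow> 'b) \<Rightarrow> (real \<Rightarrow> 'b \<Rightarrow> 'b) \<Rightarrow> 'b set \<Rightarrow> 'b set \<Rightarrow> bool" where
  "quot_iso addA scA Z1 E1 addB scB Z2 E2 \<longleftrightarrow>
     (\<exists>\<phi>. (\<forall>x\<in>Z1. \<phi> x \<in> Z2)
        \<and> (\<forall>x\<in>Z1. \<forall>x'\<in>Z1. \<phi> (addA x x') = addB (\<phi> x) (\<phi> x'))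
        \<and> (\<forall>c. \<forall>x\<in>Z1. \<phi> (scA c x) = scB c (\<phi> x))
        \<and> (\<forall>x\<in>Z1. \<phi> x \<in> E2 \<longleftrightarrow> x \<in> E1)
        \<and> (\<forall>z\<in>Z2. \<exists>x\<in>Z1. addB z (scB (-1) (\<phi> x)) \<in> E2))"

end

theory Submission
  imports Defs "HOL-Library.Function_Algebras"
begin

text \<open>
Functions of the free coordinates represent the classes modulo the ideal uniquely, and on them
\<open>D\<^sub>2, \<dots>, D\<^sub>m\<close> act as the total derivatives of a free jet space, while \<open>D\<^sub>1\<close> acts as a further vector
field commuting with them. Splitting off one differential at a time makes every complex the cone of
a single derivation on a smaller complex, so the cohomology is read off inductively from the kernel and
cokernel of that derivation. In top degree an \<open>N\<close>-divergence is recognised by the vanishing of its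
variational derivatives: integration by parts brings the vertical differential of \<open>f\<close> into a unique form
without \<open>N\<close>-derivatives of the coordinates, up to Lie derivatives, and integrating along
\<open>t \<mapsto> f(x, t u)\<close> recovers \<open>f\<close> from its vertical differential. Finally \<open>\<delta>(D\<^sub>1 L)\<close> is the linear system
of \<open>S\<close> applied to \<open>\<delta>L\<close>, because \<open>D\<^sub>1\<close> acts on vertical forms compatibly with \<open>D\<^sub>2, \<dots>, D\<^sub>m\<close>.
\<close>

section \<open>Linear maps on subspaces of function spaces\<close>

instantiation "fun" :: (type, real_vector) real_vector
begin

definition scaleR_fun :: "real \<Rightarrow> ('a \<Rightarrow> 'b) \<Rightarrow> 'a \<Rightarrow> 'b" where
  "scaleR_fun c f = (\<lambda>x. c *\<^sub>R f x)"

instance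
  by standard (simp_all add: scaleR_fun_def fun_eq_iff scaleR_add_right scaleR_add_left)

end

lemma scaleR_fun_apply: "(c *\<^sub>R f) x = c *\<^sub>R f x"
  by (simp add: scaleR_fun_def)

instance "fun" :: (type, real_algebra) real_algebra
  by standard (simp_all add: fun_eq_iff scaleR_fun_apply)

lemma sum_fun_apply: "(\<Sum>i\<in>I. f i) x = (\<Sum>i\<in>I. f i x)"
  by (induction I rule: infinite_finite_induct) simp_all

lemma fun_zero_iff: "f = 0 \<longleftrightarrow> (\<forall>x. f x = 0)"
  by (auto simp: fun_eq_iff zero_fun_apply)

lemma coord_apply: "coord v y = y v"
  by (simp add: coord_def)

text \<open>As default rewrite rules these would turn \<open>f + g\<close> into \<open>\<lambda>x. f x + g x\<close> wherever the simplifier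
  meets an eta-expanded term.\<close>

lemmas pointwise = plus_fun_apply zero_fun_apply times_fun_apply one_fun_apply
  minus_apply uminus_apply scaleR_fun_apply sum_fun_apply coord_apply

declare pointwise [simp del]

definition linear_on :: "'a::real_vector set \<Rightarrow> ('a \<Rightarrow> 'b::real_vector) \<Rightarrow> bool" where
  "linear_on S T \<longleftrightarrow> (\<forall>x\<in>S. \<forall>y\<in>S. T (x + y) = T x + T y) \<and> (\<forall>c. \<forall>x\<in>S. T (c *\<^sub>R x) = c *\<^sub>R T x)"

lemma linear_onI:
  assumes "\<And>x y. x \<in> S \<Longrightarrow> y \<in> S \<Longrightarrow> T (x + y) = T x + T y" "\<And>c x. x \<in> S \<Longrightarrow> T (c *\<^sub>R x) = c *\<^sub>R T x"
  shows "linear_on S T"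
  using assms by (simp add: linear_on_def)

lemma linear_on_add: "linear_on S T \<Longrightarrow> x \<in> S \<Longrightarrow> y \<in> S \<Longrightarrow> T (x + y) = T x + T y"
  by (simp add: linear_on_def)

lemma linear_on_scaleR: "linear_on S T \<Longrightarrow> x \<in> S \<Longrightarrow> T (c *\<^sub>R x) = c *\<^sub>R T x"
  by (simp add: linear_on_def)

lemma linear_on_subset: "linear_on S T \<Longrightarrow> R \<subseteq> S \<Longrightarrow> linear_on R T"
  unfolding linear_on_def by blast

lemma linear_on_uminus: "linear_on S T \<Longrightarrow> x \<in> S \<Longrightarrow> T (- x) = - T x"
  using linear_on_scaleR[of S T x "-1"] by simp

lemma linear_on_zero: "linear_on S T \<Longrightarrow> subspace S \<Longrightarrow> T 0 = 0"
  using linear_on_scaleR[of S T 0 0] subspace_0[of S] by simp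

lemma linear_on_diff: "linear_on S T \<Longrightarrow> subspace S \<Longrightarrow> x \<in> S \<Longrightarrow> y \<in> S \<Longrightarrow> T (x - y) = T x - T y"
  using linear_on_add[of S T x "- y"] by (simp add: linear_on_uminus subspace_neg)

lemma linear_on_sum:
  assumes "linear_on S T" "subspace S" "\<And>i. i \<in> I \<Longrightarrow> f i \<in> S"
  shows "T (\<Sum>i\<in>I. f i) = (\<Sum>i\<in>I. T (f i))"
  using assms(3)
  by (induction I rule: infinite_finite_induct)
    (simp_all add: linear_on_zero[OF assms(1,2)] linear_on_add[OF assms(1)] subspace_sum[OF assms(2)])

lemma linear_on_compose:
  assumes "linear_on S T" "linear_on R T'" "\<And>x. x \<in> S \<Longrightarrow> T x \<in> R"
  shows "linear_on S (\<lambda>x. T' (T x))"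
  using assms by (simp add: linear_on_def)

lemma linear_on_add_fun: "linear_on S T \<Longrightarrow> linear_on S T' \<Longrightarrow> linear_on S (\<lambda>x. T x + T' x)"
  by (simp add: linear_on_def scaleR_add_right)

lemma linear_on_scaleR_fun: "linear_on S T \<Longrightarrow> linear_on S (\<lambda>x. c *\<^sub>R T x)"
  by (simp add: linear_on_def scaleR_add_right)

lemma linear_on_diff_fun: "linear_on S T \<Longrightarrow> linear_on S T' \<Longrightarrow> linear_on S (\<lambda>x. T x - T' x)"
  by (simp add: linear_on_def scaleR_diff_right)

lemma linear_on_if_fun:
  "(B \<Longrightarrow> linear_on S T) \<Longrightarrow> (\<not> B \<Longrightarrow> linear_on S T') \<Longrightarrow> linear_on S (\<lambda>x. if B then T x else T' x)"
  by (cases B) simp_all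

lemma linear_on_uminus_fun: "linear_on S T \<Longrightarrow> linear_on S (\<lambda>x. - T x)"
  by (simp add: linear_on_def)

lemma linear_on_sum_fun: "(\<And>i. i \<in> I \<Longrightarrow> linear_on S (T i)) \<Longrightarrow> linear_on S (\<lambda>x. \<Sum>i\<in>I. T i x)"
  by (simp add: linear_on_def sum.distrib scaleR_right.sum)

lemma linear_on_span:
  assumes "linear_on V T" "subspace V" "subspace W" "S \<subseteq> V" "\<And>x. x \<in> S \<Longrightarrow> T x \<in> W" "x \<in> span S"
  shows "T x \<in> W"
proof -
  have "subspace {x \<in> V. T x \<in> W}"
    using assms(2,3) linear_on_zero[OF assms(1,2)] unfolding subspace_def
    by (auto simp: linear_on_add[OF assms(1)] linear_on_scaleR[OF assms(1)])
  moreover have "S \<subseteq> {x \<in> V. T x \<in> W}" using assms(4,5) by blast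
  ultimately show ?thesis using span_minimal assms(6) by blast
qed

lemma linear_on_subspace_image:
  assumes "linear_on V T" "subspace V" shows "subspace (T ` V)"
  unfolding subspace_def
proof (intro conjI ballI allI)
  show "0 \<in> T ` V" using linear_on_zero[OF assms] subspace_0[OF assms(2)] by force
  show "x + y \<in> T ` V" if "x \<in> T ` V" "y \<in> T ` V" for x y
    using that linear_on_add[OF assms(1)] subspace_add[OF assms(2)] by (smt (verit) image_iff)
  show "c *\<^sub>R x \<in> T ` V" if "x \<in> T ` V" for c x
    using that linear_on_scaleR[OF assms(1)] subspace_scale[OF assms(2)] by (smt (verit) image_iff)
qed

section \<open>Smooth functions of finitely many coordinates\<close>

definition depends_on :: "fn \<Rightarrow> var set \<Rightarrow> bool" where
  "depends_on f S \<longleftrightarrow> (\<forall>y z. (\<forall>v\<in>S. y v = z v) \<longrightarrow> f y = f z)"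

definition finitely_dependent :: "fn \<Rightarrow> var set \<Rightarrow> bool" where
  "finitely_dependent f V \<longleftrightarrow> (\<exists>S. finite S \<and> S \<subseteq> V \<and> depends_on f S)"

primrec C_k :: "nat \<Rightarrow> var set \<Rightarrow> fn set" where
  "C_k 0 V = {f. finitely_dependent f V \<and> continuous_on UNIV f}"
| "C_k (Suc k) V = {f. finitely_dependent f V \<and> continuous_on UNIV f \<and>
     (\<forall>v. partial v f \<in> C_k k V \<and> (\<forall>y. (\<lambda>t. f (y(v := t))) differentiable (at (y v))))}"

definition smooth :: "var set \<Rightarrow> fn set" where
  "smooth V = (\<Inter>k. C_k k V)"

lemma depends_onD: "depends_on f S \<Longrightarrow> (\<And>v. v \<in> S \<Longrightarrow> y v = z v) \<Longrightarrow> f y = f z"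
  unfolding depends_on_def by blast

lemma depends_on_mono: "depends_on f S \<Longrightarrow> S \<subseteq> T \<Longrightarrow> depends_on f T"
  unfolding depends_on_def by blast

lemma depends_on_coord: "depends_on (coord w) {w}"
  by (simp add: depends_on_def coord_def)

lemma depends_on_add: "depends_on f S \<Longrightarrow> depends_on g S \<Longrightarrow> depends_on (f + g) S"
  unfolding depends_on_def by (metis plus_fun_apply)

lemma depends_on_mult: "depends_on f S \<Longrightarrow> depends_on g S \<Longrightarrow> depends_on (f * g) S"
  unfolding depends_on_def by (metis times_fun_apply)

lemma depends_on_scaleR: "depends_on f S \<Longrightarrow> depends_on (c *\<^sub>R f) S"
  unfolding depends_on_def by (metis scaleR_fun_apply)

lemma partial_cong:
  assumes "depends_on f S" "\<And>u. u \<in> S \<Longrightarrow> y u = z u"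
  shows "partial v f y = partial v f z"
proof (cases "v \<in> S")
  case True
  then have "(\<lambda>t. f (y(v := t))) = (\<lambda>t. f (z(v := t)))" "y v = z v"
    using assms by (auto intro!: depends_onD[OF assms(1)])
  then show ?thesis unfolding partial_def by simp
next
  case False
  then have "f (y(v := t)) = f y" "f (z(v := t)) = f z" for t
    by (auto intro!: depends_onD[OF assms(1)])
  then show ?thesis unfolding partial_def by simp
qed

lemma depends_on_partial: "depends_on f S \<Longrightarrow> depends_on (partial v f) S"
  unfolding depends_on_def[of "partial v f"] using partial_cong by blast

lemma partial_outside:
  assumes "depends_on f S" "v \<notin> S" shows "partial v f = 0"
proof
  fix y
  have "f (y(v := t)) = f y" for t
    using assms by (intro depends_onD[OF assms(1)]) auto
  then show "partial v f y = 0 y" unfolding partial_def by (simp add: pointwise)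
qed

lemma partial_eqI:
  "((\<lambda>t. f (y(v := t))) has_real_derivative d) (at (y v)) \<Longrightarrow> partial v f y = d"
  unfolding partial_def by (rule DERIV_imp_deriv)

lemma partial_const [simp]: "partial v (\<lambda>_. c) = 0"
  by (simp add: partial_def fun_eq_iff pointwise)

lemma partial_zero [simp]: "partial v 0 = 0" and partial_one [simp]: "partial v 1 = 0"
  using partial_const[of v 0] partial_const[of v 1] by (simp_all add: zero_fun_def one_fun_def)

lemma partial_coord: "partial v (coord w) = (if v = w then 1 else 0)"
proof
  fix y show "partial v (coord w) y = (if v = w then 1 else 0) y"
    by (rule partial_eqI) (auto simp: pointwise intro!: derivative_eq_intros)
qed

lemma finitely_dependent_common:
  assumes "finitely_dependent f V" "finitely_dependent g V"
  obtains S where "finite S" "S \<subseteq> V" "depends_on f S" "depends_on g S"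
proof -
  obtain S T where "finite S" "S \<subseteq> V" "depends_on f S" "finite T" "T \<subseteq> V" "depends_on g T"
    using assms unfolding finitely_dependent_def by blast
  then show thesis
    using that[of "S \<union> T"] depends_on_mono by (metis Un_least Un_upper1 Un_upper2 finite_Un)
qed

lemma finitely_dependent_mono: "finitely_dependent f V \<Longrightarrow> V \<subseteq> W \<Longrightarrow> finitely_dependent f W"
  unfolding finitely_dependent_def by blast

lemma finitely_dependent_add: "finitely_dependent f V \<Longrightarrow> finitely_dependent g V \<Longrightarrow> finitely_dependent (f + g) V"
  by (metis finitely_dependent_common depends_on_add finitely_dependent_def)

lemma finitely_dependent_mult:
  "finitely_dependent f V \<Longrightarrow> finitely_dependent g V \<Longrightarrow> finitely_dependent (f * g) V"
  by (metis finitely_dependent_common depends_on_mult finitely_dependent_def)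

lemma finitely_dependent_partial: "finitely_dependent f V \<Longrightarrow> finitely_dependent (partial v f) V"
  unfolding finitely_dependent_def using depends_on_partial by blast

lemma C_k_finitely_dependent: "f \<in> C_k k V \<Longrightarrow> finitely_dependent f V"
  by (cases k) auto

lemma C_k_obtain_dependence:
  assumes "f \<in> C_k k V" obtains S where "finite S" "S \<subseteq> V" "depends_on f S"
  using C_k_finitely_dependent[OF assms] unfolding finitely_dependent_def by blast

lemma C_k_depends_on: "f \<in> C_k k V \<Longrightarrow> depends_on f V"
  by (meson C_k_obtain_dependence depends_on_mono)

lemma C_k_continuous: "f \<in> C_k k V \<Longrightarrow> continuous_on UNIV f"
  by (cases k) auto

lemma C_k_continuous_compose:
  "f \<in> C_k k V \<Longrightarrow> continuous_on A g \<Longrightarrow> continuous_on A (\<lambda>x. f (g x))"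
  using continuous_on_compose2[OF C_k_continuous] by blast

lemma C_k_partial: "f \<in> C_k (Suc k) V \<Longrightarrow> partial v f \<in> C_k k V"
  by simp

lemma C_k_has_partial:
  assumes "f \<in> C_k (Suc k) V"
  shows "((\<lambda>t. f (y(v := t))) has_real_derivative partial v f (y(v := x))) (at x)"
proof -
  have "\<forall>z. (\<lambda>t. f (z(v := t))) differentiable (at (z v))" using assms by simp
  from spec[OF this, of "y(v := x)"] have "(\<lambda>t. f (y(v := t))) differentiable (at x)" by simp
  then have "(\<lambda>t. f (y(v := t))) field_differentiable (at x)"
    by (simp add: real_differentiable_def field_differentiable_def)
  then show ?thesis
    unfolding partial_def using DERIV_deriv_iff_field_differentiable by fastforce
qed

lemma C_k_has_partial_at:
  assumes "f \<in> C_k (Suc k) V"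
  shows "((\<lambda>t. f (y(v := t))) has_real_derivative partial v f y) (at (y v))"
  using C_k_has_partial[OF assms, of y v "y v"] by simp

lemma C_k_SucI:
  assumes "finitely_dependent f V" "continuous_on UNIV f"
    and "\<And>v y. ((\<lambda>t. f (y(v := t))) has_real_derivative f' v y) (at (y v))" "\<And>v. f' v \<in> C_k k V"
  shows "f \<in> C_k (Suc k) V"
proof -
  have "partial v f = f' v" for v by (rule ext, rule partial_eqI, rule assms(3))
  then show ?thesis using assms by (auto simp: real_differentiable_def)
qed

lemma C_k_Suc_subset: "C_k (Suc k) V \<subseteq> C_k k V"
  by (induction k) auto

lemma C_k_mono: "V \<subseteq> W \<Longrightarrow> C_k k V \<subseteq> C_k k W"
  by (induction k) (auto dest: finitely_dependent_mono)

lemma C_k_const: "(\<lambda>_. c) \<in> C_k k V"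
proof (induction k arbitrary: c)
  case (Suc k)
  have "0 \<in> C_k k V" using Suc[of 0] by (simp add: zero_fun_def)
  then show ?case by (simp add: finitely_dependent_def depends_on_def exI[of _ "{}"])
qed (simp add: finitely_dependent_def depends_on_def exI[of _ "{}"])

lemma C_k_coord:
  assumes "w \<in> V" shows "coord w \<in> C_k k V"
proof (cases k)
  case 0
  then show ?thesis
    using assms depends_on_coord
    by (auto simp: finitely_dependent_def coord_def[abs_def] intro!: exI[of _ "{w}"])
next
  case (Suc k)
  show ?thesis unfolding Suc
  proof (rule C_k_SucI[where f' = "\<lambda>v _. if v = w then 1 else 0"])
    show "((\<lambda>t. coord w (y(v := t))) has_real_derivative (if v = w then 1 else 0)) (at (y v))" for v y
      by (auto simp: pointwise intro!: derivative_eq_intros)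
  qed (use assms depends_on_coord C_k_const in
      \<open>auto simp: finitely_dependent_def coord_def[abs_def] intro!: exI[of _ "{w}"]\<close>)
qed

lemma C_k_add: "f \<in> C_k k V \<Longrightarrow> g \<in> C_k k V \<Longrightarrow> f + g \<in> C_k k V"
proof (induction k arbitrary: f g)
  case 0
  then show ?case
    by (auto simp: plus_fun_def intro: finitely_dependent_add[unfolded plus_fun_def] continuous_intros)
next
  case (Suc k)
  note f = Suc.prems(1) and g = Suc.prems(2)
  show ?case
  proof (rule C_k_SucI)
    show "finitely_dependent (f + g) V"
      by (rule finitely_dependent_add[OF f[THEN C_k_finitely_dependent] g[THEN C_k_finitely_dependent]])
    show "continuous_on UNIV (f + g)"
      unfolding plus_fun_def by (rule continuous_on_add[OF f[THEN C_k_continuous] g[THEN C_k_continuous]])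
    show "((\<lambda>t. (f + g) (y(v := t))) has_real_derivative (partial v f + partial v g) y) (at (y v))" for v y
      unfolding plus_fun_apply by (rule DERIV_add[OF f[THEN C_k_has_partial_at] g[THEN C_k_has_partial_at]])
  qed (use Suc in auto)
qed

lemma C_k_mult: "f \<in> C_k k V \<Longrightarrow> g \<in> C_k k V \<Longrightarrow> f * g \<in> C_k k V"
proof (induction k arbitrary: f g)
  case 0
  then show ?case
    by (auto simp: times_fun_def intro: finitely_dependent_mult[unfolded times_fun_def] continuous_intros)
next
  case (Suc k)
  note f = Suc.prems(1) and g = Suc.prems(2)
  show ?case
  proof (rule C_k_SucI)
    show "finitely_dependent (f * g) V"
      by (rule finitely_dependent_mult[OF f[THEN C_k_finitely_dependent] g[THEN C_k_finitely_dependent]])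
    show "continuous_on UNIV (f * g)"
      unfolding times_fun_def by (rule continuous_on_mult[OF f[THEN C_k_continuous] g[THEN C_k_continuous]])
    show "((\<lambda>t. (f * g) (y(v := t))) has_real_derivative (partial v f * g + f * partial v g) y) (at (y v))"
      for v y
      unfolding times_fun_apply plus_fun_apply
      by (rule DERIV_mult[OF f[THEN C_k_has_partial_at] g[THEN C_k_has_partial_at], THEN DERIV_cong]) simp
    show "partial v f * g + f * partial v g \<in> C_k k V" for v
      using Suc.prems C_k_Suc_subset by (intro C_k_add Suc.IH C_k_partial) blast+
  qed
qed

lemma subspace_C_k: "subspace (C_k k V)"
  unfolding subspace_def
proof (intro conjI ballI allI)
  show "0 \<in> C_k k V" using C_k_const[of 0] by (simp add: zero_fun_def)
  show "c *\<^sub>R f \<in> C_k k V" if "f \<in> C_k k V" for c f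
    using C_k_mult[OF C_k_const[of c] that] by (simp add: times_fun_def scaleR_fun_def)
qed (rule C_k_add)

lemma smooth_C_k: "f \<in> smooth V \<Longrightarrow> f \<in> C_k k V"
  by (simp add: smooth_def)

lemmas smooth_obtain_dependence = C_k_obtain_dependence[OF smooth_C_k]
lemmas smooth_depends_on = C_k_depends_on[OF smooth_C_k]
lemmas smooth_has_partial = C_k_has_partial[OF smooth_C_k]
lemmas smooth_has_partial_at = C_k_has_partial_at[OF smooth_C_k]

lemma smooth_mono: "V \<subseteq> W \<Longrightarrow> f \<in> smooth V \<Longrightarrow> f \<in> smooth W"
  unfolding smooth_def using C_k_mono by blast

lemma smooth_const: "(\<lambda>_. c) \<in> smooth V"
  by (simp add: smooth_def C_k_const)

lemma smooth_one: "1 \<in> smooth V"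
  using smooth_const[of 1] by (simp add: one_fun_def)

lemma smooth_coord: "w \<in> V \<Longrightarrow> coord w \<in> smooth V"
  by (simp add: smooth_def C_k_coord)

lemma smooth_partial: "f \<in> smooth V \<Longrightarrow> partial v f \<in> smooth V"
  unfolding smooth_def by (blast intro: C_k_partial)

lemma smooth_mult: "f \<in> smooth V \<Longrightarrow> g \<in> smooth V \<Longrightarrow> f * g \<in> smooth V"
  by (simp add: smooth_def C_k_mult)

lemma subspace_smooth: "subspace (smooth V)"
  unfolding smooth_def by (rule subspace_Inter) (use subspace_C_k in auto)

lemmas smooth_closed = smooth_coord smooth_const smooth_mult smooth_partial
  subspace_0[OF subspace_smooth] subspace_add[OF subspace_smooth] subspace_diff[OF subspace_smooth]
  subspace_neg[OF subspace_smooth] subspace_scale[OF subspace_smooth] subspace_sum[OF subspace_smooth]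
  smooth_one

lemma smooth_partial_outside: "f \<in> smooth V \<Longrightarrow> v \<notin> V \<Longrightarrow> partial v f = 0"
  by (metis partial_outside smooth_depends_on)

lemma smooth_common_dependence:
  assumes "f \<in> smooth V" "g \<in> smooth V"
  obtains S where "finite S" "S \<subseteq> V" "depends_on f S" "depends_on g S"
  using assms by (meson C_k_finitely_dependent finitely_dependent_common smooth_C_k)

lemma smooth_iff_pds:
  "f \<in> smooth V \<longleftrightarrow> finitely_dependent f V \<and>
     (\<forall>vs. continuous_on UNIV (pds vs f) \<and> (\<forall>v y. (\<lambda>t. pds vs f (y(v := t))) differentiable (at (y v))))"
  (is "_ \<longleftrightarrow> ?pds f")
proof
  assume f: "f \<in> smooth V"
  have "pds vs f \<in> smooth V" for vs by (induction vs) (auto simp: f smooth_partial)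
  then have "pds vs f \<in> C_k (Suc 0) V" for vs using smooth_C_k by blast
  then show "?pds f"
    using C_k_finitely_dependent[OF smooth_C_k[OF f]] unfolding C_k.simps(2) by blast
next
  have pds_partial: "pds vs (partial v f) = pds (vs @ [v]) f" for vs v f
    by (induction vs) auto
  have "f \<in> C_k k V" if "?pds f" for k f
    using that
  proof (induction k arbitrary: f)
    case 0
    then show ?case by (metis (mono_tags, lifting) C_k.simps(1) mem_Collect_eq pds.simps(1))
  next
    case (Suc k)
    have "?pds (partial v f)" for v
      using Suc.prems finitely_dependent_partial unfolding pds_partial by blast
    then have "partial v f \<in> C_k k V" for v by (rule Suc.IH)
    moreover have "continuous_on UNIV f" "(\<lambda>t. f (y(v := t))) differentiable (at (y v))" for y v
      using Suc.prems by (metis pds.simps(1))+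
    ultimately show ?case using Suc.prems by simp
  qed
  then show "f \<in> smooth V" if "?pds f" using that by (simp add: smooth_def)
qed

lemma AB_eq_smooth: "AB m = smooth {v. valid_var m v}"
  unfolding AB_def set_eq_iff smooth_iff_pds finitely_dependent_def depends_on_def by blast

lemma partial_mult:
  assumes "f \<in> smooth V" "g \<in> smooth W"
  shows "partial v (f * g) = partial v f * g + f * partial v g"
proof
  fix y
  show "partial v (f * g) y = (partial v f * g + f * partial v g) y"
    by (rule partial_eqI, unfold pointwise, rule DERIV_mult[THEN DERIV_cong])
      (auto intro: smooth_has_partial_at assms)
qed

lemma linear_on_partial: "linear_on (smooth V) (partial v)"
proof (rule linear_onI)
  show "partial v (f + g) = partial v f + partial v g" if "f \<in> smooth V" "g \<in> smooth V" for f g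
    using that unfolding plus_fun_def by (intro ext partial_eqI DERIV_add smooth_has_partial_at)
  show "partial v (c *\<^sub>R f) = c *\<^sub>R partial v f" if "f \<in> smooth V" for c f
    using that unfolding scaleR_fun_def real_scaleR_def
    by (intro ext partial_eqI DERIV_cmult smooth_has_partial_at)
qed

subsection \<open>Chain rule\<close>

lemma tendsto_coordinatewise:
  fixes c :: "'b \<Rightarrow> 'a \<Rightarrow> real"
  assumes "\<And>v. ((\<lambda>t. c t v) \<longlongrightarrow> l v) F"
  shows "(c \<longlongrightarrow> l) F"
proof -
  have "limitin (product_topology (\<lambda>i. euclidean) UNIV) c l F"
    unfolding limitin_componentwise using assms by simp
  then show ?thesis
    by (simp add: euclidean_product_topology)
qed

lemma has_derivative_at_replaced_coordinate:
  assumes f: "f \<in> C_k (Suc k) V"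
    and c: "\<And>v. isCont (\<lambda>t. c t v) x" and d: "((\<lambda>t. f ((c t)(a := u))) has_real_derivative d) (at x)"
  shows "((\<lambda>(t, s). f ((c t)(a := s))) has_derivative (\<lambda>(h, k). d * h + partial a f ((c x)(a := u)) * k))
    (at (x, u))"
proof -
  have "((\<lambda>(t, s). f ((c t)(a := s))) has_derivative
      (\<lambda>(h, k). d * h + blinfun_apply (blinfun_mult_right (partial a f ((c x)(a := u)))) k))
        (at (x, u) within UNIV \<times> UNIV)"
  proof (rule has_derivative_partialsI)
    show "((\<lambda>t. f ((c t)(a := u))) has_derivative (\<lambda>h. d * h)) (at x within UNIV)"
      using d by (simp add: has_field_derivative_def)
    show "((\<lambda>s. f ((c t)(a := s))) has_derivative blinfun_apply (blinfun_mult_right (partial a f ((c t)(a := s)))))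
        (at s within UNIV)" for t s
      using C_k_has_partial[OF f] by (simp add: has_field_derivative_def)
    have "((\<lambda>p. (c (fst p))(a := snd p)) \<longlongrightarrow> (c x)(a := u)) (at (x, u))"
    proof (rule tendsto_coordinatewise)
      have "((\<lambda>p. c (fst p) v) \<longlongrightarrow> c x v) (at (x, u))" for v
        using isCont_o2[of "(x, u)" fst "\<lambda>t. c t v"] c[of v]
        by (simp add: isCont_def[where f = "\<lambda>p. c (fst p) v"])
      then show "((\<lambda>p. ((c (fst p))(a := snd p)) v) \<longlongrightarrow> ((c x)(a := u)) v) (at (x, u))" for v
        by (cases "v = a") (auto intro!: tendsto_eq_intros)
    qed
    then have "((\<lambda>p. partial a f ((c (fst p))(a := snd p))) \<longlongrightarrow> partial a f ((c x)(a := u))) (at (x, u))"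
      by (rule continuous_on_tendsto_compose[OF C_k_continuous[OF C_k_partial[OF f]]]) auto
    then show "continuous (at (x, u) within UNIV \<times> UNIV) (\<lambda>(t, s). blinfun_mult_right (partial a f ((c t)(a := s))))"
      using bounded_linear.tendsto[OF bounded_linear_blinfun_mult_right]
      by (auto simp: continuous_within split_beta')
  qed auto
  then show ?thesis by simp
qed

lemma C_k_has_derivative_along_curve:
  assumes f: "f \<in> C_k (Suc k) V" and S: "finite S" "depends_on f S"
    and c: "\<And>v. v \<in> S \<Longrightarrow> ((\<lambda>t. c t v) has_real_derivative c' v) (at x)"
  shows "((\<lambda>t. f (c t)) has_real_derivative (\<Sum>v\<in>S. partial v f (c x) * c' v)) (at x)"
proof -
  define C where "C T t = (\<lambda>v. if v \<in> T then c t v else c x v)" for T t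
  have "((\<lambda>t. f (C T t)) has_real_derivative (\<Sum>v\<in>T. partial v f (c x) * c' v)) (at x)" if "T \<subseteq> S" for T
    using finite_subset[OF that S(1)] that
  proof (induction T rule: finite_induct)
    case empty
    then show ?case by (simp add: C_def)
  next
    case (insert a T)
    define d where "d = (\<Sum>v\<in>T. partial v f (c x) * c' v)"
    have Cx: "C R x = c x" for R by (auto simp: C_def)
    have "(C T t)(a := c x a) = C T t" for t using insert.hyps by (auto simp: C_def)
    then have "((\<lambda>t. f ((C T t)(a := c x a))) has_real_derivative d) (at x)"
      using insert by (simp add: d_def)
    moreover have "isCont (\<lambda>t. C T t v) x" for v
      using insert.prems DERIV_isCont[OF c, of v] by (cases "v \<in> T") (auto simp: C_def)
    ultimately have D: "((\<lambda>(t, s). f ((C T t)(a := s))) has_derivative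
        (\<lambda>(h, k). d * h + partial a f (c x) * k)) (at (x, c x a))"
      using has_derivative_at_replaced_coordinate
        [OF f, where c = "C T" and x = x and a = a and u = "c x a" and d = d]
      by (simp add: Cx)
    have "((\<lambda>t. (t, c t a)) has_derivative (\<lambda>h. (h, c' a * h))) (at x)"
      using c[of a] insert.prems by (auto simp: has_field_derivative_def intro!: derivative_eq_intros)
    from has_derivative_compose[OF this D]
    have "((\<lambda>t. f ((C T t)(a := c t a))) has_derivative (\<lambda>h. d * h + partial a f (c x) * (c' a * h))) (at x)"
      by simp
    moreover have "(C T t)(a := c t a) = C (insert a T) t" for t by (auto simp: C_def)
    ultimately show ?case
      using insert.hyps by (intro has_derivative_imp_has_field_derivative) (auto simp: d_def algebra_simps)
  qed
  moreover have "(\<lambda>t. f (c t)) = (\<lambda>t. f (C S t))"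
    by (intro ext depends_onD[OF S(2)]) (simp add: C_def)
  ultimately show ?thesis by simp
qed

definition subst :: "(var \<Rightarrow> fn) \<Rightarrow> fn \<Rightarrow> fn" where
  "subst s f = (\<lambda>y. f (\<lambda>v. s v y))"

lemma subst_apply: "subst s f y = f (\<lambda>v. s v y)"
  by (simp add: subst_def)

lemma subst_coord [simp]: "subst s (coord v) = s v"
  by (simp add: subst_def pointwise)

lemma subst_id [simp]: "subst coord f = f"
  by (simp add: subst_def pointwise)

lemma subst_cong: "depends_on f V \<Longrightarrow> (\<And>v. v \<in> V \<Longrightarrow> s v = s' v) \<Longrightarrow> subst s f = subst s' f"
  unfolding subst_def by (rule ext) (erule depends_onD, simp)

lemma depends_on_subst:
  assumes "depends_on f S" "\<And>v. v \<in> S \<Longrightarrow> depends_on (s v) (T v)"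
  shows "depends_on (subst s f) (\<Union>v\<in>S. T v)"
  unfolding depends_on_def[of "subst s f"] subst_apply
proof (intro allI impI depends_onD[OF assms(1)])
  fix y z :: pt and v assume "\<forall>u\<in>\<Union>v\<in>S. T v. y u = z u" "v \<in> S"
  then show "s v y = s v z" by (intro depends_onD[OF assms(2)]) auto
qed

lemma partial_subst:
  assumes f: "f \<in> C_k (Suc k) V" "finite S" "depends_on f S" and s: "\<And>v. v \<in> S \<Longrightarrow> s v \<in> C_k (Suc l) W"
  shows "((\<lambda>t. subst s f (y(w := t))) has_real_derivative (\<Sum>v\<in>S. subst s (partial v f) * partial w (s v)) y) (at (y w))"
    and "partial w (subst s f) = (\<Sum>v\<in>S. subst s (partial v f) * partial w (s v))"
proof -
  show "((\<lambda>t. subst s f (y(w := t))) has_real_derivative (\<Sum>v\<in>S. subst s (partial v f) * partial w (s v)) y) (at (y w))" for y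
    unfolding subst_def sum_fun_apply times_fun_apply
    using C_k_has_derivative_along_curve[OF f, of "\<lambda>t v. s v (y(w := t))" "\<lambda>v. partial w (s v) y" "y w"]
      C_k_has_partial_at[OF s, of _ y w] by simp
  then show "partial w (subst s f) = (\<Sum>v\<in>S. subst s (partial v f) * partial w (s v))"
    by (intro ext partial_eqI)
qed

lemma finitely_dependent_subst:
  assumes f: "finitely_dependent f V" and s: "\<And>v. v \<in> V \<Longrightarrow> finitely_dependent (s v) W"
  shows "finitely_dependent (subst s f) W"
proof -
  obtain S where S: "finite S" "S \<subseteq> V" "depends_on f S" using f by (auto simp: finitely_dependent_def)
  obtain T where T: "\<And>v. v \<in> V \<Longrightarrow> finite (T v) \<and> T v \<subseteq> W \<and> depends_on (s v) (T v)"
    using s unfolding finitely_dependent_def by metis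
  have "depends_on (subst s f) (\<Union>v\<in>S. T v)" using S T by (intro depends_on_subst) auto
  moreover have "finite (\<Union>v\<in>S. T v)" "(\<Union>v\<in>S. T v) \<subseteq> W" using S T by blast+
  ultimately show ?thesis unfolding finitely_dependent_def by blast
qed

lemma C_k_subst:
  assumes "f \<in> C_k k V" "\<And>v. v \<in> V \<Longrightarrow> s v \<in> C_k k W"
  shows "subst s f \<in> C_k k W"
proof -
  define s' where "s' v = (if v \<in> V then s v else 0)" for v
  have s': "s' v \<in> C_k k W" for v using assms(2) subspace_0[OF subspace_C_k] by (auto simp: s'_def)
  have cont: "continuous_on UNIV (subst s' g)" if "g \<in> C_k l V" for g l
    unfolding subst_def
    by (rule C_k_continuous_compose[OF that], rule continuous_on_coordinatewise_then_product)
      (rule C_k_continuous[OF s'])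
  have dep: "finitely_dependent (subst s' g) W" if "g \<in> C_k l V" for g l
    using that s' by (blast intro: finitely_dependent_subst C_k_finitely_dependent)
  have "subst s' f \<in> C_k k W"
    using assms(1) s'
  proof (induction k arbitrary: f)
    case 0
    then show ?case using dep[OF "0.prems"(1)] cont[OF "0.prems"(1)] by (simp only: C_k.simps mem_Collect_eq)
  next
    case (Suc k)
    note f = Suc.prems(1)
    obtain S where S: "finite S" "depends_on f S" using C_k_obtain_dependence[OF f] by metis
    have s'_k: "s' v \<in> C_k k W" for v using Suc.prems(2) C_k_Suc_subset by blast
    show ?case
    proof (rule C_k_SucI[OF dep[OF f] cont[OF f] partial_subst(1)[OF f S Suc.prems(2)]])
      show "(\<Sum>v\<in>S. subst s' (partial v f) * partial w (s' v)) \<in> C_k k W" for w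
        by (intro subspace_sum[OF subspace_C_k] C_k_mult Suc.IH C_k_partial s'_k f Suc.prems(2))
    qed
  qed
  moreover have "subst s f = subst s' f"
    by (rule subst_cong[OF C_k_depends_on[OF assms(1)]]) (simp add: s'_def)
  ultimately show ?thesis by simp
qed

lemma smooth_subst: "f \<in> smooth V \<Longrightarrow> (\<And>v. v \<in> V \<Longrightarrow> s v \<in> smooth W) \<Longrightarrow> subst s f \<in> smooth W"
  unfolding smooth_def by (blast intro: C_k_subst)

subsection \<open>Integration along rays\<close>

definition scale_coords :: "var set \<Rightarrow> real \<Rightarrow> pt \<Rightarrow> pt" where
  "scale_coords B t y = (\<lambda>v. if v \<in> B then t * y v else y v)"

text \<open>The weight \<open>t ^ n\<close> makes the family of these operators closed under partial differentiation.\<close>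

definition ray_integral :: "var set \<Rightarrow> nat \<Rightarrow> fn \<Rightarrow> fn" where
  "ray_integral B n f = (\<lambda>y. integral {0..1} (\<lambda>t. t ^ n * f (scale_coords B t y)))"

lemma scale_coords_1 [simp]: "scale_coords B 1 y = y"
  by (simp add: scale_coords_def fun_eq_iff)

lemma continuous_on_scale_coords:
  assumes "continuous_on A t" "continuous_on A y"
  shows "continuous_on A (\<lambda>x. scale_coords B (t x) (y x))"
proof (rule continuous_on_coordinatewise_then_product)
  fix v
  show "continuous_on A (\<lambda>x. scale_coords B (t x) (y x) v)"
    using assms(1) continuous_on_product_then_coordinatewise[OF assms(2)]
    by (cases "v \<in> B") (auto simp: scale_coords_def intro!: continuous_intros)
qed

lemma continuous_on_fun_upd:
  fixes g :: "'a::topological_space \<Rightarrow> 'b \<Rightarrow> real"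
  assumes "continuous_on A g" "continuous_on A h"
  shows "continuous_on A (\<lambda>x. (g x)(v := h x))"
proof (rule continuous_on_coordinatewise_then_product)
  fix i
  show "continuous_on A (\<lambda>x. ((g x)(v := h x)) i)"
    using assms(2) continuous_on_product_then_coordinatewise[OF assms(1)] by (cases "i = v") auto
qed

lemma ray_integrable:
  assumes "f \<in> C_k k V" shows "(\<lambda>t. t ^ n * f (scale_coords B t y)) integrable_on {0..1}"
  by (intro integrable_continuous_real continuous_intros C_k_continuous_compose[OF assms]
      continuous_on_scale_coords)

lemma ray_integral_has_partial:
  assumes f: "f \<in> C_k (Suc k) V"
  shows "((\<lambda>s. ray_integral B n f (y(w := s))) has_real_derivative
    ray_integral B (if w \<in> B then Suc n else n) (partial w f) y) (at (y w))"
proof -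
  define m where "m = (if w \<in> B then Suc n else n)"
  have "((\<lambda>s. integral (cbox 0 1) (\<lambda>t. t ^ n * f (scale_coords B t (y(w := s))))) has_real_derivative
      integral (cbox 0 1) (\<lambda>t. t ^ m * partial w f (scale_coords B t (y(w := y w))))) (at (y w) within UNIV)"
  proof (rule leibniz_rule_field_derivative)
    fix s t :: real
    define r where "r = (if w \<in> B then t else 1)"
    have upd: "scale_coords B t (y(w := x)) = (scale_coords B t y)(w := r * x)" for x
      by (auto simp: scale_coords_def r_def)
    have "((\<lambda>s. f ((scale_coords B t y)(w := r * s))) has_real_derivative
        partial w f ((scale_coords B t y)(w := r * s)) * r) (at s)"
      by (rule DERIV_chain2[OF C_k_has_partial[OF f]]) (auto intro!: derivative_eq_intros)
    from DERIV_cmult[OF this, of "t ^ n"]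
    show "((\<lambda>s. t ^ n * f (scale_coords B t (y(w := s)))) has_real_derivative
        t ^ m * partial w f (scale_coords B t (y(w := s)))) (at s within UNIV)"
      unfolding upd by (cases "w \<in> B") (simp_all add: r_def m_def algebra_simps)
    show "(\<lambda>t. t ^ n * f (scale_coords B t (y(w := s)))) integrable_on cbox 0 1"
      using ray_integrable[OF f] by simp
  next
    show "continuous_on (UNIV \<times> cbox 0 1) (\<lambda>(s, t). t ^ m * partial w f (scale_coords B t (y(w := s))))"
      unfolding split_beta
      by (intro continuous_intros C_k_continuous_compose[OF C_k_partial[OF f]]
          continuous_on_scale_coords continuous_on_fun_upd)
  qed auto
  then show ?thesis by (simp add: ray_integral_def m_def)
qed

lemma partial_ray_integral:
  "f \<in> smooth V \<Longrightarrow>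
    partial w (ray_integral B n f) = ray_integral B (if w \<in> B then Suc n else n) (partial w f)"
  by (intro ext partial_eqI ray_integral_has_partial smooth_C_k)

lemma depends_on_ray_integral:
  assumes "depends_on f S" shows "depends_on (ray_integral B n f) S"
  unfolding depends_on_def
proof (intro allI impI)
  fix y z :: pt assume "\<forall>v\<in>S. y v = z v"
  then have "f (scale_coords B t y) = f (scale_coords B t z)" for t
    by (intro depends_onD[OF assms]) (simp add: scale_coords_def)
  then show "ray_integral B n f y = ray_integral B n f z" by (simp add: ray_integral_def)
qed

lemma finitely_dependent_ray_integral: "finitely_dependent f V \<Longrightarrow> finitely_dependent (ray_integral B n f) V"
  unfolding finitely_dependent_def using depends_on_ray_integral by blast

lemma continuous_on_ray_integral:
  assumes "f \<in> C_k k V" shows "continuous_on UNIV (ray_integral B n f)"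
proof -
  have "continuous_on UNIV (\<lambda>y. integral (cbox 0 1) (\<lambda>t. t ^ n * f (scale_coords B t y)))"
    by (rule integral_continuous_on_param, unfold split_beta)
      (intro continuous_intros C_k_continuous_compose[OF assms] continuous_on_scale_coords)
  then show ?thesis by (simp add: ray_integral_def)
qed

lemma C_k_ray_integral: "f \<in> C_k k V \<Longrightarrow> ray_integral B n f \<in> C_k k V"
proof (induction k arbitrary: f n)
  case 0
  show ?case
    using finitely_dependent_ray_integral[OF C_k_finitely_dependent[OF 0]] continuous_on_ray_integral[OF 0]
    by (simp only: C_k.simps mem_Collect_eq)
next
  case (Suc k)
  note f = Suc.prems
  show ?case
    by (rule C_k_SucI[OF finitely_dependent_ray_integral[OF C_k_finitely_dependent[OF f]]
          continuous_on_ray_integral[OF f] ray_integral_has_partial[OF f]])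
      (rule Suc.IH[OF C_k_partial[OF f]])
qed

lemma smooth_ray_integral: "f \<in> smooth V \<Longrightarrow> ray_integral B n f \<in> smooth V"
  by (simp add: smooth_def C_k_ray_integral)

lemma linear_on_ray_integral: "linear_on (smooth V) (ray_integral B n)"
proof (rule linear_onI)
  show "ray_integral B n (f + g) = ray_integral B n f + ray_integral B n g"
    if "f \<in> smooth V" "g \<in> smooth V" for f g
    using ray_integrable[OF that(1)[THEN smooth_C_k]] ray_integrable[OF that(2)[THEN smooth_C_k]]
    by (simp add: ray_integral_def fun_eq_iff pointwise distrib_left integral_add)
  show "ray_integral B n (c *\<^sub>R f) = c *\<^sub>R ray_integral B n f" for c f
    by (simp add: ray_integral_def fun_eq_iff pointwise mult.left_commute[of _ c])
qed

lemma ray_integral_mult_coord: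
  "v \<in> B \<Longrightarrow> ray_integral B n (coord v * f) = coord v * ray_integral B (Suc n) f"
  by (simp add: ray_integral_def fun_eq_iff pointwise scale_coords_def algebra_simps
      flip: integral_mult_right)

lemma ray_homotopy:
  assumes f: "f \<in> smooth V" and S: "finite S" "depends_on f S"
  shows "f y - f (scale_coords B 0 y) = (\<Sum>v\<in>S \<inter> B. y v * ray_integral B 0 (partial v f) y)"
proof -
  define c' where "c' v = (if v \<in> B then y v else 0)" for v
  have "((\<lambda>t. scale_coords B t y v) has_real_derivative c' v) (at t)" for t v
    by (auto simp: scale_coords_def c'_def intro!: derivative_eq_intros)
  from C_k_has_derivative_along_curve[OF smooth_C_k[OF f] S, of "\<lambda>t. scale_coords B t y", OF this]
  have "((\<lambda>t. \<Sum>v\<in>S. partial v f (scale_coords B t y) * c' v) has_integral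
      f (scale_coords B 1 y) - f (scale_coords B 0 y)) {0..1}"
    by (intro fundamental_theorem_of_calculus)
      (simp_all only: has_real_derivative_iff_has_vector_derivative[symmetric] has_field_derivative_at_within)
  then have "f y - f (scale_coords B 0 y)
      = integral {0..1} (\<lambda>t. \<Sum>v\<in>S. partial v f (scale_coords B t y) * c' v)"
    by (simp add: integral_unique)
  also have "\<dots> = (\<Sum>v\<in>S. integral {0..1} (\<lambda>t. partial v f (scale_coords B t y) * c' v))"
    using ray_integrable[OF smooth_C_k[OF smooth_partial[OF f]], of 0]
    by (intro integral_sum S(1) integrable_on_mult_left) simp
  also have "\<dots> = (\<Sum>v\<in>S. if v \<in> B then y v * ray_integral B 0 (partial v f) y else 0)"
    by (intro sum.cong refl) (simp add: ray_integral_def c'_def mult.commute)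
  finally show ?thesis by (simp add: sum.inter_restrict[OF S(1)])
qed

lemma partial_coord_mult_ray_integral:
  assumes f: "f \<in> smooth V"
  shows "partial v (coord v * ray_integral {v} 0 f) = f"
proof
  fix y
  define F where "F t = f (scale_coords {v} t y)" for t
  define F' where "F' t = t * partial v f (scale_coords {v} t y)" for t
  have "((\<lambda>t. t * F t) has_real_derivative F t + y v * F' t) (at t)" for t
  proof -
    have scale: "scale_coords {v} t y = y(v := t * y v)" for t by (auto simp: scale_coords_def)
    have "(F has_real_derivative partial v f (y(v := t * y v)) * y v) (at t)"
      unfolding F_def scale
      by (rule DERIV_chain2[OF smooth_has_partial[OF f]]) (auto intro!: derivative_eq_intros)
    from DERIV_mult[OF DERIV_ident this] show ?thesis by (simp add: F'_def scale algebra_simps)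
  qed
  then have "((\<lambda>t. F t + y v * F' t) has_integral 1 * F 1 - 0 * F 0) {0..1}"
    by (intro fundamental_theorem_of_calculus)
      (simp_all only: has_real_derivative_iff_has_vector_derivative[symmetric] has_field_derivative_at_within)
  then have "f y = integral {0..1} (\<lambda>t. F t + y v * F' t)" by (simp add: integral_unique F_def)
  also have "\<dots> = integral {0..1} F + y v * integral {0..1} F'"
    using ray_integrable[OF smooth_C_k[OF f], of 0] ray_integrable[OF smooth_C_k[OF smooth_partial[OF f]], of 1]
    by (subst integral_add) (auto simp: F_def[abs_def] F'_def[abs_def] intro: integrable_on_mult_right)
  also have "\<dots> = partial v (coord v * ray_integral {v} 0 f) y"
    unfolding partial_mult[OF smooth_coord[OF UNIV_I] smooth_ray_integral[OF f]] partial_ray_integral[OF f]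
    by (simp add: pointwise partial_coord ray_integral_def F_def[abs_def] F'_def[abs_def])
  finally show "partial v (coord v * ray_integral {v} 0 f) y = f y" ..
qed

lemma obtain_coordinate_expansion:
  assumes f: "f \<in> smooth V"
  obtains f\<^sub>0 where "f\<^sub>0 \<in> smooth UNIV" "depends_on f\<^sub>0 (- {a})"
    "f = f\<^sub>0 + coord a * ray_integral {a} 0 (partial a f)"
proof
  define f\<^sub>0 where "f\<^sub>0 = subst (coord(a := 0)) f"
  have f': "f \<in> smooth UNIV" using f smooth_mono by blast
  then show "f\<^sub>0 \<in> smooth UNIV"
    unfolding f\<^sub>0_def by (rule smooth_subst) (auto intro: smooth_closed)
  show "depends_on f\<^sub>0 (- {a})"
    unfolding f\<^sub>0_def by (rule depends_on_mono[OF depends_on_subst[OF smooth_depends_on[OF f'],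
            where T = "\<lambda>v. if v = a then {} else {v}"]])
      (auto simp: depends_on_def pointwise)
  obtain S where S: "finite S" "depends_on f S" using smooth_obtain_dependence[OF f] by metis
  have "f (scale_coords {a} 0 y) = f\<^sub>0 y" for y
    unfolding f\<^sub>0_def subst_def by (rule arg_cong[where f = f]) (auto simp: scale_coords_def pointwise)
  then show "f = f\<^sub>0 + coord a * ray_integral {a} 0 (partial a f)"
    using ray_homotopy[OF f, of "insert a S" _ "{a}"] S depends_on_mono[OF S(2) subset_insertI]
    by (simp add: fun_eq_iff pointwise algebra_simps)
qed

lemma partial_commute:
  assumes f: "f \<in> smooth V" shows "partial a (partial b f) = partial b (partial a f)"
proof (cases "a = b")
  case False
  obtain f\<^sub>0 where f\<^sub>0: "f\<^sub>0 \<in> smooth UNIV" "depends_on f\<^sub>0 (- {a})"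
    and expansion: "f = f\<^sub>0 + coord a * ray_integral {a} 0 (partial a f)"
    using f by (rule obtain_coordinate_expansion)
  define R where "R = ray_integral {a} 0"
  have R: "R g \<in> smooth UNIV" if "g \<in> smooth UNIV" for g
    unfolding R_def using that by (rule smooth_ray_integral)
  have "f \<in> smooth UNIV" using f smooth_mono by blast
  note smooth = f\<^sub>0(1) R smooth_closed this
  have "partial b f = partial b (f\<^sub>0 + coord a * R (partial a f))" using expansion by (simp add: R_def)
  then have "partial b f = partial b f\<^sub>0 + coord a * partial b (R (partial a f))"
    using False linear_on_add[OF linear_on_partial, of f\<^sub>0 UNIV "coord a * R (partial a f)" b]
      partial_mult[of "coord a" UNIV "R (partial a f)" UNIV b]
    by (simp add: smooth partial_coord)
  moreover have "partial b (R (partial a f)) = R (partial b (partial a f))"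
    using False unfolding R_def by (simp add: partial_ray_integral[OF smooth_partial[OF f]])
  ultimately have "partial a (partial b f)
      = partial a (partial b f\<^sub>0 + coord a * R (partial b (partial a f)))"
    by simp
  also have "\<dots> = partial a (partial b f\<^sub>0) + partial a (coord a * R (partial b (partial a f)))"
    by (rule linear_on_add[OF linear_on_partial, of _ UNIV]) (simp_all add: smooth)
  also have "\<dots> = partial b (partial a f)"
    using partial_outside[OF depends_on_partial[OF f\<^sub>0(2)], of a b]
      partial_coord_mult_ray_integral[OF smooth_partial[OF smooth_partial[OF f]]]
    by (simp add: R_def)
  finally show ?thesis .
qed simp

lemma hadamard_division:
  assumes f: "f \<in> smooth V" and h: "h \<in> smooth (V - {v})" and v: "v \<in> V"
  obtains Q where "Q \<in> smooth V" "\<And>y. f y - f (y(v := h y)) = (y v - h y) * Q y"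
proof
  define g where "g = subst (coord(v := coord v + h)) f"
  define Q where "Q = subst (coord(v := coord v - h)) (ray_integral {v} 0 (partial v g))"
  have h': "h \<in> smooth V" using h smooth_mono[of "V - {v}" V] by blast
  have g: "g \<in> smooth V"
    unfolding g_def by (rule smooth_subst[OF f]) (auto intro!: smooth_closed h' v)
  show "Q \<in> smooth V"
    unfolding Q_def by (rule smooth_subst[OF smooth_ray_integral[OF smooth_partial[OF g]]])
      (auto intro!: smooth_closed h' v)
  fix y
  define z where "z = y(v := y v - h y)"
  have h_upd: "h (x(v := t)) = h x" for x t by (rule depends_onD[OF smooth_depends_on[OF h]]) auto
  have g_apply: "g x = f (x(v := x v + h x))" for x
    unfolding g_def subst_def by (rule arg_cong[where f = f]) (auto simp: pointwise)
  obtain S where S: "finite S" "depends_on g S" using smooth_obtain_dependence[OF g] by metis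
  have "g z - g (z(v := 0)) = z v * ray_integral {v} 0 (partial v g) z"
  proof -
    have "scale_coords {v} 0 z = z(v := 0)" by (auto simp: scale_coords_def)
    then show ?thesis
      using ray_homotopy[OF g, of "insert v S" z "{v}"] S depends_on_mono[OF S(2) subset_insertI] by simp
  qed
  moreover have "g z = f y" "g (z(v := 0)) = f (y(v := h y))"
    unfolding g_apply by (auto simp: z_def h_upd)
  moreover have "Q y = ray_integral {v} 0 (partial v g) z"
    unfolding Q_def subst_def by (rule arg_cong[where f = "ray_integral _ _ _"]) (auto simp: z_def pointwise)
  ultimately show "f y - f (y(v := h y)) = (y v - h y) * Q y" by (simp add: z_def)
qed

lemma smooth_restrict:
  assumes f: "f \<in> smooth V" and zero: "\<And>v. v \<notin> W \<Longrightarrow> partial v f = 0"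
  shows "f \<in> smooth W"
proof -
  obtain S where S: "finite S" "S \<subseteq> V" "depends_on f S" using smooth_obtain_dependence[OF f] by metis
  have const: "f (y(v := t)) = f y" if "v \<notin> W" for v y t
    using DERIV_isconst_all[of "\<lambda>t. f (y(v := t))" t "y v"] smooth_has_partial[OF f, of y v] zero[OF that]
    by (simp add: pointwise)
  have "depends_on f (S \<inter> W)"
    unfolding depends_on_def
  proof (intro allI impI)
    fix y z :: pt assume yz: "\<forall>v\<in>S \<inter> W. y v = z v"
    have "f (override_on y z T) = f y" if "finite T" "T \<subseteq> S - W" for T
      using that
    proof (induction T rule: finite_induct)
      case (insert a T)
      then show ?case by (metis DiffD2 const insert_subset override_on_insert)
    qed simp
    from this[of "S - W"] have "f y = f (override_on y z (S - W))" using S by simp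
    also have "\<dots> = f z" using yz by (intro depends_onD[OF S(3)]) (auto simp: override_on_def)
    finally show "f y = f z" .
  qed
  then show ?thesis
    using f S(1) unfolding smooth_iff_pds finitely_dependent_def by blast
qed

subsection \<open>Derivatives along vector fields\<close>

definition lie :: "(var \<Rightarrow> fn) \<Rightarrow> fn \<Rightarrow> fn" where
  "lie a f = (\<Sum>v | partial v f \<noteq> 0. a v * partial v f)"

lemma lie_eq_sum:
  assumes "finite S" "depends_on f S" shows "lie a f = (\<Sum>v\<in>S. a v * partial v f)"
proof -
  have "{v. partial v f \<noteq> 0} \<subseteq> S" using partial_outside[OF assms(2)] by blast
  then show ?thesis unfolding lie_def by (intro sum.mono_neutral_left assms) auto
qed

lemma lie_const [simp]: "lie a (\<lambda>_. c) = 0"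
  by (simp add: lie_def)

lemma lie_coord [simp]: "lie a (coord w) = a w"
  by (simp add: lie_eq_sum[OF _ depends_on_coord] partial_coord)

lemma smooth_lie:
  assumes f: "f \<in> smooth V" and a: "\<And>v. v \<in> V \<Longrightarrow> a v \<in> smooth V" shows "lie a f \<in> smooth V"
  unfolding lie_def using f a smooth_partial_outside
  by (intro subspace_sum[OF subspace_smooth] smooth_mult smooth_partial) auto

lemma linear_on_lie: "linear_on (smooth V) (lie a)"
proof (rule linear_onI)
  fix f assume f: "f \<in> smooth V"
  show "lie a (f + g) = lie a f + lie a g" if g: "g \<in> smooth V" for g
  proof -
    obtain S where S: "finite S" "depends_on f S" "depends_on g S"
      using smooth_common_dependence[OF f g] by metis
    then show ?thesis
      by (simp add: lie_eq_sum[OF S(1) depends_on_add[OF S(2,3)]] lie_eq_sum[OF S(1,2)] lie_eq_sum[OF S(1,3)]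
          linear_on_add[OF linear_on_partial f g] sum.distrib distrib_left)
  qed
  show "lie a (c *\<^sub>R f) = c *\<^sub>R lie a f" for c
  proof -
    obtain S where S: "finite S" "depends_on f S" using smooth_obtain_dependence[OF f] by metis
    then show ?thesis
      by (simp add: lie_eq_sum[OF S(1) depends_on_scaleR[OF S(2)]] lie_eq_sum[OF S]
          linear_on_scaleR[OF linear_on_partial f] scaleR_right.sum)
  qed
qed

lemma lie_mult:
  assumes f: "f \<in> smooth V" and g: "g \<in> smooth V"
  shows "lie a (f * g) = lie a f * g + f * lie a g"
proof -
  obtain S where S: "finite S" "depends_on f S" "depends_on g S"
    using smooth_common_dependence[OF f g] by metis
  then show ?thesis
    by (simp add: lie_eq_sum[OF S(1) depends_on_mult[OF S(2,3)]] lie_eq_sum[OF S(1,2)] lie_eq_sum[OF S(1,3)]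
        partial_mult[OF f g] sum.distrib algebra_simps sum_distrib_left sum_distrib_right)
qed

lemma lie_subst:
  assumes f: "f \<in> smooth V" "finite S" "depends_on f S" and s: "\<And>v. v \<in> S \<Longrightarrow> s v \<in> smooth W"
  shows "lie a (subst s f) = (\<Sum>v\<in>S. subst s (partial v f) * lie a (s v))"
proof -
  have "\<forall>v\<in>S. \<exists>T. finite T \<and> depends_on (s v) T" using s smooth_obtain_dependence by metis
  then obtain T where T: "\<And>v. v \<in> S \<Longrightarrow> finite (T v)" "\<And>v. v \<in> S \<Longrightarrow> depends_on (s v) (T v)" by metis
  let ?T = "\<Union>v\<in>S. T v"
  have fin: "finite ?T" using T f by auto
  have dep: "depends_on (s v) ?T" if "v \<in> S" for v using T that depends_on_mono by blast
  have "lie a (subst s f) = (\<Sum>w\<in>?T. a w * partial w (subst s f))"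
    by (rule lie_eq_sum[OF fin depends_on_subst[OF f(3) T(2)]])
  also have "\<dots> = (\<Sum>w\<in>?T. \<Sum>v\<in>S. subst s (partial v f) * (a w * partial w (s v)))"
    using partial_subst(2)[OF smooth_C_k[OF f(1)] f(2,3) smooth_C_k[OF s]]
    by (simp add: sum_distrib_left algebra_simps)
  also have "\<dots> = (\<Sum>v\<in>S. subst s (partial v f) * lie a (s v))"
    using dep by (subst sum.swap) (simp add: lie_eq_sum[OF fin] sum_distrib_left)
  finally show ?thesis .
qed

lemma partial_lie:
  assumes f: "f \<in> smooth V" "finite S" "depends_on f S" and a: "\<And>v. v \<in> S \<Longrightarrow> a v \<in> smooth W"
  shows "partial u (lie a f) = lie a (partial u f) + (\<Sum>v\<in>S. partial u (a v) * partial v f)"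
proof -
  have f': "f \<in> smooth UNIV" and a': "\<And>v. v \<in> S \<Longrightarrow> a v \<in> smooth UNIV" using f a smooth_mono by blast+
  have "partial u (lie a f) = (\<Sum>v\<in>S. partial u (a v * partial v f))"
    unfolding lie_eq_sum[OF f(2,3)] using f' a'
    by (intro linear_on_sum[OF linear_on_partial subspace_smooth] smooth_mult smooth_partial)
  also have "\<dots> = (\<Sum>v\<in>S. partial u (a v) * partial v f + a v * partial v (partial u f))"
    by (intro sum.cong refl)
      (simp add: partial_mult[OF a' smooth_partial[OF f']] partial_commute[OF f', of u])
  finally show ?thesis
    by (simp add: lie_eq_sum[OF f(2) depends_on_partial[OF f(3)]] sum.distrib add.commute)
qed

lemma lie_lie:
  assumes f: "f \<in> smooth V" "finite S" "S \<subseteq> V" "depends_on f S" and b: "\<And>v. v \<in> V \<Longrightarrow> b v \<in> smooth V"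
  shows "lie a (lie b f)
      = (\<Sum>v\<in>S. lie a (b v) * partial v f) + (\<Sum>v\<in>S. \<Sum>w\<in>S. b v * (a w * partial w (partial v f)))"
proof -
  have "lie a (lie b f) = (\<Sum>v\<in>S. lie a (b v * partial v f))"
    unfolding lie_eq_sum[OF f(2,4), of b] using f b
    by (intro linear_on_sum[OF linear_on_lie subspace_smooth] smooth_mult smooth_partial) auto
  also have "\<dots> = (\<Sum>v\<in>S. lie a (b v) * partial v f + b v * lie a (partial v f))"
    using f b by (intro sum.cong refl lie_mult smooth_partial) auto
  finally show ?thesis
    by (simp add: lie_eq_sum[OF f(2) depends_on_partial[OF f(4)]] sum.distrib sum_distrib_left)
qed

lemma lie_commute:
  assumes f: "f \<in> smooth V" and a: "\<And>v. v \<in> V \<Longrightarrow> a v \<in> smooth V" and b: "\<And>v. v \<in> V \<Longrightarrow> b v \<in> smooth V"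
    and commute: "\<And>v. v \<in> V \<Longrightarrow> lie a (b v) = lie b (a v)"
  shows "lie a (lie b f) = lie b (lie a f)"
proof -
  obtain S where S: "finite S" "S \<subseteq> V" "depends_on f S" using smooth_obtain_dependence[OF f] by metis
  have "(\<Sum>v\<in>S. \<Sum>w\<in>S. b v * (a w * partial w (partial v f)))
      = (\<Sum>v\<in>S. \<Sum>w\<in>S. a v * (b w * partial w (partial v f)))"
    by (subst sum.swap) (simp add: partial_commute[OF f, of _ _] mult.left_commute)
  moreover have "(\<Sum>v\<in>S. lie a (b v) * partial v f) = (\<Sum>v\<in>S. lie b (a v) * partial v f)"
    using S commute by (intro sum.cong) auto
  ultimately show ?thesis by (simp add: lie_lie[OF f S a] lie_lie[OF f S b])
qed

lemma subst_simps [simp]: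
  "subst s (\<lambda>_. c) = (\<lambda>_. c)" "subst s 0 = 0" "subst s 1 = 1"
  "subst s (f + g) = subst s f + subst s g" "subst s (f - g) = subst s f - subst s g"
  "subst s (- f) = - subst s f" "subst s (f * g) = subst s f * subst s g"
  "subst s (c *\<^sub>R f) = c *\<^sub>R subst s f" "subst s (\<Sum>i\<in>I. h i) = (\<Sum>i\<in>I. subst s (h i))"
  by (simp_all add: subst_def fun_eq_iff pointwise)

lemma smooth_obtain_finite:
  assumes "f \<in> smooth V" obtains S where "finite S" "S \<subseteq> V" "f \<in> smooth S"
  using assms unfolding smooth_iff_pds finitely_dependent_def by blast

section \<open>Multi-indices and total derivatives\<close>

definition idx :: "nat \<Rightarrow> var \<Rightarrow> nat" where
  "idx \<mu> v = (case v of X _ \<Rightarrow> 0 | U l i \<Rightarrow> i \<mu> | P i \<Rightarrow> i \<mu>)"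

definition strip_idx :: "nat \<Rightarrow> var \<Rightarrow> var" where
  "strip_idx \<mu> v = (case v of X \<nu> \<Rightarrow> X \<nu> | U l i \<Rightarrow> U l (i(\<mu> := 0)) | P i \<Rightarrow> P (i(\<mu> := 0)))"

lemma inc_apply [simp]: "inc i \<mu> \<mu> = Suc (i \<mu>)" "\<nu> \<noteq> \<mu> \<Longrightarrow> inc i \<mu> \<nu> = i \<nu>"
  by (auto simp: inc_def)

lemma inc_commute: "inc (inc i \<mu>) \<nu> = inc (inc i \<nu>) \<mu>"
  by (auto simp: inc_def fun_eq_iff)

lemma unit_apply [simp]: "unit \<mu> \<mu> = 1" "\<nu> \<noteq> \<mu> \<Longrightarrow> unit \<mu> \<nu> = 0"
  by (simp_all add: unit_def)

lemma at1_apply [simp]: "at1 k \<mu> = (if \<mu> = 1 then k else 0)"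
  by (simp add: at1_def)

lemma at1_inject [simp]: "at1 j = at1 k \<longleftrightarrow> j = k"
  by (auto simp: at1_def fun_eq_iff)

lemma at1_eqs: "at1 0 = (\<lambda>_. 0)" "unit (Suc 0) = at1 (Suc 0)" "inc (at1 k) (Suc 0) = at1 (Suc k)"
  by (auto simp: at1_def inc_def unit_def)

lemma at1_eq_iff: "at1 (i (Suc 0)) = i \<longleftrightarrow> (\<forall>k. k \<noteq> Suc 0 \<longrightarrow> i k = 0)"
  by (auto simp: fun_eq_iff)

lemma shiftv_simps [simp]:
  "shiftv \<mu> (X \<nu>) = X \<nu>" "shiftv \<mu> (U l i) = U l (inc i \<mu>)" "shiftv \<mu> (P i) = P (inc i \<mu>)"
  by (auto simp: shiftv_def)

lemma shiftv_commute: "shiftv \<mu> (shiftv \<nu> v) = shiftv \<nu> (shiftv \<mu> v)"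
  by (cases v) (auto simp: inc_commute)

lemma is_X_simps [simp]: "is_X (X \<nu>)" "\<not> is_X (U l i)" "\<not> is_X (P i)"
  by (auto simp: is_X_def)

lemma is_X_shiftv [simp]: "is_X (shiftv \<mu> v) = is_X v"
  by (cases v) auto

lemma idx_simps [simp]: "idx \<mu> (X \<nu>) = 0" "idx \<mu> (U l i) = i \<mu>" "idx \<mu> (P i) = i \<mu>"
  by (simp_all add: idx_def)

lemma idx_shiftv: "\<not> is_X v \<Longrightarrow> idx \<mu> (shiftv \<mu> v) = Suc (idx \<mu> v)" "\<nu> \<noteq> \<mu> \<Longrightarrow> idx \<nu> (shiftv \<mu> v) = idx \<nu> v"
  by (cases v; simp)+

lemma idx_pos_not_X: "0 < idx \<mu> v \<Longrightarrow> \<not> is_X v"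
  by (cases v) auto

lemma strip_idx_shiftv:
  "strip_idx \<mu> (shiftv \<mu> v) = strip_idx \<mu> v" "\<nu> \<noteq> \<mu> \<Longrightarrow> strip_idx \<mu> (shiftv \<nu> v) = shiftv \<nu> (strip_idx \<mu> v)"
  by (cases v; auto simp: strip_idx_def inc_def)+

lemma strip_idx_eq_self: "idx \<mu> v = 0 \<Longrightarrow> strip_idx \<mu> v = v"
  by (cases v) (auto simp: strip_idx_def)

lemma obtain_unshift:
  assumes "0 < idx \<mu> v" obtains w where "v = shiftv \<mu> w"
proof (cases v)
  case (U l i)
  then show thesis using that[of "U l (i(\<mu> := i \<mu> - 1))"] assms by (simp add: inc_def)
next
  case (P i)
  then show thesis using that[of "P (i(\<mu> := i \<mu> - 1))"] assms by (simp add: inc_def)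
qed (use assms in simp)

lemma inj_shiftv: "inj (shiftv \<mu>)"
proof (rule injI)
  fix v w assume "shiftv \<mu> v = shiftv \<mu> w"
  moreover have "i = j" if "inc i \<mu> = inc j \<mu>" for i j
    using that by (metis fun_upd_triv fun_upd_upd inc_apply(1) inc_def nat.inject)
  ultimately show "v = w" by (cases v; cases w) auto
qed

lemma shiftv_induct [case_names base shift]:
  assumes base: "\<And>v. idx \<mu> v = 0 \<Longrightarrow> Q v" and shift: "\<And>v. \<not> is_X v \<Longrightarrow> Q v \<Longrightarrow> Q (shiftv \<mu> v)"
  shows "Q v"
proof (induction "idx \<mu> v" arbitrary: v)
  case (Suc n)
  then obtain w where w: "v = shiftv \<mu> w" by (metis obtain_unshift zero_less_Suc)
  then have "\<not> is_X w" using Suc(2) idx_pos_not_X[of \<mu> v] by simp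
  then show ?case using Suc w by (auto simp: idx_shiftv intro: shift)
qed (simp add: base)

lemma valid_mi_0 [simp]: "valid_mi m (\<lambda>_. 0)"
  by (simp add: valid_mi_def)

lemma valid_mi_inc_iff: "\<mu> \<in> {1..m} \<Longrightarrow> valid_mi m (inc i \<mu>) \<longleftrightarrow> valid_mi m i"
  by (auto simp: valid_mi_def inc_def)

lemma valid_mi_unit: "\<mu> \<in> {1..m} \<Longrightarrow> valid_mi m (unit \<mu>)"
  by (simp add: unit_def valid_mi_inc_iff)

lemma valid_var_simps:
  "valid_var m (X \<mu>) \<longleftrightarrow> \<mu> \<in> {1..m}"
  "valid_var m (U l i) \<longleftrightarrow> l \<in> {1..m} \<and> valid_mi m i"
  "valid_var m (P i) \<longleftrightarrow> valid_mi m i"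
  by (auto simp: valid_var_def)

lemma free_var_simps:
  "free_var m (X \<mu>) \<longleftrightarrow> \<mu> \<in> {1..m}"
  "free_var m (U l i) \<longleftrightarrow> l \<in> {1..m} \<and> valid_mi m i \<and> (l = 1 \<longrightarrow> i 1 = 0)"
  "free_var m (P i) \<longleftrightarrow> valid_mi m i \<and> i 1 \<le> 1"
  by (auto simp: free_var_def valid_var_def)

lemma free_imp_valid: "free_var m v \<Longrightarrow> valid_var m v"
  by (simp add: free_var_def)

lemma valid_shiftv: "\<mu> \<in> {1..m} \<Longrightarrow> valid_var m v \<Longrightarrow> valid_var m (shiftv \<mu> v)"
  by (cases v) (simp_all add: valid_var_simps valid_mi_inc_iff)

lemma Nset_iff [simp]: "\<alpha> \<in> Nset m \<longleftrightarrow> 2 \<le> \<alpha> \<and> \<alpha> \<le> m"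
  by (simp add: Nset_def)

lemma finite_Nset [simp]: "finite (Nset m)"
  by (simp add: Nset_def)

lemma free_shiftv_iff: "\<alpha> \<in> Nset m \<Longrightarrow> free_var m (shiftv \<alpha> v) \<longleftrightarrow> free_var m v"
  by (cases v) (auto simp: free_var_simps valid_mi_inc_iff)

lemma free_unshift_1: "free_var m (shiftv 1 v) \<Longrightarrow> \<not> is_X v \<Longrightarrow> 1 \<le> m \<Longrightarrow> free_var m v"
  by (cases v) (auto simp: free_var_simps valid_mi_inc_iff)

lemma multi_index_induct [consumes 2, case_names zero inc]:
  assumes "finite A" "\<forall>k. k \<notin> A \<longrightarrow> i k = 0" and zero: "Q (\<lambda>_. 0)"
    and inc: "\<And>i \<mu>. (\<forall>k. k \<notin> A \<longrightarrow> i k = 0) \<Longrightarrow> \<mu> \<in> A \<Longrightarrow> Q i \<Longrightarrow> Q (inc i \<mu>)"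
  shows "Q i"
  using assms(2)
proof (induction "\<Sum>k\<in>A. i k" arbitrary: i)
  case 0
  then have "i = (\<lambda>_. 0)" using assms(1) by (metis sum_eq_0_iff)
  then show ?case using zero by simp
next
  case (Suc n)
  then obtain \<mu> where \<mu>: "\<mu> \<in> A" "i \<mu> \<noteq> 0" by (metis sum.neutral nat.distinct(1))
  define j where "j = i(\<mu> := i \<mu> - 1)"
  have i: "i = inc j \<mu>" using \<mu> by (auto simp: inc_def j_def)
  have "(\<Sum>k\<in>A. i k) = Suc (\<Sum>k\<in>A. j k)"
    using \<mu> assms(1) by (simp add: sum.remove[of A \<mu>] j_def)
  then have "Q j" using Suc \<mu> by (auto simp: j_def)
  then show ?case unfolding i using Suc.prems \<mu> by (intro inc) (auto simp: j_def)
qed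

lemma foldr_ignore: "foldr (\<lambda>_ g. g) xs f = f"
  by (induction xs) simp_all

lemma foldr_funpow_closed:
  assumes "\<And>\<mu> g. \<mu> \<in> set xs \<Longrightarrow> i \<mu> \<noteq> 0 \<Longrightarrow> g \<in> F \<Longrightarrow> T \<mu> g \<in> F" "f \<in> F"
  shows "foldr (\<lambda>\<mu> g. (T \<mu> ^^ i \<mu>) g) xs f \<in> F"
  using assms(1)
proof (induction xs)
  case (Cons a xs)
  then have "foldr (\<lambda>\<mu> g. (T \<mu> ^^ i \<mu>) g) xs f \<in> F" by simp
  moreover have "(T a ^^ n) g \<in> F" if "g \<in> F" "n \<le> i a" for n g
    using that by (induction n) (auto intro!: Cons.prems)
  ultimately show ?case by simp
qed (use assms in simp)

lemma foldr_funpow_commute: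
  assumes closed: "\<And>\<mu> g. \<mu> \<in> I \<Longrightarrow> g \<in> F \<Longrightarrow> T \<mu> g \<in> F"
    and commute: "\<And>\<mu> \<nu> g. \<mu> \<in> I \<Longrightarrow> \<nu> \<in> I \<Longrightarrow> g \<in> F \<Longrightarrow> T \<mu> (T \<nu> g) = T \<nu> (T \<mu> g)"
    and "set xs \<subseteq> I" "\<mu> \<in> I" "f \<in> F"
  shows "T \<mu> (foldr (\<lambda>\<nu> g. (T \<nu> ^^ i \<nu>) g) xs f) = foldr (\<lambda>\<nu> g. (T \<nu> ^^ i \<nu>) g) xs (T \<mu> f)"
  using assms(3)
proof (induction xs)
  case (Cons a xs)
  have "T \<mu> ((T a ^^ n) g) = (T a ^^ n) (T \<mu> g) \<and> (T a ^^ n) g \<in> F" if "g \<in> F" for n g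
    using that commute[of \<mu> a] closed[of a] Cons.prems assms(4) by (induction n) simp_all
  moreover have "foldr (\<lambda>\<nu> g. (T \<nu> ^^ i \<nu>) g) xs f \<in> F"
    using Cons.prems assms by (intro foldr_funpow_closed closed) auto
  ultimately show ?case using Cons by simp
qed simp

lemma foldr_funpow_inc:
  assumes closed: "\<And>\<mu> g. \<mu> \<in> I \<Longrightarrow> g \<in> F \<Longrightarrow> T \<mu> g \<in> F"
    and commute: "\<And>\<mu> \<nu> g. \<mu> \<in> I \<Longrightarrow> \<nu> \<in> I \<Longrightarrow> g \<in> F \<Longrightarrow> T \<mu> (T \<nu> g) = T \<nu> (T \<mu> g)"
    and "set xs \<subseteq> I" "\<mu> \<in> set xs" "distinct xs" "f \<in> F"
  shows "foldr (\<lambda>\<nu> g. (T \<nu> ^^ inc i \<mu> \<nu>) g) xs f = foldr (\<lambda>\<nu> g. (T \<nu> ^^ i \<nu>) g) xs (T \<mu> f)"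
  using assms(3-5)
proof (induction xs)
  case (Cons a xs)
  show ?case
  proof (cases "a = \<mu>")
    case True
    then have "foldr (\<lambda>\<nu> g. (T \<nu> ^^ inc i \<mu> \<nu>) g) xs f = foldr (\<lambda>\<nu> g. (T \<nu> ^^ i \<nu>) g) xs f"
      using Cons.prems by (intro foldr_cong) (auto simp: inc_def)
    moreover have "T \<mu> (foldr (\<lambda>\<nu> g. (T \<nu> ^^ i \<nu>) g) xs f) = foldr (\<lambda>\<nu> g. (T \<nu> ^^ i \<nu>) g) xs (T \<mu> f)"
      using Cons.prems assms(6) True by (intro foldr_funpow_commute[of I F T, OF closed commute]) auto
    ultimately show ?thesis using True by (simp add: funpow_swap1)
  qed (use Cons in auto)
qed simp

definition tot_field :: "nat \<Rightarrow> var \<Rightarrow> fn" where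
  "tot_field \<mu> v = (if is_X v then (if v = X \<mu> then 1 else 0) else coord (shiftv \<mu> v))"

lemma tot_field_simps [simp]:
  "tot_field \<mu> (X \<nu>) = (if \<nu> = \<mu> then 1 else 0)" "\<not> is_X v \<Longrightarrow> tot_field \<mu> v = coord (shiftv \<mu> v)"
  by (auto simp: tot_field_def)

lemma Dt_eq_lie:
  assumes "f \<in> AB m" shows "Dt m \<mu> f = lie (tot_field \<mu>) f"
proof
  fix y
  obtain S where S: "finite S" "depends_on f S"
    using assms smooth_obtain_dependence unfolding AB_eq_smooth by metis
  define D where "D = {v. valid_var m v \<and> \<not> is_X v \<and> partial v f \<noteq> (\<lambda>_. 0)}"
  have nonzero: "{v. partial v f \<noteq> 0} \<subseteq> S" using partial_outside[OF S(2)] by blast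
  have D: "finite D" "\<And>v. v \<in> D \<Longrightarrow> \<not> is_X v" "X \<mu> \<notin> D"
    using nonzero by (auto simp: D_def zero_fun_def intro: finite_subset[OF _ S(1)])
  have "lie (tot_field \<mu>) f = (\<Sum>v\<in>insert (X \<mu>) S. tot_field \<mu> v * partial v f)"
    using S depends_on_mono[OF S(2) subset_insertI] by (intro lie_eq_sum) auto
  also have "\<dots> = (\<Sum>v\<in>insert (X \<mu>) D. tot_field \<mu> v * partial v f)"
  proof (rule sum.mono_neutral_right)
    show "insert (X \<mu>) D \<subseteq> insert (X \<mu>) S" using nonzero by (auto simp: D_def zero_fun_def)
    show "\<forall>v\<in>insert (X \<mu>) S - insert (X \<mu>) D. tot_field \<mu> v * partial v f = 0"
      using smooth_partial_outside[OF assms[unfolded AB_eq_smooth]]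
      by (auto simp: D_def zero_fun_def[symmetric] tot_field_def)
  qed (use S in auto)
  also have "\<dots> = partial (X \<mu>) f + (\<Sum>v\<in>D. coord (shiftv \<mu> v) * partial v f)"
    using D by simp
  finally show "Dt m \<mu> f y = lie (tot_field \<mu>) f y" by (simp add: Dt_def D_def pointwise)
qed

lemmas AB_closed = smooth_closed[where V = "{v. valid_var m v}" for
    m, folded AB_eq_smooth, unfolded mem_Collect_eq]

lemma subspace_AB: "subspace (AB m)"
  unfolding AB_eq_smooth by (rule subspace_smooth)

lemma tot_field_AB: "\<mu> \<in> {1..m} \<Longrightarrow> valid_var m v \<Longrightarrow> tot_field \<mu> v \<in> AB m"
  using valid_shiftv[of \<mu> m v] by (auto simp: tot_field_def intro: AB_closed)

lemma Dt_AB: "f \<in> AB m \<Longrightarrow> \<mu> \<in> {1..m} \<Longrightarrow> Dt m \<mu> f \<in> AB m"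
  using tot_field_AB by (simp add: Dt_eq_lie) (auto simp: AB_eq_smooth intro!: smooth_lie)

lemma linear_on_Dt: "linear_on (AB m) (Dt m \<mu>)"
  using linear_on_lie[of "{v. valid_var m v}" "tot_field \<mu>"]
  by (simp add: linear_on_def Dt_eq_lie AB_closed flip: AB_eq_smooth)

lemma Dt_coord: "valid_var m v \<Longrightarrow> \<not> is_X v \<Longrightarrow> Dt m \<mu> (coord v) = coord (shiftv \<mu> v)"
  by (simp add: Dt_eq_lie AB_closed)

lemma Dt_mult: "f \<in> AB m \<Longrightarrow> g \<in> AB m \<Longrightarrow> Dt m \<mu> (f * g) = Dt m \<mu> f * g + f * Dt m \<mu> g"
  using lie_mult[of f "{v. valid_var m v}" g] by (simp add: Dt_eq_lie AB_closed flip: AB_eq_smooth)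

lemma Dt_commute:
  assumes "f \<in> AB m" "\<mu> \<in> {1..m}" "\<nu> \<in> {1..m}"
  shows "Dt m \<mu> (Dt m \<nu> f) = Dt m \<nu> (Dt m \<mu> f)"
proof -
  have "lie (tot_field \<mu>) (lie (tot_field \<nu>) f) = lie (tot_field \<nu>) (lie (tot_field \<mu>) f)"
  proof (rule lie_commute)
    show "f \<in> smooth {v. valid_var m v}" using assms by (simp add: AB_eq_smooth)
    show "tot_field \<mu> v \<in> smooth {v. valid_var m v}" "tot_field \<nu> v \<in> smooth {v. valid_var m v}"
      if "v \<in> {v. valid_var m v}" for v
      using tot_field_AB assms that unfolding AB_eq_smooth by blast+
    show "lie (tot_field \<mu>) (tot_field \<nu> v) = lie (tot_field \<nu>) (tot_field \<mu> v)" for v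
      using lie_const[of _ 0] lie_const[of _ 1]
      by (cases "is_X v") (auto simp: tot_field_def shiftv_commute zero_fun_def one_fun_def)
  qed
  then show ?thesis
    using Dt_eq_lie[OF Dt_AB[OF assms(1,2)]] Dt_eq_lie[OF Dt_AB[OF assms(1,3)]] Dt_eq_lie[OF assms(1)] by simp
qed

lemma Dmi_AB: "f \<in> AB m \<Longrightarrow> Dmi m i f \<in> AB m"
  unfolding Dmi_def by (rule foldr_funpow_closed) (auto intro: Dt_AB)

lemma Dt_Dmi:
  assumes "f \<in> AB m" "\<mu> \<in> {1..m}" shows "Dt m \<mu> (Dmi m i f) = Dmi m (inc i \<mu>) f"
proof -
  have "foldr (\<lambda>\<nu> g. (Dt m \<nu> ^^ inc i \<mu> \<nu>) g) [1..<Suc m] f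
      = foldr (\<lambda>\<nu> g. (Dt m \<nu> ^^ i \<nu>) g) [1..<Suc m] (Dt m \<mu> f)"
    using assms Dt_AB Dt_commute by (intro foldr_funpow_inc[of "{1..m}" "AB m"]) auto
  moreover have "Dt m \<mu> (foldr (\<lambda>\<nu> g. (Dt m \<nu> ^^ i \<nu>) g) [1..<Suc m] f)
      = foldr (\<lambda>\<nu> g. (Dt m \<nu> ^^ i \<nu>) g) [1..<Suc m] (Dt m \<mu> f)"
    using assms Dt_AB Dt_commute by (intro foldr_funpow_commute[of "{1..m}" "AB m"]) auto
  ultimately show ?thesis by (simp add: Dmi_def)
qed

lemma Dmi_0 [simp]: "Dmi m (\<lambda>_. 0) f = f"
  unfolding Dmi_def funpow_0 by (rule foldr_ignore)

section \<open>Solving the equation for the free coordinates\<close>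

locale cpe =
  fixes m :: nat
  assumes two_le_m: "2 \<le> m"
begin

abbreviation N :: "nat set" where
  "N \<equiv> Nset m"

definition ACPE :: "fn set" where
  "ACPE = smooth {v. free_var m v}"

lemmas ACPE_closed = smooth_closed[where V = "{v. free_var m v}", folded ACPE_def, unfolded mem_Collect_eq]

lemma subspace_ACPE: "subspace ACPE"
  unfolding ACPE_def by (rule subspace_smooth)

lemma ACPE_AB: "f \<in> ACPE \<Longrightarrow> f \<in> AB m"
  unfolding ACPE_def AB_eq_smooth by (rule smooth_mono[rotated]) (auto simp: free_imp_valid)

text \<open>\<open>cpe_Phi\<close> is the \<open>\<Phi>\<close> of the equation, with \<open>u\<^sup>1\<^sub>(\<^sub>1\<^sub>)\<close> replaced by \<open>- div_u\<close>.\<close>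

definition div_u :: fn where
  "div_u = (\<Sum>\<alpha>\<in>N. coord (U \<alpha> (unit \<alpha>)))"

definition quad_u :: fn where
  "quad_u = div_u * div_u
     + 2 *\<^sub>R (\<Sum>\<alpha>\<in>N. coord (U 1 (unit \<alpha>)) * coord (U \<alpha> (unit 1)))
     + (\<Sum>\<alpha>\<in>N. \<Sum>\<beta>\<in>N. coord (U \<alpha> (unit \<beta>)) * coord (U \<beta> (unit \<alpha>)))"

definition cpe_Phi :: fn where
  "cpe_Phi = (\<Sum>\<alpha>\<in>N. coord (P (inc (unit \<alpha>) \<alpha>))) + quad_u"

definition cpe_field :: "var \<Rightarrow> fn" where
  "cpe_field v = (case v of X \<nu> \<Rightarrow> if \<nu> = 1 then 1 else 0
      | U l i \<Rightarrow> if l = 1 then - (\<Sum>\<beta>\<in>N. coord (U \<beta> (inc i \<beta>))) else coord (U l (inc i 1))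
      | P i \<Rightarrow> if i 1 = 0 then coord (P (inc i 1)) else - Dmi m (i(1 := 0)) cpe_Phi)"

definition bar_field :: "nat \<Rightarrow> var \<Rightarrow> fn" where
  "bar_field \<mu> = (if \<mu> = 1 then cpe_field else tot_field \<mu>)"

definition Dbar :: "nat \<Rightarrow> fn \<Rightarrow> fn" where
  "Dbar \<mu> = lie (bar_field \<mu>)"

text \<open>The coordinate \<open>v\<close> expressed through the free ones; substituting it is the normal form map.\<close>

definition reduce_coord :: "var \<Rightarrow> fn" where
  "reduce_coord v = (Dbar 1 ^^ idx 1 v) (coord (strip_idx 1 v))"

abbreviation reduce :: "fn \<Rightarrow> fn" where
  "reduce \<equiv> subst reduce_coord"

lemma bar_field_X [simp]: "bar_field \<mu> (X \<nu>) = (if \<nu> = \<mu> then 1 else 0)"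
  by (simp add: bar_field_def cpe_field_def)

lemma one_le_m: "1 \<le> m" and one_in_M: "1 \<in> {1..m}"
  using two_le_m by auto

lemma sum_M: "(\<Sum>\<mu>=1..m. f \<mu>) = f 1 + (\<Sum>\<mu>\<in>N. f \<mu>)" for f :: "nat \<Rightarrow> 'a::comm_monoid_add"
proof -
  have "{1..m} = insert 1 {2..m}" using two_le_m by auto
  then show ?thesis by (simp add: Nset_def)
qed

lemma valid_mi_outside_N: "valid_mi m i \<Longrightarrow> i 1 = 0 \<Longrightarrow> k \<notin> N \<Longrightarrow> i k = 0"
  by (cases "k = 0 \<or> k = 1 \<or> m < k") (auto simp: valid_mi_def)

lemma div_u_ACPE: "div_u \<in> ACPE"
  unfolding div_u_def by (intro ACPE_closed) (auto simp: free_var_simps valid_mi_unit)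

lemma quad_u_ACPE: "quad_u \<in> ACPE"
  unfolding quad_u_def using two_le_m
  by (intro ACPE_closed div_u_ACPE) (auto simp: free_var_simps valid_mi_unit)

lemma cpe_Phi_ACPE: "cpe_Phi \<in> ACPE"
  unfolding cpe_Phi_def using two_le_m
  by (intro ACPE_closed quad_u_ACPE) (auto simp: free_var_simps valid_mi_unit valid_mi_inc_iff)

lemma Dt_ACPE:
  assumes "f \<in> ACPE" "\<alpha> \<in> N" shows "Dt m \<alpha> f \<in> ACPE"
proof -
  have "tot_field \<alpha> v \<in> ACPE" if "free_var m v" for v
    using that assms(2) free_shiftv_iff[of \<alpha> m v] by (auto simp: tot_field_def intro: ACPE_closed)
  then show ?thesis
    using assms by (simp add: Dt_eq_lie[OF ACPE_AB]) (auto simp: ACPE_def intro!: smooth_lie)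
qed

lemma Dmi_ACPE: "f \<in> ACPE \<Longrightarrow> i 1 = 0 \<Longrightarrow> Dmi m i f \<in> ACPE"
  unfolding Dmi_def
proof (rule foldr_funpow_closed)
  fix \<mu> g assume "i 1 = 0" "g \<in> ACPE" "\<mu> \<in> set [1..<Suc m]" "i \<mu> \<noteq> 0"
  then have "\<mu> \<noteq> 1" "1 \<le> \<mu>" "\<mu> \<le> m" by auto
  then show "Dt m \<mu> g \<in> ACPE" using \<open>g \<in> ACPE\<close> by (intro Dt_ACPE) auto
qed

lemma cpe_field_ACPE: "free_var m v \<Longrightarrow> cpe_field v \<in> ACPE"
  using two_le_m
  by (cases v)
    (auto simp: cpe_field_def free_var_simps valid_mi_inc_iff intro!: ACPE_closed Dmi_ACPE cpe_Phi_ACPE)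

lemma bar_field_ACPE:
  assumes "free_var m v" "\<mu> \<in> {1..m}" shows "bar_field \<mu> v \<in> ACPE"
proof (cases "\<mu> = 1 \<or> is_X v")
  case True
  then show ?thesis
    using assms cpe_field_ACPE by (auto simp: bar_field_def tot_field_def intro: ACPE_closed)
next
  case False
  then show ?thesis using assms free_shiftv_iff[of \<mu> m v] by (auto simp: bar_field_def intro: ACPE_closed)
qed

lemma Dbar_ACPE: "f \<in> ACPE \<Longrightarrow> \<mu> \<in> {1..m} \<Longrightarrow> Dbar \<mu> f \<in> ACPE"
  using bar_field_ACPE unfolding Dbar_def ACPE_def by (auto intro!: smooth_lie)

lemma linear_on_Dbar: "linear_on ACPE (Dbar \<mu>)"
  unfolding Dbar_def ACPE_def by (rule linear_on_lie)

lemma Dbar_mult: "f \<in> ACPE \<Longrightarrow> g \<in> ACPE \<Longrightarrow> Dbar \<mu> (f * g) = Dbar \<mu> f * g + f * Dbar \<mu> g"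
  unfolding Dbar_def ACPE_def by (rule lie_mult)

lemma Dbar_const [simp]: "Dbar \<mu> (\<lambda>_. c) = 0" "Dbar \<mu> 0 = 0" "Dbar \<mu> 1 = 0"
  using lie_const[of _ 0] lie_const[of _ 1] by (simp_all add: Dbar_def zero_fun_def one_fun_def)

lemma Dbar_coord: "Dbar \<mu> (coord v) = bar_field \<mu> v"
  by (simp add: Dbar_def)

lemma Dbar_coord_N: "\<alpha> \<in> N \<Longrightarrow> \<not> is_X v \<Longrightarrow> Dbar \<alpha> (coord v) = coord (shiftv \<alpha> v)"
  by (simp add: Dbar_coord bar_field_def)

lemma Dbar_eq_Dt: "f \<in> ACPE \<Longrightarrow> \<mu> \<noteq> 1 \<Longrightarrow> Dbar \<mu> f = Dt m \<mu> f"
  by (simp add: Dbar_def bar_field_def Dt_eq_lie[OF ACPE_AB])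

lemma Dbar_Dmi:
  assumes "f \<in> ACPE" "i 1 = 0" "\<alpha> \<in> N" shows "Dbar \<alpha> (Dmi m i f) = Dmi m (inc i \<alpha>) f"
  using assms Dbar_eq_Dt[OF Dmi_ACPE[of f i]] Dt_Dmi[OF ACPE_AB] by simp

lemma Dbar_cpe_field:
  assumes v: "free_var m v" "\<not> is_X v" and \<alpha>: "\<alpha> \<in> N"
  shows "Dbar \<alpha> (cpe_field v) = cpe_field (shiftv \<alpha> v)"
proof (cases v)
  case (U l i)
  show ?thesis
  proof (cases "l = 1")
    case True
    have c: "coord (U \<beta> (inc i \<beta>)) \<in> ACPE" if "\<beta> \<in> N" for \<beta>
      using that v U by (intro ACPE_closed) (auto simp: free_var_simps valid_mi_inc_iff)
    have "Dbar \<alpha> (- (\<Sum>\<beta>\<in>N. coord (U \<beta> (inc i \<beta>)))) = - Dbar \<alpha> (\<Sum>\<beta>\<in>N. coord (U \<beta> (inc i \<beta>)))"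
      using c by (intro linear_on_uminus[OF linear_on_Dbar] subspace_sum[OF subspace_ACPE])
    also have "\<dots> = - (\<Sum>\<beta>\<in>N. Dbar \<alpha> (coord (U \<beta> (inc i \<beta>))))"
      using c by (intro arg_cong[where f = uminus] linear_on_sum[OF linear_on_Dbar subspace_ACPE])
    finally have "Dbar \<alpha> (- (\<Sum>\<beta>\<in>N. coord (U \<beta> (inc i \<beta>)))) = - (\<Sum>\<beta>\<in>N. Dbar \<alpha> (coord (U \<beta> (inc i \<beta>))))" .
    then show ?thesis using U True \<alpha> by (simp add: cpe_field_def Dbar_coord_N inc_commute)
  qed (use U \<alpha> in \<open>simp add: cpe_field_def Dbar_coord_N inc_commute\<close>)
next
  case (P i)
  show ?thesis
  proof (cases "i 1 = 0")
    case True
    then show ?thesis using P \<alpha> by (simp add: cpe_field_def Dbar_coord_N inc_commute)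
  next
    case False
    have "(inc i \<alpha>)(1 := 0) = inc (i(1 := 0)) \<alpha>" using \<alpha> by (auto simp: inc_def)
    then show ?thesis
      using P \<alpha> False linear_on_uminus[OF linear_on_Dbar Dmi_ACPE[OF cpe_Phi_ACPE]] Dbar_Dmi[OF cpe_Phi_ACPE]
      by (simp add: cpe_field_def)
  qed
qed (use v in simp)

lemma Dbar_bar_field:
  assumes "free_var m v" "\<mu> \<in> {1..m}" "\<nu> \<in> {1..m}"
  shows "Dbar \<mu> (bar_field \<nu> v) = Dbar \<nu> (bar_field \<mu> v)"
proof (cases "is_X v")
  case True
  then obtain \<kappa> where v: "v = X \<kappa>" by (cases v) auto
  have "Dbar \<kappa>' (bar_field \<nu>' v) = 0" for \<kappa>' \<nu>' by (simp add: v)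
  then show ?thesis by simp
next
  case False
  consider "\<mu> = \<nu>" | "\<mu> = 1" "\<nu> \<in> N" | "\<mu> \<in> N" "\<nu> = 1" | "\<mu> \<in> N" "\<nu> \<in> N" using assms by force
  then show ?thesis
    using assms(1) False Dbar_cpe_field[of v]
    by cases (auto simp: bar_field_def Dbar_coord_N shiftv_commute, simp_all add: Dbar_def bar_field_def)
qed

lemma Dbar_commute:
  assumes "f \<in> ACPE" "\<mu> \<in> {1..m}" "\<nu> \<in> {1..m}"
  shows "Dbar \<mu> (Dbar \<nu> f) = Dbar \<nu> (Dbar \<mu> f)"
  unfolding Dbar_def
proof (rule lie_commute[OF assms(1)[unfolded ACPE_def]])
  fix v assume v: "v \<in> {v. free_var m v}"
  then show "bar_field \<mu> v \<in> smooth {v. free_var m v}" "bar_field \<nu> v \<in> smooth {v. free_var m v}"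
    using bar_field_ACPE assms unfolding ACPE_def by auto
  show "lie (bar_field \<mu>) (bar_field \<nu> v) = lie (bar_field \<nu>) (bar_field \<mu> v)"
    using Dbar_bar_field v assms by (simp add: Dbar_def)
qed

lemma funpow_Dbar_1:
  assumes "f \<in> ACPE"
  shows "(Dbar 1 ^^ n) f \<in> ACPE"
    and "\<mu> \<in> {1..m} \<Longrightarrow> Dbar \<mu> ((Dbar 1 ^^ n) f) = (Dbar 1 ^^ n) (Dbar \<mu> f)"
proof -
  show closed: "(Dbar 1 ^^ n) f \<in> ACPE" for n
    using assms one_in_M by (induction n) (auto intro: Dbar_ACPE)
  show "Dbar \<mu> ((Dbar 1 ^^ n) f) = (Dbar 1 ^^ n) (Dbar \<mu> f)" if "\<mu> \<in> {1..m}"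
    using Dbar_commute[OF closed that one_in_M] by (induction n) simp_all
qed

lemma free_strip_idx_1: "valid_var m v \<Longrightarrow> free_var m (strip_idx 1 v)"
  by (cases v) (auto simp: strip_idx_def valid_var_simps free_var_simps valid_mi_def)

lemma reduce_coord_ACPE: "valid_var m v \<Longrightarrow> reduce_coord v \<in> ACPE"
  unfolding reduce_coord_def by (intro funpow_Dbar_1 ACPE_closed free_strip_idx_1)

lemma Dbar_reduce_coord:
  assumes v: "valid_var m v" "\<not> is_X v" and \<mu>: "\<mu> \<in> {1..m}"
  shows "Dbar \<mu> (reduce_coord v) = reduce_coord (shiftv \<mu> v)"
proof (cases "\<mu> = 1")
  case True
  then show ?thesis using v by (simp add: reduce_coord_def idx_shiftv strip_idx_shiftv)
next
  case False
  then have "Dbar \<mu> (coord (strip_idx 1 v)) = coord (shiftv \<mu> (strip_idx 1 v))"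
    using \<mu> v by (intro Dbar_coord_N) (auto simp: strip_idx_def split: var.split)
  then show ?thesis
    using False \<mu> funpow_Dbar_1(2)[OF ACPE_closed(1)[OF free_strip_idx_1[OF v(1)]]]
    by (simp add: reduce_coord_def idx_shiftv strip_idx_shiftv)
qed

lemma reduce_coord_free: "free_var m v \<Longrightarrow> reduce_coord v = coord v"
proof (induction v rule: shiftv_induct[of 1])
  case (base v)
  then show ?case by (simp add: reduce_coord_def strip_idx_eq_self)
next
  case (shift v)
  have v: "free_var m v" using shift one_le_m by (auto intro: free_unshift_1[of m v])
  then have "reduce_coord (shiftv 1 v) = cpe_field v"
    using shift Dbar_reduce_coord[OF free_imp_valid[OF v] _ one_in_M] by (simp add: Dbar_coord bar_field_def)
  also have "\<dots> = coord (shiftv 1 v)"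
    using shift by (cases v) (auto simp: cpe_field_def free_var_simps)
  finally show ?case .
qed

lemma reduce_ACPE: "f \<in> AB m \<Longrightarrow> reduce f \<in> ACPE"
  unfolding ACPE_def AB_eq_smooth by (rule smooth_subst) (use reduce_coord_ACPE in \<open>auto simp: ACPE_def\<close>)

lemma reduce_AB: "f \<in> AB m \<Longrightarrow> reduce f \<in> AB m"
  using reduce_ACPE ACPE_AB by blast

lemma reduce_id:
  assumes "f \<in> ACPE" shows "reduce f = f"
proof -
  have "reduce f = subst coord f"
    using assms smooth_depends_on reduce_coord_free unfolding ACPE_def by (intro subst_cong) auto
  then show ?thesis by simp
qed

lemma Dbar_reduce:
  assumes f: "f \<in> AB m" and \<mu>: "\<mu> \<in> {1..m}"
  shows "Dbar \<mu> (reduce f) = reduce (Dt m \<mu> f)"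
proof -
  obtain S where S: "finite S" "S \<subseteq> {v. valid_var m v}" "depends_on f S"
    using smooth_obtain_dependence f unfolding AB_eq_smooth by metis
  have field: "Dbar \<mu> (reduce_coord v) = reduce (tot_field \<mu> v)" if "v \<in> S" for v
  proof (cases "is_X v")
    case True
    then obtain \<nu> where v: "v = X \<nu>" by (cases v) auto
    then have "free_var m v" using that S by (auto simp: free_var_simps valid_var_simps)
    then have "Dbar \<mu> (reduce_coord v) = bar_field \<mu> v" by (simp add: reduce_coord_free Dbar_coord)
    then show ?thesis by (simp add: v)
  next
    case False
    then show ?thesis using Dbar_reduce_coord[of v] that S \<mu> by auto
  qed
  have "Dbar \<mu> (reduce f) = (\<Sum>v\<in>S. reduce (partial v f) * Dbar \<mu> (reduce_coord v))"
    unfolding Dbar_def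
    by (rule lie_subst[OF f[unfolded AB_eq_smooth] S(1,3)]) (use reduce_coord_ACPE S in \<open>auto simp: ACPE_def\<close>)
  then show ?thesis
    using field by (simp add: Dt_eq_lie[OF f] lie_eq_sum[OF S(1,3)] mult.commute)
qed

subsection \<open>The ideal of the equation\<close>

lemma CE_eq: "CE m i = (\<Sum>\<mu>=1..m. coord (U \<mu> (inc i \<mu>)))"
  by (simp add: CE_def fun_eq_iff pointwise)

lemma PE_eq: "PE m i = (\<Sum>\<mu>=1..m. coord (P (inc (inc i \<mu>) \<mu>))) + Dmi m i (quadU m)"
  by (simp add: PE_def fun_eq_iff pointwise)

lemma quadU_eq: "quadU m = (\<Sum>l=1..m. \<Sum>\<mu>=1..m. coord (U l (unit \<mu>)) * coord (U \<mu> (unit l)))"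
  by (simp add: quadU_def fun_eq_iff pointwise)

lemma quadU_split:
  "quadU m = coord (U 1 (unit 1)) * coord (U 1 (unit 1))
     + 2 *\<^sub>R (\<Sum>\<alpha>\<in>N. coord (U 1 (unit \<alpha>)) * coord (U \<alpha> (unit 1)))
     + (\<Sum>\<alpha>\<in>N. \<Sum>\<beta>\<in>N. coord (U \<alpha> (unit \<beta>)) * coord (U \<beta> (unit \<alpha>)))"
  unfolding quadU_eq sum_M by (simp add: sum.distrib scaleR_2 mult.commute add_ac)

lemma quadU_AB: "quadU m \<in> AB m"
  unfolding quadU_eq by (intro AB_closed) (auto simp: valid_var_simps valid_mi_unit)

lemma gen_AB: "valid_mi m (snd k) \<Longrightarrow> gen m k \<in> AB m"
  unfolding gen_def CE_eq PE_eq
  by (auto intro!: AB_closed Dmi_AB quadU_AB simp: valid_var_simps valid_mi_inc_iff)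

lemma Dt_gen:
  assumes i: "valid_mi m i" and \<mu>: "\<mu> \<in> {1..m}"
  shows "Dt m \<mu> (gen m (b, i)) = gen m (b, inc i \<mu>)"
proof -
  have sum: "Dt m \<mu> (\<Sum>\<nu>=1..m. coord (v \<nu>)) = (\<Sum>\<nu>=1..m. coord (shiftv \<mu> (v \<nu>)))"
    if "\<And>\<nu>. \<nu> \<in> {1..m} \<Longrightarrow> valid_var m (v \<nu>)" "\<And>\<nu>. \<not> is_X (v \<nu>)" for v
    using that linear_on_sum[OF linear_on_Dt subspace_AB, of "{1..m}" "\<lambda>\<nu>. coord (v \<nu>)"]
    by (simp add: AB_closed Dt_coord)
  have "Dt m \<mu> (CE m i) = CE m (inc i \<mu>)"
    unfolding CE_eq using i by (subst sum) (auto simp: valid_var_simps valid_mi_inc_iff inc_commute)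
  moreover have "Dt m \<mu> (PE m i) = PE m (inc i \<mu>)"
  proof -
    have "Dt m \<mu> (PE m i) = Dt m \<mu> (\<Sum>\<nu>=1..m. coord (P (inc (inc i \<nu>) \<nu>))) + Dt m \<mu> (Dmi m i (quadU m))"
      unfolding PE_eq using i
      by (intro linear_on_add[OF linear_on_Dt] AB_closed Dmi_AB quadU_AB)
        (auto simp: valid_var_simps valid_mi_inc_iff)
    also have "\<dots> = (\<Sum>\<nu>=1..m. coord (P (inc (inc (inc i \<mu>) \<nu>) \<nu>))) + Dmi m (inc i \<mu>) (quadU m)"
      using i
      by (subst sum) (auto simp: valid_var_simps valid_mi_inc_iff inc_commute[of _ \<mu>] Dt_Dmi[OF quadU_AB \<mu>])
    finally show ?thesis by (simp add: PE_eq)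
  qed
  ultimately show ?thesis by (simp add: gen_def)
qed

lemma reduce_gen_zero: "reduce (gen m (b, \<lambda>_. 0)) = 0"
proof -
  have free: "reduce_coord (U \<alpha> (unit \<mu>)) = coord (U \<alpha> (unit \<mu>))" if "\<alpha> \<in> N" "\<mu> \<in> {1..m}" for \<alpha> \<mu>
    using that by (intro reduce_coord_free) (auto simp: free_var_simps valid_mi_unit)
  have free_N: "reduce_coord (U 1 (unit \<alpha>)) = coord (U 1 (unit \<alpha>))"
    "reduce_coord (P (inc (unit \<alpha>) \<alpha>)) = coord (P (inc (unit \<alpha>) \<alpha>))" if "\<alpha> \<in> N" for \<alpha>
    using that two_le_m
    by (intro reduce_coord_free; auto simp: free_var_simps valid_mi_unit valid_mi_inc_iff)+
  have shift_0: "reduce_coord (shiftv 1 v) = cpe_field v" if "free_var m v" "\<not> is_X v" for v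
    using Dbar_reduce_coord[OF free_imp_valid[OF that(1)] that(2) one_in_M] that
    by (simp add: reduce_coord_free Dbar_coord bar_field_def)
  have u11: "reduce_coord (U 1 (unit 1)) = - div_u"
    using shift_0[of "U 1 (\<lambda>_. 0)"] one_le_m
    by (simp add: free_var_simps cpe_field_def div_u_def flip: unit_def)
  have p11: "reduce_coord (P (inc (unit 1) 1)) = - cpe_Phi"
  proof -
    have "(unit 1)(1 := 0) = (\<lambda>_. 0)" by (auto simp: fun_eq_iff)
    then show ?thesis
      using shift_0[of "P (unit 1)"] valid_mi_unit[OF one_in_M] by (simp add: free_var_simps cpe_field_def)
  qed
  have "reduce (quadU m) = quad_u"
    unfolding quadU_split quad_u_def using free free_N two_le_m by (simp add: u11 del: One_nat_def)
  moreover have "reduce (CE m (\<lambda>_. 0)) = 0"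
    unfolding CE_eq sum_M using free u11 by (simp add: div_u_def flip: unit_def)
  moreover have "reduce (PE m (\<lambda>_. 0)) = 0" if "reduce (quadU m) = quad_u"
    unfolding PE_eq sum_M using free_N by (simp add: that p11 cpe_Phi_def del: One_nat_def flip: unit_def)
  ultimately show ?thesis by (simp add: gen_def)
qed

lemma reduce_gen:
  assumes "valid_mi m i" shows "reduce (gen m (b, i)) = 0"
proof -
  have "finite {1..m}" "\<forall>k. k \<notin> {1..m} \<longrightarrow> i k = 0" using assms by (auto simp: valid_mi_def not_le)
  then show ?thesis
  proof (induction i rule: multi_index_induct)
    case zero
    show ?case by (rule reduce_gen_zero)
  next
    case (inc i \<mu>)
    then have i: "valid_mi m i" by (auto simp: valid_mi_def)
    show ?case
      using Dbar_reduce[OF gen_AB[of "(b, i)"], of \<mu>] i inc by (simp add: Dt_gen[OF i])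
  qed
qed

lemma Jid_iff: "f \<in> Jid m \<longleftrightarrow> (\<exists>K a. finite K \<and> K \<subseteq> {k. valid_mi m (snd k)} \<and> range a \<subseteq> AB m
    \<and> f = (\<Sum>k\<in>K. a k * gen m k))"
proof
  assume "f \<in> Jid m"
  then obtain K a where K: "finite K" "K \<subseteq> {k. valid_mi m (snd k)}" "\<forall>k\<in>K. a k \<in> AB m"
    "f = (\<Sum>k\<in>K. a k * gen m k)"
    unfolding Jid_def by (auto simp: fun_eq_iff pointwise)
  define b where "b k = (if k \<in> K then a k else 0)" for k
  have "range b \<subseteq> AB m" "f = (\<Sum>k\<in>K. b k * gen m k)" using K by (auto simp: b_def AB_closed)
  then show "\<exists>K a. finite K \<and> K \<subseteq> {k. valid_mi m (snd k)} \<and> range a \<subseteq> AB m \<and> f = (\<Sum>k\<in>K. a k * gen m k)"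
    using K by blast
next
  assume "\<exists>K a. finite K \<and> K \<subseteq> {k. valid_mi m (snd k)} \<and> range a \<subseteq> AB m \<and> f = (\<Sum>k\<in>K. a k * gen m k)"
  then show "f \<in> Jid m" unfolding Jid_def by (fastforce simp: fun_eq_iff pointwise)
qed

lemma JidE:
  assumes "f \<in> Jid m"
  obtains K a where "finite K" "K \<subseteq> {k. valid_mi m (snd k)}" "range a \<subseteq> AB m" "f = (\<Sum>k\<in>K. a k * gen m k)"
  using assms unfolding Jid_iff by blast

lemma Jid_gen: "valid_mi m (snd k) \<Longrightarrow> gen m k \<in> Jid m"
  unfolding Jid_iff by (rule exI[of _ "{k}"], rule exI[of _ "\<lambda>_. 1"]) (auto intro: AB_closed)

lemma Jid_mult:
  assumes a: "a \<in> AB m" and f: "f \<in> Jid m" shows "a * f \<in> Jid m"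
proof -
  obtain K b where K: "finite K" "K \<subseteq> {k. valid_mi m (snd k)}" "range b \<subseteq> AB m" "f = (\<Sum>k\<in>K. b k * gen m k)"
    using f by (rule JidE)
  show ?thesis
    unfolding Jid_iff by (rule exI[of _ K], rule exI[of _ "\<lambda>k. a * b k"])
      (use K a in \<open>auto simp: sum_distrib_left mult.assoc intro!: AB_closed\<close>)
qed

lemma Jid_add:
  assumes "f \<in> Jid m" "g \<in> Jid m" shows "f + g \<in> Jid m"
proof -
  obtain K a where K: "finite K" "K \<subseteq> {k. valid_mi m (snd k)}" "range a \<subseteq> AB m" "f = (\<Sum>k\<in>K. a k * gen m k)"
    using assms(1) by (rule JidE)
  obtain L b where L: "finite L" "L \<subseteq> {k. valid_mi m (snd k)}" "range b \<subseteq> AB m" "g = (\<Sum>k\<in>L. b k * gen m k)"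
    using assms(2) by (rule JidE)
  define c where "c k = (if k \<in> K then a k else 0) + (if k \<in> L then b k else 0)" for k
  have "(\<Sum>k\<in>K \<union> L. (if k \<in> K then a k else 0) * gen m k) = f"
    unfolding K(4) by (rule sum.mono_neutral_cong_right) (use K L in auto)
  moreover have "(\<Sum>k\<in>K \<union> L. (if k \<in> L then b k else 0) * gen m k) = g"
    unfolding L(4) by (rule sum.mono_neutral_cong_right) (use K L in auto)
  ultimately have "f + g = (\<Sum>k\<in>K \<union> L. c k * gen m k)" by (simp add: c_def distrib_right sum.distrib)
  moreover have "c k \<in> AB m" for k
    unfolding c_def using K(3) L(3) by (intro AB_closed(6)) (auto intro: AB_closed)
  ultimately show ?thesis
    using K(1,2) L(1,2) unfolding Jid_iff by (intro exI[of _ "K \<union> L"] exI[of _ c]) auto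
qed

lemma subspace_Jid: "subspace (Jid m)"
  unfolding subspace_def
proof (intro conjI ballI allI)
  show "0 \<in> Jid m" unfolding Jid_iff by (rule exI[of _ "{}"], rule exI[of _ "\<lambda>_. 0"]) (auto intro: AB_closed)
  show "c *\<^sub>R f \<in> Jid m" if "f \<in> Jid m" for c f
    using Jid_mult[OF AB_closed(2)[of c] that] by (simp add: times_fun_def scaleR_fun_def)
qed (rule Jid_add)

lemmas Jid_closed = Jid_mult subspace_0[OF subspace_Jid] subspace_add[OF subspace_Jid]
  subspace_diff[OF subspace_Jid] subspace_sum[OF subspace_Jid]

lemma Dt_Jid:
  assumes "f \<in> Jid m" "\<mu> \<in> {1..m}" shows "Dt m \<mu> f \<in> Jid m"
proof -
  obtain K a where K: "finite K" "K \<subseteq> {k. valid_mi m (snd k)}" "range a \<subseteq> AB m" "f = (\<Sum>k\<in>K. a k * gen m k)"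
    using assms(1) by (rule JidE)
  have AB: "a k \<in> AB m" "gen m k \<in> AB m" if "k \<in> K" for k using that K gen_AB[of k] by auto
  have "Dt m \<mu> f = (\<Sum>k\<in>K. Dt m \<mu> (a k * gen m k))"
    unfolding K(4) using AB by (intro linear_on_sum[OF linear_on_Dt subspace_AB] AB_closed)
  also have "\<dots> = (\<Sum>k\<in>K. Dt m \<mu> (a k) * gen m k + a k * gen m (fst k, inc (snd k) \<mu>))"
    using AB K assms(2) Dt_gen[of "snd k" \<mu> "fst k" for k] by (intro sum.cong refl) (auto simp: Dt_mult)
  also have "\<dots> \<in> Jid m"
    using AB K assms(2) by (intro Jid_closed Jid_gen Dt_AB) (auto simp: valid_mi_inc_iff)
  finally show ?thesis .
qed

lemma reduce_Jid:
  assumes "f \<in> Jid m" shows "reduce f = 0"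
proof -
  obtain K a where K: "K \<subseteq> {k. valid_mi m (snd k)}" "f = (\<Sum>k\<in>K. a k * gen m k)"
    using assms by (rule JidE)
  have "reduce (gen m k) = 0" if "k \<in> K" for k
    using reduce_gen[of "snd k" "fst k"] that K by auto
  then show ?thesis by (simp add: K(2))
qed

lemma pressure_equation_Jid:
  assumes "valid_mi m j" "j 1 = 0"
  shows "coord (P (inc (inc j 1) 1)) + Dmi m j cpe_Phi \<in> Jid m"
proof -
  have "finite N" "\<forall>k. k \<notin> N \<longrightarrow> j k = 0" using assms valid_mi_outside_N by auto
  then show ?thesis
  proof (induction j rule: multi_index_induct)
    case zero
    have "gen m (True, \<lambda>_. 0) = coord (P (inc (unit 1) 1)) + (\<Sum>\<alpha>\<in>N. coord (P (inc (unit \<alpha>) \<alpha>))) + quadU m"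
      unfolding gen_def PE_eq sum_M by (simp flip: unit_def)
    moreover have "gen m (False, \<lambda>_. 0) = coord (U 1 (unit 1)) + div_u"
      unfolding gen_def CE_eq sum_M div_u_def by (simp flip: unit_def)
    ultimately have "coord (P (inc (unit 1) 1)) + cpe_Phi
        = gen m (True, \<lambda>_. 0) - (coord (U 1 (unit 1)) - div_u) * gen m (False, \<lambda>_. 0)"
      unfolding quadU_split cpe_Phi_def quad_u_def by (simp add: algebra_simps)
    also have "\<dots> \<in> Jid m"
      using one_in_M by (intro Jid_closed(1,4) Jid_gen AB_closed ACPE_AB[OF div_u_ACPE])
        (auto simp: valid_var_simps valid_mi_unit)
    finally show ?case by (simp flip: unit_def)
  next
    case (inc j \<mu>)
    have j: "valid_mi m j" and \<mu>: "\<mu> \<in> {1..m}" using inc by (auto simp: valid_mi_def)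
    have v: "valid_var m (P (inc (inc j 1) 1))"
      using j one_in_M by (simp add: valid_var_simps valid_mi_inc_iff)
    have "Dt m \<mu> (coord (P (inc (inc j 1) 1)) + Dmi m j cpe_Phi)
      = coord (P (inc (inc (inc j \<mu>) 1) 1)) + Dmi m (inc j \<mu>) cpe_Phi"
      using v linear_on_add[OF linear_on_Dt AB_closed(1)[OF v] Dmi_AB[OF ACPE_AB[OF cpe_Phi_ACPE]]]
      by (simp add: Dt_coord Dt_Dmi[OF ACPE_AB[OF cpe_Phi_ACPE] \<mu>] inc_commute[of _ \<mu>])
    then show ?case using Dt_Jid[OF inc.IH \<mu>] by simp
  qed
qed

lemma tot_field_diff_cpe_field_Jid:
  assumes w: "free_var m w" shows "tot_field 1 w - cpe_field w \<in> Jid m"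
proof -
  have zero: ?thesis if "tot_field 1 w = cpe_field w" using that Jid_closed(2) by simp
  show ?thesis
  proof (cases w)
    case (X \<nu>)
    then show ?thesis by (intro zero) (simp add: cpe_field_def)
  next
    case (U l i)
    show ?thesis
    proof (cases "l = 1")
      case True
      then have "tot_field 1 w - cpe_field w = gen m (False, i)"
        using U unfolding gen_def CE_eq sum_M by (simp add: cpe_field_def)
      then show ?thesis using Jid_gen[of "(False, i)"] w U by (simp add: free_var_simps)
    qed (use U in \<open>intro zero, simp add: cpe_field_def\<close>)
  next
    case (P i)
    show ?thesis
    proof (cases "i 1 = 0")
      case False
      define j where "j = i(1 := 0)"
      have j: "inc j 1 = i" "valid_mi m j" "j 1 = 0"
        using False w P by (auto simp: free_var_simps inc_def j_def valid_mi_def)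
      then have "tot_field 1 w - cpe_field w = coord (P (inc (inc j 1) 1)) + Dmi m j cpe_Phi"
        using P False by (simp add: cpe_field_def j_def)
      then show ?thesis using pressure_equation_Jid[OF j(2,3)] by simp
    qed (use P in \<open>intro zero, simp add: cpe_field_def\<close>)
  qed
qed

lemma Dt_diff_Dbar_Jid:
  assumes f: "f \<in> ACPE" shows "Dt m 1 f - Dbar 1 f \<in> Jid m"
proof -
  obtain S where S: "finite S" "S \<subseteq> {v. free_var m v}" "depends_on f S"
    using smooth_obtain_dependence f unfolding ACPE_def by metis
  have "Dt m 1 f - Dbar 1 f = (\<Sum>v\<in>S. partial v f * (tot_field 1 v - cpe_field v))"
    using f
    by (simp add: Dt_eq_lie ACPE_AB Dbar_def bar_field_def lie_eq_sum[OF S(1,3)] sum_subtractf algebra_simps)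
  also have "\<dots> \<in> Jid m"
    using S f by (intro Jid_closed(1,5) tot_field_diff_cpe_field_Jid AB_closed ACPE_AB) auto
  finally show ?thesis .
qed

lemma coord_diff_reduce_coord_Jid: "valid_var m v \<Longrightarrow> coord v - reduce_coord v \<in> Jid m"
proof (induction v rule: shiftv_induct[of 1])
  case (base v)
  then have "free_var m v" by (auto simp: free_var_def split: var.split)
  then show ?case using Jid_closed(2) by (simp add: reduce_coord_free)
next
  case (shift v)
  then have v: "valid_var m v"
    using one_in_M by (cases v) (auto simp: valid_var_simps valid_mi_inc_iff)
  have FR: "reduce_coord v \<in> ACPE" using reduce_coord_ACPE[OF v] .
  have "Dt m 1 (coord v) - Dt m 1 (reduce_coord v) \<in> Jid m"
    using Dt_Jid[OF shift.IH[OF v] one_in_M] linear_on_diff[OF linear_on_Dt subspace_AB AB_closed(1)[OF v]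
        ACPE_AB[OF FR]]
    by simp
  then have "(Dt m 1 (coord v) - Dt m 1 (reduce_coord v))
      + (Dt m 1 (reduce_coord v) - Dbar 1 (reduce_coord v)) \<in> Jid m"
    using Dt_diff_Dbar_Jid[OF FR] by (rule Jid_closed(3))
  then show ?case using v shift Dbar_reduce_coord[OF v _ one_in_M] by (simp add: Dt_coord)
qed

text \<open>The nonfree coordinates are eliminated one at a time, dividing by \<open>coord v - reduce_coord v\<close>.\<close>

lemma obtain_eliminated_coord:
  assumes f: "f \<in> smooth (insert v V)" and V: "{w. free_var m w} \<subseteq> V" "V \<subseteq> {w. valid_var m w}"
    and v: "valid_var m v" "v \<notin> V"
  obtains g where "g \<in> smooth V" "reduce g = reduce f" "f - g \<in> Jid m"
proof
  define g where "g = subst (coord(v := reduce_coord v)) f"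
  have r: "reduce_coord v \<in> smooth V"
    using smooth_mono[OF V(1)] reduce_coord_ACPE[OF v(1)] by (simp add: ACPE_def)
  show "g \<in> smooth V"
    unfolding g_def by (rule smooth_subst[OF f]) (auto intro: smooth_closed r)
  have "(\<lambda>u. (coord(v := reduce_coord v)) u (\<lambda>w. reduce_coord w y)) = (\<lambda>w. reduce_coord w y)" for y
    using fun_cong[OF reduce_id[OF reduce_coord_ACPE[OF v(1)]], of y] by (auto simp: subst_def pointwise)
  then show "reduce g = reduce f" unfolding g_def subst_def by simp
  have "insert v V - {v} = V" using v by auto
  then obtain Q where Q: "Q \<in> smooth (insert v V)"
    "\<And>y. f y - f (y(v := reduce_coord v y)) = (y v - reduce_coord v y) * Q y"
    using hadamard_division[OF f, of "reduce_coord v" v] r by auto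
  have "g y = f (y(v := reduce_coord v y))" for y
    unfolding g_def subst_def by (rule arg_cong[where f = f]) (auto simp: pointwise)
  then have "f - g = Q * (coord v - reduce_coord v)"
    using Q(2) by (simp add: fun_eq_iff pointwise mult.commute)
  moreover have "Q \<in> AB m"
    using smooth_mono[OF _ Q(1), of "{v. valid_var m v}"] V v by (simp add: AB_eq_smooth)
  ultimately show "f - g \<in> Jid m" using Jid_mult[OF _ coord_diff_reduce_coord_Jid[OF v(1)]] by simp
qed

lemma diff_reduce_Jid:
  assumes "f \<in> AB m" shows "f - reduce f \<in> Jid m"
proof -
  obtain B where "finite B" "B \<subseteq> {v. valid_var m v}" "f \<in> smooth B"
    using smooth_obtain_finite assms unfolding AB_eq_smooth by metis
  moreover have "f - reduce f \<in> Jid m"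
    if "finite B" "B \<subseteq> {v. valid_var m v}" "f \<in> smooth ({v. free_var m v} \<union> B)" for f B
    using that
  proof (induction B arbitrary: f rule: finite_induct)
    case empty
    then show ?case using reduce_id[of f] Jid_closed(2) by (simp add: ACPE_def)
  next
    case (insert v B)
    show ?case
    proof (cases "free_var m v")
      case True
      then have "{v. free_var m v} \<union> insert v B = {v. free_var m v} \<union> B" by auto
      then show ?thesis using insert by auto
    next
      case False
      then obtain g where g: "g \<in> smooth ({v. free_var m v} \<union> B)" "reduce g = reduce f" "f - g \<in> Jid m"
        using obtain_eliminated_coord[of f v "{v. free_var m v} \<union> B"] insert.hyps insert.prems free_imp_valid
        by auto
      then have "g - reduce f \<in> Jid m" using insert.IH[OF _ g(1)] insert.prems(1) by auto
      then show ?thesis using Jid_closed(3)[OF g(3)] by force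
    qed
  qed
  ultimately show ?thesis using smooth_mono[of B "{v. free_var m v} \<union> B" f] by blast
qed

lemma eqJ_iff:
  assumes "f \<in> AB m" "g \<in> AB m" shows "eqJ m f g \<longleftrightarrow> reduce f = reduce g"
proof
  assume "eqJ m f g"
  then have "f - g \<in> Jid m" by (simp add: eqJ_def fun_diff_def)
  then show "reduce f = reduce g" using reduce_Jid[of "f - g"] by simp
next
  assume "reduce f = reduce g"
  then have "f - g \<in> Jid m"
    using Jid_closed(4)[OF diff_reduce_Jid[OF assms(1)] diff_reduce_Jid[OF assms(2)]] by simp
  then show "eqJ m f g" by (simp add: eqJ_def fun_diff_def)
qed

lemma nf_eq_reduce:
  assumes "f \<in> AB m" shows "nf m f = reduce f"
  unfolding nf_def
proof (rule the_equality)
  have "depends_on (reduce f) {v. free_var m v}"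
    using smooth_depends_on reduce_ACPE[OF assms] by (simp add: ACPE_def)
  then show "reduce f \<in> AB m \<and> (\<forall>y z. (\<forall>v. free_var m v \<longrightarrow> y v = z v) \<longrightarrow> reduce f y = reduce f z)
      \<and> eqJ m f (reduce f)"
    using assms reduce_AB reduce_id[OF reduce_ACPE] by (auto simp: eqJ_iff depends_on_def)
next
  fix g assume g: "g \<in> AB m \<and> (\<forall>y z. (\<forall>v. free_var m v \<longrightarrow> y v = z v) \<longrightarrow> g y = g z) \<and> eqJ m f g"
  then have "reduce g = subst coord g"
    using reduce_coord_free by (intro subst_cong[of g "{v. free_var m v}"]) (auto simp: depends_on_def)
  then have "reduce g = g" by simp
  then show "g = reduce f" using g assms eqJ_iff[of f g] by simp
qed

section \<open>Vertical forms\<close>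

text \<open>A vertical form \<open>\<phi>\<close> stands for the sum of \<open>\<phi> v\<close> times the vertical differential of the coordinate \<open>v\<close>.\<close>

definition fibre_vars :: "var set" where
  "fibre_vars = {v. free_var m v \<and> \<not> is_X v}"

definition supp :: "(var \<Rightarrow> fn) \<Rightarrow> var set" where
  "supp \<phi> = {v. \<phi> v \<noteq> 0}"

definition vforms :: "(var \<Rightarrow> fn) set" where
  "vforms = {\<phi>. finite (supp \<phi>) \<and> supp \<phi> \<subseteq> fibre_vars \<and> range \<phi> \<subseteq> ACPE}"

definition dV :: "fn \<Rightarrow> var \<Rightarrow> fn" where
  "dV f v = (if is_X v then 0 else partial v f)"

definition fmul :: "fn \<Rightarrow> (var \<Rightarrow> fn) \<Rightarrow> var \<Rightarrow> fn" where
  "fmul g \<phi> v = g * \<phi> v"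

definition single :: "var \<Rightarrow> fn \<Rightarrow> var \<Rightarrow> fn" where
  "single w g v = (if v = w then g else 0)"

definition lie_vform :: "nat \<Rightarrow> (var \<Rightarrow> fn) \<Rightarrow> var \<Rightarrow> fn" where
  "lie_vform \<mu> \<phi> v = (if is_X v then 0 else Dbar \<mu> (\<phi> v) + (\<Sum>w\<in>supp \<phi>. partial v (bar_field \<mu> w) * \<phi> w))"

lemma not_in_supp: "supp \<phi> \<subseteq> S \<Longrightarrow> v \<notin> S \<Longrightarrow> \<phi> v = 0"
  unfolding supp_def by blast

lemma supp_subsets:
  "supp 0 = {}" "supp (\<phi> + \<psi>) \<subseteq> supp \<phi> \<union> supp \<psi>" "supp (c *\<^sub>R \<phi>) \<subseteq> supp \<phi>"
  "supp (fmul g \<phi>) \<subseteq> supp \<phi>" "supp (single w g) \<subseteq> {w}"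
  by (auto simp: supp_def fmul_def single_def zero_fun_apply plus_fun_apply scaleR_fun_apply)

lemma vformsI:
  assumes "finite S" "S \<subseteq> fibre_vars" "supp \<phi> \<subseteq> S" "\<And>v. v \<in> S \<Longrightarrow> \<phi> v \<in> ACPE"
  shows "\<phi> \<in> vforms"
proof -
  have "\<phi> v \<in> ACPE" for v using assms(4) not_in_supp[OF assms(3)] ACPE_closed(5) by metis
  then show ?thesis using assms(1-3) finite_subset unfolding vforms_def by blast
qed

lemma
  assumes "\<phi> \<in> vforms"
  shows vforms_ACPE: "\<phi> v \<in> ACPE" and finite_supp: "finite (supp \<phi>)"
    and supp_fibre: "supp \<phi> \<subseteq> fibre_vars" and vforms_outside: "v \<notin> fibre_vars \<Longrightarrow> \<phi> v = 0"
  using assms unfolding vforms_def supp_def by blast+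

lemma subspace_vforms: "subspace vforms"
  unfolding subspace_def
proof (intro conjI ballI allI)
  show "0 \<in> vforms" by (rule vformsI[of "{}"]) (auto simp: supp_subsets)
  show "\<phi> + \<psi> \<in> vforms" if "\<phi> \<in> vforms" "\<psi> \<in> vforms" for \<phi> \<psi>
    by (rule vformsI[OF _ _ supp_subsets(2)])
      (use that finite_supp supp_fibre in \<open>auto simp: plus_fun_apply intro: ACPE_closed vforms_ACPE\<close>)
  show "c *\<^sub>R \<phi> \<in> vforms" if "\<phi> \<in> vforms" for c \<phi>
    by (rule vformsI[OF _ _ supp_subsets(3)])
      (use that finite_supp supp_fibre in \<open>auto simp: scaleR_fun_apply intro: ACPE_closed vforms_ACPE\<close>)
qed

lemmas vforms_closed = subspace_0[OF subspace_vforms] subspace_add[OF subspace_vforms]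
  subspace_diff[OF subspace_vforms] subspace_sum[OF subspace_vforms]

lemma fmul_vforms: "g \<in> ACPE \<Longrightarrow> \<phi> \<in> vforms \<Longrightarrow> fmul g \<phi> \<in> vforms"
  by (rule vformsI[OF finite_supp supp_fibre supp_subsets(4)])
    (auto simp: fmul_def intro: ACPE_closed vforms_ACPE)

lemma dV_vforms:
  assumes "f \<in> ACPE" shows "dV f \<in> vforms"
proof -
  obtain S where S: "finite S" "S \<subseteq> {v. free_var m v}" "depends_on f S"
    using assms smooth_obtain_dependence unfolding ACPE_def by metis
  show ?thesis
  proof (rule vformsI)
    show "finite (S \<inter> fibre_vars)" "S \<inter> fibre_vars \<subseteq> fibre_vars" using S by auto
    show "dV f v \<in> ACPE" for v using assms by (auto simp: dV_def intro: ACPE_closed)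
    show "supp (dV f) \<subseteq> S \<inter> fibre_vars"
      using S(2) partial_outside[OF S(3)] by (auto simp: supp_def dV_def fibre_vars_def split: if_splits)
  qed
qed

lemma single_vforms: "w \<in> fibre_vars \<Longrightarrow> g \<in> ACPE \<Longrightarrow> single w g \<in> vforms"
  by (rule vformsI[OF _ _ supp_subsets(5)]) (auto simp: single_def)

lemma single_eq_fmul_dV: "\<not> is_X w \<Longrightarrow> single w g = fmul g (dV (coord w))"
  by (auto simp: single_def fmul_def dV_def partial_coord fun_eq_iff pointwise)

lemma vform_eq_sum_single:
  assumes "finite S" "supp \<phi> \<subseteq> S" shows "(\<Sum>w\<in>S. single w (\<phi> w)) = \<phi>"
proof
  fix v
  have "(\<Sum>w\<in>S. single w (\<phi> w)) v = (\<Sum>w\<in>S. if v = w then \<phi> w else 0)"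
    by (simp add: sum_fun_apply single_def)
  also have "\<dots> = \<phi> v" using assms not_in_supp[OF assms(2)] by simp
  finally show "(\<Sum>w\<in>S. single w (\<phi> w)) v = \<phi> v" .
qed

lemma linear_on_eq_of_singles:
  assumes T: "linear_on V T" and T': "linear_on V T'" and V: "subspace V" and fin: "finite (supp \<phi>)"
    and singles: "\<And>w. w \<in> supp \<phi> \<Longrightarrow> single w (\<phi> w) \<in> V"
      "\<And>w. w \<in> supp \<phi> \<Longrightarrow> T (single w (\<phi> w)) = T' (single w (\<phi> w))"
  shows "T \<phi> = T' \<phi>"
proof -
  have "T (\<Sum>w\<in>supp \<phi>. single w (\<phi> w)) = (\<Sum>w\<in>supp \<phi>. T (single w (\<phi> w)))"
    "T' (\<Sum>w\<in>supp \<phi>. single w (\<phi> w)) = (\<Sum>w\<in>supp \<phi>. T' (single w (\<phi> w)))"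
    by (intro linear_on_sum[OF T V] linear_on_sum[OF T' V] singles(1); assumption)+
  then show ?thesis using singles(2) by (simp add: vform_eq_sum_single[OF fin order_refl])
qed

lemma linear_on_vforms_eqI:
  assumes T: "linear_on vforms T" and T': "linear_on vforms T'"
    and eq: "\<And>w g. w \<in> fibre_vars \<Longrightarrow> g \<in> ACPE \<Longrightarrow> T (single w g) = T' (single w g)"
    and \<phi>: "\<phi> \<in> vforms"
  shows "T \<phi> = T' \<phi>"
proof (rule linear_on_eq_of_singles[OF T T' subspace_vforms finite_supp[OF \<phi>]])
  fix w assume "w \<in> supp \<phi>"
  then have "w \<in> fibre_vars" "\<phi> w \<in> ACPE" using supp_fibre[OF \<phi>] vforms_ACPE[OF \<phi>] by auto
  then show "single w (\<phi> w) \<in> vforms" "T (single w (\<phi> w)) = T' (single w (\<phi> w))"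
    by (simp_all add: single_vforms eq)
qed

lemma linear_on_dV: "linear_on ACPE dV"
proof (rule linear_onI)
  show "dV (f + g) = dV f + dV g" if "f \<in> ACPE" "g \<in> ACPE" for f g
    using that linear_on_add[OF linear_on_partial]
    unfolding ACPE_def by (auto simp: dV_def fun_eq_iff pointwise)
  show "dV (c *\<^sub>R f) = c *\<^sub>R dV f" if "f \<in> ACPE" for c f
    using that linear_on_scaleR[OF linear_on_partial]
    unfolding ACPE_def by (auto simp: dV_def fun_eq_iff pointwise)
qed

lemma dV_mult: "f \<in> ACPE \<Longrightarrow> g \<in> ACPE \<Longrightarrow> dV (f * g) = fmul g (dV f) + fmul f (dV g)"
  unfolding ACPE_def by (auto simp: dV_def fmul_def partial_mult fun_eq_iff pointwise algebra_simps)

lemma lie_vform_eq_sum: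
  assumes "finite S" "supp \<phi> \<subseteq> S" "\<not> is_X v"
  shows "lie_vform \<mu> \<phi> v = Dbar \<mu> (\<phi> v) + (\<Sum>w\<in>S. partial v (bar_field \<mu> w) * \<phi> w)"
proof -
  have "(\<Sum>w\<in>supp \<phi>. partial v (bar_field \<mu> w) * \<phi> w) = (\<Sum>w\<in>S. partial v (bar_field \<mu> w) * \<phi> w)"
    using assms(1,2) not_in_supp[OF order_refl, of _ \<phi>] by (intro sum.mono_neutral_left) auto
  then show ?thesis using assms(3) by (simp add: lie_vform_def)
qed

lemma lie_vform_X: "is_X v \<Longrightarrow> lie_vform \<mu> \<phi> v = 0"
  by (simp add: lie_vform_def)

lemma linear_on_lie_vform: "linear_on vforms (lie_vform \<mu>)"
proof (rule linear_onI)
  fix \<phi> assume \<phi>: "\<phi> \<in> vforms"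
  show "lie_vform \<mu> (\<phi> + \<psi>) = lie_vform \<mu> \<phi> + lie_vform \<mu> \<psi>" if \<psi>: "\<psi> \<in> vforms" for \<psi>
  proof
    fix v
    show "lie_vform \<mu> (\<phi> + \<psi>) v = (lie_vform \<mu> \<phi> + lie_vform \<mu> \<psi>) v"
    proof (cases "is_X v")
      case False
      have S: "finite (supp \<phi> \<union> supp \<psi>)" "supp \<phi> \<subseteq> supp \<phi> \<union> supp \<psi>" "supp \<psi> \<subseteq> supp \<phi> \<union> supp \<psi>"
        using \<phi> \<psi> finite_supp by auto
      show ?thesis
        using linear_on_add[OF linear_on_Dbar vforms_ACPE[OF \<phi>] vforms_ACPE[OF \<psi>]]
        by (simp add: plus_fun_apply lie_vform_eq_sum[OF S(1) supp_subsets(2) False]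
            lie_vform_eq_sum[OF S(1,2) False]
            lie_vform_eq_sum[OF S(1,3) False] distrib_left sum.distrib)
    qed (simp add: lie_vform_X plus_fun_apply)
  qed
  show "lie_vform \<mu> (c *\<^sub>R \<phi>) = c *\<^sub>R lie_vform \<mu> \<phi>" for c
  proof
    fix v
    show "lie_vform \<mu> (c *\<^sub>R \<phi>) v = (c *\<^sub>R lie_vform \<mu> \<phi>) v"
    proof (cases "is_X v")
      case False
      then show ?thesis
        using linear_on_scaleR[OF linear_on_Dbar vforms_ACPE[OF \<phi>]] finite_supp[OF \<phi>]
        by (simp add: scaleR_fun_apply lie_vform_eq_sum[OF _ supp_subsets(3)]
            lie_vform_eq_sum[OF _ order_refl]
            scaleR_right.sum scaleR_add_right)
    qed (simp add: lie_vform_X scaleR_fun_apply)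
  qed
qed

lemma lie_vform_vforms:
  assumes \<phi>: "\<phi> \<in> vforms" and \<mu>: "\<mu> \<in> {1..m}" shows "lie_vform \<mu> \<phi> \<in> vforms"
proof -
  have field: "bar_field \<mu> w \<in> ACPE" if "w \<in> supp \<phi>" for w
    using that supp_fibre[OF \<phi>] \<mu> by (auto simp: fibre_vars_def intro: bar_field_ACPE)
  then have "dV (bar_field \<mu> w) \<in> vforms" if "w \<in> supp \<phi>" for w using that dV_vforms by blast
  note dV_field = finite_supp[OF this] supp_fibre[OF this]
  show ?thesis
  proof (rule vformsI)
    let ?S = "supp \<phi> \<union> (\<Union>w\<in>supp \<phi>. supp (dV (bar_field \<mu> w)))"
    show "finite ?S" using finite_supp[OF \<phi>] dV_field by simp
    show "?S \<subseteq> fibre_vars" using supp_fibre[OF \<phi>] dV_field by blast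
    show "lie_vform \<mu> \<phi> v \<in> ACPE" for v
      using field \<phi> \<mu>
      by (cases "is_X v") (auto simp: lie_vform_def intro!: ACPE_closed Dbar_ACPE vforms_ACPE[OF \<phi>])
    show "supp (lie_vform \<mu> \<phi>) \<subseteq> ?S"
    proof (rule ccontr)
      assume "\<not> ?thesis"
      then obtain v where v: "lie_vform \<mu> \<phi> v \<noteq> 0" "v \<notin> ?S" by (auto simp: supp_def)
      then have "\<not> is_X v" "\<phi> v = 0" by (auto simp: lie_vform_X supp_def)
      then have "partial v (bar_field \<mu> w) = 0" if "w \<in> supp \<phi>" for w
        using that v(2) by (auto simp: supp_def dV_def)
      then show False using v(1) \<open>\<phi> v = 0\<close> by (simp add: lie_vform_def cong: sum.cong split: if_splits)
    qed
  qed
qed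

lemma lie_vform_fmul:
  assumes g: "g \<in> ACPE" and \<phi>: "\<phi> \<in> vforms"
  shows "lie_vform \<mu> (fmul g \<phi>) = fmul (Dbar \<mu> g) \<phi> + fmul g (lie_vform \<mu> \<phi>)"
proof
  fix v
  show "lie_vform \<mu> (fmul g \<phi>) v = (fmul (Dbar \<mu> g) \<phi> + fmul g (lie_vform \<mu> \<phi>)) v"
  proof (cases "is_X v")
    case True
    then have "\<phi> v = 0" using vforms_outside[OF \<phi>] by (simp add: fibre_vars_def)
    then show ?thesis using True by (simp add: lie_vform_X fmul_def plus_fun_apply)
  next
    case False
    have "lie_vform \<mu> (fmul g \<phi>) v = Dbar \<mu> (g * \<phi> v) + (\<Sum>w\<in>supp \<phi>. partial v (bar_field \<mu> w) * (g * \<phi> w))"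
      using lie_vform_eq_sum[OF finite_supp[OF \<phi>] supp_subsets(4) False] by (simp add: fmul_def)
    then show ?thesis
      using False Dbar_mult[OF g vforms_ACPE[OF \<phi>]]
      by (simp add: plus_fun_apply fmul_def lie_vform_def sum_distrib_left algebra_simps)
  qed
qed

lemma lie_vform_dV:
  assumes f: "f \<in> ACPE" and \<mu>: "\<mu> \<in> {1..m}" shows "lie_vform \<mu> (dV f) = dV (Dbar \<mu> f)"
proof
  fix v
  obtain S where S: "finite S" "S \<subseteq> {v. free_var m v}" "depends_on f S"
    using f smooth_obtain_dependence unfolding ACPE_def by metis
  have supp: "supp (dV f) \<subseteq> S" using partial_outside[OF S(3)] by (auto simp: supp_def dV_def split: if_splits)
  show "lie_vform \<mu> (dV f) v = dV (Dbar \<mu> f) v"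
  proof (cases "is_X v")
    case False
    have "partial v (bar_field \<mu> w) * dV f w = partial v (bar_field \<mu> w) * partial w f" for w
      by (cases w) (simp_all add: dV_def)
    moreover have "bar_field \<mu> w \<in> smooth {v. free_var m v}" if "w \<in> S" for w
      using that S(2) \<mu> bar_field_ACPE unfolding ACPE_def by blast
    ultimately show ?thesis
      using False partial_lie[OF f[unfolded ACPE_def] S(1,3), of "bar_field \<mu>" "{v. free_var m v}"]
      by (simp add: lie_vform_eq_sum[OF S(1) supp False]) (simp add: dV_def Dbar_def)
  qed (simp add: lie_vform_X dV_def)
qed

lemma lie_vform_fmul_dV:
  "g \<in> ACPE \<Longrightarrow> f \<in> ACPE \<Longrightarrow> \<mu> \<in> {1..m} \<Longrightarrow>
    lie_vform \<mu> (fmul g (dV f)) = fmul (Dbar \<mu> g) (dV f) + fmul g (dV (Dbar \<mu> f))"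
  by (simp add: lie_vform_fmul dV_vforms lie_vform_dV)

lemma fibre_varsD: "w \<in> fibre_vars \<Longrightarrow> \<not> is_X w" "w \<in> fibre_vars \<Longrightarrow> coord w \<in> ACPE"
  by (auto simp: fibre_vars_def intro: ACPE_closed)

lemma shiftv_fibre_vars: "\<alpha> \<in> N \<Longrightarrow> shiftv \<alpha> w \<in> fibre_vars \<longleftrightarrow> w \<in> fibre_vars"
  by (simp add: fibre_vars_def free_shiftv_iff del: Nset_iff)

lemma N_imp_M: "\<alpha> \<in> N \<Longrightarrow> \<alpha> \<in> {1..m}"
  by simp

lemma bar_field_N: "\<alpha> \<in> N \<Longrightarrow> w \<in> fibre_vars \<Longrightarrow> bar_field \<alpha> w = coord (shiftv \<alpha> w)"
  by (auto simp: bar_field_def fibre_vars_def)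

lemma lie_vform_single:
  assumes "w \<in> fibre_vars" "g \<in> ACPE" "\<mu> \<in> {1..m}"
  shows "lie_vform \<mu> (single w g) = single w (Dbar \<mu> g) + fmul g (dV (bar_field \<mu> w))"
  using assms fibre_varsD[OF assms(1)] lie_vform_fmul_dV[of g "coord w" \<mu>]
  by (simp add: single_eq_fmul_dV Dbar_coord)

lemma lie_vform_single_N:
  assumes "w \<in> fibre_vars" "g \<in> ACPE" "\<alpha> \<in> N"
  shows "lie_vform \<alpha> (single w g) = single w (Dbar \<alpha> g) + single (shiftv \<alpha> w) g"
  using lie_vform_single[OF assms(1,2) N_imp_M[OF assms(3)]] fibre_varsD(1)[OF assms(1)]
  by (simp add: bar_field_N[OF assms(3,1)] single_eq_fmul_dV[of "shiftv \<alpha> w"])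

lemma lie_vform_commute:
  assumes \<phi>: "\<phi> \<in> vforms" and \<mu>: "\<mu> \<in> {1..m}" and \<nu>: "\<nu> \<in> {1..m}"
  shows "lie_vform \<mu> (lie_vform \<nu> \<phi>) = lie_vform \<nu> (lie_vform \<mu> \<phi>)"
proof -
  have linear: "linear_on vforms (\<lambda>\<phi>. lie_vform \<kappa> (lie_vform \<iota> \<phi>))" if "\<iota> \<in> {1..m}" for \<kappa> \<iota>
    by (rule linear_on_compose[OF linear_on_lie_vform linear_on_lie_vform]) (rule lie_vform_vforms[OF _ that])
  show ?thesis
  proof (rule linear_on_vforms_eqI[OF linear[OF \<nu>] linear[OF \<mu>] _ \<phi>])
    fix w g assume w: "w \<in> fibre_vars" and g: "g \<in> ACPE"
    have lie_vform_lie_vform: "lie_vform \<kappa> (lie_vform \<iota> (single w g))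
        = fmul (Dbar \<kappa> (Dbar \<iota> g)) (dV (coord w)) + fmul (Dbar \<iota> g) (dV (Dbar \<kappa> (coord w)))
          + (fmul (Dbar \<kappa> g) (dV (Dbar \<iota> (coord w))) + fmul g (dV (Dbar \<kappa> (Dbar \<iota> (coord w)))))"
      if "\<kappa> \<in> {1..m}" "\<iota> \<in> {1..m}" for \<kappa> \<iota>
    proof -
      have "lie_vform \<iota> (single w g) = fmul (Dbar \<iota> g) (dV (coord w)) + fmul g (dV (Dbar \<iota> (coord w)))"
        using w g that by (simp add: single_eq_fmul_dV lie_vform_fmul_dV fibre_varsD)
      then show ?thesis
        using that fibre_varsD(2)[OF w] g
        by (simp add: linear_on_add[OF linear_on_lie_vform] lie_vform_fmul_dV fmul_vforms dV_vforms Dbar_ACPE)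
    qed
    show "lie_vform \<mu> (lie_vform \<nu> (single w g)) = lie_vform \<nu> (lie_vform \<mu> (single w g))"
      using \<mu> \<nu> g fibre_varsD(2)[OF w] by (simp add: lie_vform_lie_vform Dbar_commute[of _ \<mu> \<nu>])
  qed
qed

lemma lie_vform_apply_shiftv:
  assumes \<phi>: "\<phi> \<in> vforms" and \<alpha>: "\<alpha> \<in> N" and w: "\<not> is_X w"
  shows "lie_vform \<alpha> \<phi> (shiftv \<alpha> w) = Dbar \<alpha> (\<phi> (shiftv \<alpha> w)) + \<phi> w"
proof -
  have "(\<Sum>v\<in>supp \<phi>. partial (shiftv \<alpha> w) (bar_field \<alpha> v) * \<phi> v) = (\<Sum>v\<in>supp \<phi>. if v = w then \<phi> v else 0)"
    using supp_fibre[OF \<phi>] bar_field_N[OF \<alpha>]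
    by (intro sum.cong) (auto simp: partial_coord inj_eq[OF inj_shiftv])
  also have "\<dots> = \<phi> w" using finite_supp[OF \<phi>] not_in_supp[OF order_refl, of w \<phi>] by simp
  finally show ?thesis using w by (simp add: lie_vform_def)
qed

subsection \<open>The partial Euler operator\<close>

definition base_vforms :: "nat set \<Rightarrow> (var \<Rightarrow> fn) set" where
  "base_vforms A = {\<rho> \<in> vforms. \<forall>v\<in>supp \<rho>. \<forall>\<alpha>\<in>A. idx \<alpha> v = 0}"

definition vdivergences :: "nat set \<Rightarrow> (var \<Rightarrow> fn) set" where
  "vdivergences A = span (\<Union>\<alpha>\<in>A. lie_vform \<alpha> ` vforms)"

definition euler :: "nat set \<Rightarrow> (var \<Rightarrow> fn) \<Rightarrow> var \<Rightarrow> fn" where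
  "euler A \<phi> = (THE \<rho>. \<rho> \<in> base_vforms A \<and> \<phi> - \<rho> \<in> vdivergences A)"

lemma subspace_base_vforms: "subspace (base_vforms A)"
  unfolding subspace_def
proof (intro conjI ballI allI)
  show "0 \<in> base_vforms A" by (simp add: base_vforms_def vforms_closed supp_subsets)
  show "\<phi> + \<psi> \<in> base_vforms A" if "\<phi> \<in> base_vforms A" "\<psi> \<in> base_vforms A" for \<phi> \<psi>
    using that supp_subsets(2)[of \<phi> \<psi>] by (auto simp: base_vforms_def vforms_closed)
  show "c *\<^sub>R \<phi> \<in> base_vforms A" if "\<phi> \<in> base_vforms A" for c \<phi>
    using that supp_subsets(3)[of c \<phi>] by (auto simp: base_vforms_def subspace_scale[OF subspace_vforms])
qed

lemma subspace_vdivergences: "subspace (vdivergences A)"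
  unfolding vdivergences_def by (rule subspace_span)

lemma lie_vform_vdivergences: "\<alpha> \<in> A \<Longrightarrow> \<phi> \<in> vforms \<Longrightarrow> lie_vform \<alpha> \<phi> \<in> vdivergences A"
  unfolding vdivergences_def by (blast intro: span_base)

lemma lie_vform_vdivergences_subset: "A \<subseteq> N \<Longrightarrow> (\<Union>\<alpha>\<in>A. lie_vform \<alpha> ` vforms) \<subseteq> vforms"
  using lie_vform_vforms N_imp_M by blast

lemma lie_vform_vdivergences_closed:
  assumes A: "A \<subseteq> N" and \<mu>: "\<mu> \<in> {1..m}" and \<phi>: "\<phi> \<in> vdivergences A"
  shows "lie_vform \<mu> \<phi> \<in> vdivergences A"
proof (rule linear_on_span[OF linear_on_lie_vform subspace_vforms subspace_vdivergences
    lie_vform_vdivergences_subset[OF A]])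
  fix \<psi> assume "\<psi> \<in> (\<Union>\<alpha>\<in>A. lie_vform \<alpha> ` vforms)"
  then obtain \<alpha> \<omega> where \<omega>: "\<alpha> \<in> A" "\<omega> \<in> vforms" "\<psi> = lie_vform \<alpha> \<omega>" by blast
  then have "lie_vform \<mu> \<psi> = lie_vform \<alpha> (lie_vform \<mu> \<omega>)" using lie_vform_commute[OF _ \<mu> N_imp_M] A by auto
  then show "lie_vform \<mu> \<psi> \<in> vdivergences A" using \<omega> \<mu> by (simp add: lie_vform_vdivergences lie_vform_vforms)
qed (use \<phi> in \<open>simp add: vdivergences_def\<close>)

lemma supp_lie_vform:
  assumes "\<phi> \<in> vforms" "\<alpha> \<in> N" shows "supp (lie_vform \<alpha> \<phi>) \<subseteq> supp \<phi> \<union> shiftv \<alpha> ` supp \<phi>"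
proof
  fix v assume v: "v \<in> supp (lie_vform \<alpha> \<phi>)"
  show "v \<in> supp \<phi> \<union> shiftv \<alpha> ` supp \<phi>"
  proof (rule ccontr)
    assume "v \<notin> supp \<phi> \<union> shiftv \<alpha> ` supp \<phi>"
    moreover from this have "partial v (bar_field \<alpha> w) = 0" if "w \<in> supp \<phi>" for w
      using that bar_field_N[OF assms(2) subsetD[OF supp_fibre[OF assms(1)] that]]
      by (auto simp: partial_coord)
    ultimately have "lie_vform \<alpha> \<phi> v = 0"
      using not_in_supp[OF order_refl, of v \<phi>] by (simp add: lie_vform_def)
    then show False using v by (simp add: supp_def)
  qed
qed

lemma lie_vform_base_vforms:
  assumes \<rho>: "\<rho> \<in> base_vforms A" and \<beta>: "\<beta> \<in> N - A" shows "lie_vform \<beta> \<rho> \<in> base_vforms A"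
proof -
  have \<rho>_vf: "\<rho> \<in> vforms" using \<rho> by (simp add: base_vforms_def)
  have "idx \<alpha> (shiftv \<beta> w) = idx \<alpha> w" if "\<alpha> \<in> A" for \<alpha> w using that \<beta> by (intro idx_shiftv) auto
  then show ?thesis
    using \<rho> \<beta> supp_lie_vform[OF \<rho>_vf, of \<beta>] lie_vform_vforms[OF \<rho>_vf, of \<beta>] unfolding base_vforms_def by auto
qed

lemma base_vforms_imp_vforms: "\<rho> \<in> base_vforms A \<Longrightarrow> \<rho> \<in> vforms"
  by (simp add: base_vforms_def)

lemma lie_vform_base_vforms_imp_zero:
  assumes \<phi>: "\<phi> \<in> vforms" and \<beta>: "\<beta> \<in> N" and base: "lie_vform \<beta> \<phi> \<in> base_vforms {\<beta>}"
  shows "\<phi> = 0"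
proof (rule ccontr)
  assume "\<phi> \<noteq> 0"
  then have "supp \<phi> \<noteq> {}" by (auto simp: supp_def fun_eq_iff zero_fun_apply)
  then obtain w where w: "w \<in> supp \<phi>" "\<And>v. v \<in> supp \<phi> \<Longrightarrow> idx \<beta> v \<le> idx \<beta> w"
    using Max_ge[of "idx \<beta> ` supp \<phi>"] Max_in[of "idx \<beta> ` supp \<phi>"] finite_supp[OF \<phi>] by fastforce
  have X: "\<not> is_X w" using w(1) supp_fibre[OF \<phi>] fibre_varsD by blast
  then have idx: "idx \<beta> (shiftv \<beta> w) = Suc (idx \<beta> w)" by (rule idx_shiftv)
  then have "\<phi> (shiftv \<beta> w) = 0" using w(2)[of "shiftv \<beta> w"] by (auto simp: supp_def)
  then have "lie_vform \<beta> \<phi> (shiftv \<beta> w) = \<phi> w" by (simp add: lie_vform_apply_shiftv[OF \<phi> \<beta> X])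
  then have "shiftv \<beta> w \<in> supp (lie_vform \<beta> \<phi>)" using w(1) by (simp add: supp_def)
  then show False using base idx by (auto simp: base_vforms_def)
qed

lemma lie_vform_eq_0_imp:
  assumes "\<phi> \<in> vforms" "\<beta> \<in> N" "lie_vform \<beta> \<phi> = 0" shows "\<phi> = 0"
  using lie_vform_base_vforms_imp_zero[OF assms(1,2)] assms(3) subspace_0[OF subspace_base_vforms] by simp

lemma single_decomposition:
  assumes A: "finite A" "A \<subseteq> N" and w: "w \<in> fibre_vars" and g: "g \<in> ACPE"
  shows "\<exists>\<rho>\<in>base_vforms A. single w g - \<rho> \<in> vdivergences A"
  using w g
proof (induction "\<Sum>\<alpha>\<in>A. idx \<alpha> w" arbitrary: w g)
  case 0
  then have "\<forall>\<alpha>\<in>A. idx \<alpha> w = 0" using A by (metis sum_eq_0_iff)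
  then have "single w g \<in> base_vforms A"
    using 0 supp_subsets(5)[of w g] by (auto simp: base_vforms_def single_vforms)
  then show ?case using subspace_0[OF subspace_vdivergences] by force
next
  case (Suc n)
  then obtain \<alpha> where \<alpha>: "\<alpha> \<in> A" "0 < idx \<alpha> w" by (metis gr0I sum.neutral nat.distinct(1))
  then obtain u where u: "w = shiftv \<alpha> u" using obtain_unshift by blast
  have \<alpha>N: "\<alpha> \<in> N" using \<alpha> A by blast
  have u_fibre: "u \<in> fibre_vars" using Suc.prems \<alpha>N unfolding u by (simp add: shiftv_fibre_vars del: Nset_iff)
  have "(\<Sum>\<beta>\<in>A. idx \<beta> w) = Suc (\<Sum>\<beta>\<in>A. idx \<beta> u)"
    using A \<alpha> fibre_varsD(1)[OF u_fibre] unfolding u by (simp add: sum.remove[of A \<alpha>] idx_shiftv)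
  then have "n = (\<Sum>\<beta>\<in>A. idx \<beta> u)" using Suc.hyps(2) by simp
  then obtain \<rho> where \<rho>: "\<rho> \<in> base_vforms A" "single u (Dbar \<alpha> g) - \<rho> \<in> vdivergences A"
    using Suc.hyps(1) u_fibre Dbar_ACPE[OF Suc.prems(2) N_imp_M[OF \<alpha>N]] by blast
  have "lie_vform \<alpha> (single u g) - (single u (Dbar \<alpha> g) - \<rho>) \<in> vdivergences A"
    by (intro subspace_diff[OF subspace_vdivergences] lie_vform_vdivergences[OF \<alpha>(1)]
        single_vforms[OF u_fibre Suc.prems(2)] \<rho>(2))
  then have "single w g - (- \<rho>) \<in> vdivergences A"
    unfolding u by (simp add: lie_vform_single_N[OF u_fibre Suc.prems(2) \<alpha>N] algebra_simps)
  then show ?case using subspace_neg[OF subspace_base_vforms \<rho>(1)] by blast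
qed

lemma vform_decomposition:
  assumes A: "finite A" "A \<subseteq> N" and \<phi>: "\<phi> \<in> vforms"
  shows "\<exists>\<rho>\<in>base_vforms A. \<phi> - \<rho> \<in> vdivergences A"
proof -
  have "\<exists>\<rho>\<in>base_vforms A. single w (\<phi> w) - \<rho> \<in> vdivergences A" if "w \<in> supp \<phi>" for w
    using that supp_fibre[OF \<phi>] vforms_ACPE[OF \<phi>] by (intro single_decomposition[OF A]) auto
  then obtain \<rho> where \<rho>: "\<And>w. w \<in> supp \<phi> \<Longrightarrow> \<rho> w \<in> base_vforms A \<and> single w (\<phi> w) - \<rho> w \<in> vdivergences A"
    by metis
  then have "(\<Sum>w\<in>supp \<phi>. single w (\<phi> w) - \<rho> w) \<in> vdivergences A"
    by (intro subspace_sum[OF subspace_vdivergences]) simp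
  moreover have "(\<Sum>w\<in>supp \<phi>. \<rho> w) \<in> base_vforms A"
    using \<rho> by (intro subspace_sum[OF subspace_base_vforms]) simp
  ultimately show ?thesis
    using vform_eq_sum_single[OF finite_supp[OF \<phi>] order_refl] by (auto simp: sum_subtractf)
qed

lemma base_vforms_Int_vdivergences:
  assumes "finite A" "A \<subseteq> N" "\<rho> \<in> base_vforms A" "\<rho> \<in> vdivergences A"
  shows "\<rho> = 0"
  using assms
proof (induction A arbitrary: \<rho> rule: finite_induct)
  case empty
  then show ?case by (simp add: vdivergences_def)
next
  case (insert \<beta> A)
  have \<beta>: "\<beta> \<in> N" "\<beta> \<in> {1..m}" "\<beta> \<in> N - A" using insert.prems(1) insert.hyps(2) by auto
  have "span (lie_vform \<beta> ` vforms) = lie_vform \<beta> ` vforms"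
    using linear_on_subspace_image[OF linear_on_lie_vform subspace_vforms] by (simp add: span_eq_iff)
  then have "vdivergences (insert \<beta> A) = {x + y |x y. x \<in> lie_vform \<beta> ` vforms \<and> y \<in> vdivergences A}"
    unfolding vdivergences_def UN_insert span_Un by (rule arg_cong)
  then obtain \<psi> \<tau> where \<psi>: "\<psi> \<in> vforms" "\<tau> \<in> vdivergences A" "\<rho> = lie_vform \<beta> \<psi> + \<tau>"
    using insert.prems(3) by blast
  obtain \<sigma> where \<sigma>: "\<sigma> \<in> base_vforms A" "\<psi> - \<sigma> \<in> vdivergences A"
    using vform_decomposition[of A \<psi>] insert.hyps insert.prems \<psi> by auto
  have "\<rho> - lie_vform \<beta> \<sigma> = lie_vform \<beta> (\<psi> - \<sigma>) + \<tau>"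
    using linear_on_diff[OF linear_on_lie_vform subspace_vforms \<psi>(1) base_vforms_imp_vforms[OF \<sigma>(1)]] \<psi>(3)
    by simp
  then have "\<rho> - lie_vform \<beta> \<sigma> \<in> vdivergences A"
    using lie_vform_vdivergences_closed[OF _ \<beta>(2) \<sigma>(2)] \<psi>(2) insert.prems(1)
      subspace_add[OF subspace_vdivergences] by simp
  moreover have "\<rho> \<in> base_vforms A" using insert.prems(2) by (simp add: base_vforms_def)
  then have "\<rho> - lie_vform \<beta> \<sigma> \<in> base_vforms A"
    using lie_vform_base_vforms[OF \<sigma>(1) \<beta>(3)] by (intro subspace_diff[OF subspace_base_vforms])
  ultimately have \<rho>: "\<rho> = lie_vform \<beta> \<sigma>" using insert.IH insert.prems(1) by force
  then have "lie_vform \<beta> \<sigma> \<in> base_vforms {\<beta>}" using insert.prems(2) by (simp add: base_vforms_def)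
  then have "\<sigma> = 0" by (rule lie_vform_base_vforms_imp_zero[OF base_vforms_imp_vforms[OF \<sigma>(1)] \<beta>(1)])
  then show ?case using \<rho> linear_on_zero[OF linear_on_lie_vform subspace_vforms] by simp
qed

lemma euler_eqI:
  assumes A: "A \<subseteq> N" and \<rho>: "\<rho> \<in> base_vforms A" "\<phi> - \<rho> \<in> vdivergences A"
  shows "euler A \<phi> = \<rho>"
  unfolding euler_def
proof (rule the_equality)
  fix \<rho>' assume \<rho>': "\<rho>' \<in> base_vforms A \<and> \<phi> - \<rho>' \<in> vdivergences A"
  then have "\<rho>' - \<rho> \<in> base_vforms A" using \<rho>(1) subspace_diff[OF subspace_base_vforms] by blast
  moreover have "\<rho>' - \<rho> \<in> vdivergences A" using \<rho>(2) \<rho>' subspace_diff[OF subspace_vdivergences] by force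
  ultimately show "\<rho>' = \<rho>" using base_vforms_Int_vdivergences[OF finite_subset[OF A] A] by fastforce
qed (use \<rho> in blast)

lemma euler_decomposition:
  assumes "A \<subseteq> N" "\<phi> \<in> vforms" shows "euler A \<phi> \<in> base_vforms A" "\<phi> - euler A \<phi> \<in> vdivergences A"
  using vform_decomposition[OF finite_subset[OF assms(1)] assms] euler_eqI[OF assms(1)] by auto

lemma linear_on_euler:
  assumes A: "A \<subseteq> N" shows "linear_on vforms (euler A)"
proof (rule linear_onI)
  fix \<phi> assume \<phi>: "\<phi> \<in> vforms"
  note dec = euler_decomposition[OF A]
  show "euler A (\<phi> + \<psi>) = euler A \<phi> + euler A \<psi>" if \<psi>: "\<psi> \<in> vforms" for \<psi>
  proof (rule euler_eqI[OF A])
    show "euler A \<phi> + euler A \<psi> \<in> base_vforms A" by (intro subspace_add[OF subspace_base_vforms] dec \<phi> \<psi>)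
    show "\<phi> + \<psi> - (euler A \<phi> + euler A \<psi>) \<in> vdivergences A"
      using subspace_add[OF subspace_vdivergences dec(2)[OF \<phi>] dec(2)[OF \<psi>]] by (simp add: algebra_simps)
  qed
  show "euler A (c *\<^sub>R \<phi>) = c *\<^sub>R euler A \<phi>" for c
    using subspace_scale[OF subspace_vdivergences dec(2)[OF \<phi>], of c]
    by (intro euler_eqI[OF A] subspace_scale[OF subspace_base_vforms] dec \<phi>) (simp add: scaleR_diff_right)
qed

lemma euler_vdivergences:
  assumes "A \<subseteq> N" "\<phi> \<in> vdivergences A" shows "euler A \<phi> = 0"
  using assms by (intro euler_eqI) (simp_all add: subspace_0[OF subspace_base_vforms])

lemma euler_base_vforms: "A \<subseteq> N \<Longrightarrow> \<rho> \<in> base_vforms A \<Longrightarrow> euler A \<rho> = \<rho>"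
  by (intro euler_eqI) (simp_all add: subspace_0[OF subspace_vdivergences])

lemma euler_lie_vform:
  assumes A: "A \<subseteq> N" and \<beta>: "\<beta> \<in> N - A" and \<phi>: "\<phi> \<in> vforms"
  shows "euler A (lie_vform \<beta> \<phi>) = lie_vform \<beta> (euler A \<phi>)"
proof (rule euler_eqI[OF A])
  note dec = euler_decomposition[OF A \<phi>]
  show "lie_vform \<beta> (euler A \<phi>) \<in> base_vforms A" by (rule lie_vform_base_vforms[OF dec(1) \<beta>])
  have "lie_vform \<beta> (\<phi> - euler A \<phi>) \<in> vdivergences A"
    using \<beta> by (intro lie_vform_vdivergences_closed[OF A _ dec(2)]) auto
  then show "lie_vform \<beta> \<phi> - lie_vform \<beta> (euler A \<phi>) \<in> vdivergences A"
    by (simp add: linear_on_diff[OF linear_on_lie_vform subspace_vforms \<phi> base_vforms_imp_vforms[OF dec(1)]])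
qed

lemma euler_lie_vform_euler:
  assumes A: "A \<subseteq> N" and \<mu>: "\<mu> \<in> {1..m}" and \<phi>: "\<phi> \<in> vforms"
  shows "euler A (lie_vform \<mu> (euler A \<phi>)) = euler A (lie_vform \<mu> \<phi>)"
proof -
  note dec = euler_decomposition[OF A \<phi>]
  have "euler A (lie_vform \<mu> (\<phi> - euler A \<phi>)) = 0"
    by (intro euler_vdivergences[OF A] lie_vform_vdivergences_closed[OF A \<mu> dec(2)])
  then show ?thesis
    using linear_on_diff[OF linear_on_lie_vform subspace_vforms \<phi> base_vforms_imp_vforms[OF dec(1)], of \<mu>]
      linear_on_diff[OF linear_on_euler[OF A] subspace_vforms lie_vform_vforms[OF \<phi> \<mu>]
          lie_vform_vforms[OF base_vforms_imp_vforms[OF dec(1)] \<mu>]]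
    by simp
qed

subsection \<open>Vertical homotopy and divergences\<close>

abbreviation fibre_ray_integral :: "nat \<Rightarrow> fn \<Rightarrow> fn" where
  "fibre_ray_integral \<equiv> ray_integral {v. \<not> is_X v}"

definition vhomotopy :: "(var \<Rightarrow> fn) \<Rightarrow> fn" where
  "vhomotopy \<phi> = (\<Sum>v\<in>supp \<phi>. coord v * fibre_ray_integral 0 (\<phi> v))"

definition divergences :: "nat set \<Rightarrow> fn set" where
  "divergences A = span (\<Union>\<alpha>\<in>A. Dbar \<alpha> ` ACPE)"

lemma fibre_ray_integral_ACPE: "f \<in> ACPE \<Longrightarrow> fibre_ray_integral n f \<in> ACPE"
  unfolding ACPE_def by (rule smooth_ray_integral)

lemma linear_on_fibre_ray_integral: "linear_on ACPE (fibre_ray_integral n)"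
  unfolding ACPE_def by (rule linear_on_ray_integral)

lemma vhomotopy_eq_sum:
  assumes "finite S" "supp \<phi> \<subseteq> S" shows "vhomotopy \<phi> = (\<Sum>v\<in>S. coord v * fibre_ray_integral 0 (\<phi> v))"
  unfolding vhomotopy_def
proof (rule sum.mono_neutral_left[OF assms])
  show "\<forall>v\<in>S - supp \<phi>. coord v * fibre_ray_integral 0 (\<phi> v) = 0"
    using not_in_supp[OF order_refl, of _ \<phi>] linear_on_zero[OF linear_on_fibre_ray_integral subspace_ACPE]
    by simp
qed

lemma linear_on_vhomotopy: "linear_on vforms vhomotopy"
proof (rule linear_onI)
  fix \<phi> assume \<phi>: "\<phi> \<in> vforms"
  show "vhomotopy (\<phi> + \<psi>) = vhomotopy \<phi> + vhomotopy \<psi>" if \<psi>: "\<psi> \<in> vforms" for \<psi>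
  proof -
    have S: "finite (supp \<phi> \<union> supp \<psi>)" "supp \<phi> \<subseteq> supp \<phi> \<union> supp \<psi>" "supp \<psi> \<subseteq> supp \<phi> \<union> supp \<psi>"
      using \<phi> \<psi> finite_supp by auto
    show ?thesis
      by (simp add: vhomotopy_eq_sum[OF S(1) supp_subsets(2)] vhomotopy_eq_sum[OF S(1,2)]
          vhomotopy_eq_sum[OF S(1,3)]
          plus_fun_apply linear_on_add[OF linear_on_fibre_ray_integral vforms_ACPE[OF \<phi>] vforms_ACPE[OF \<psi>]]
            distrib_left sum.distrib)
  qed
  show "vhomotopy (c *\<^sub>R \<phi>) = c *\<^sub>R vhomotopy \<phi>" for c
    by (simp add: vhomotopy_eq_sum[OF finite_supp[OF \<phi>] supp_subsets(3)]
        vhomotopy_eq_sum[OF finite_supp[OF \<phi>] order_refl] scaleR_fun_apply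
        linear_on_scaleR[OF linear_on_fibre_ray_integral vforms_ACPE[OF \<phi>]] scaleR_right.sum)
qed

lemma vhomotopy_ACPE:
  assumes \<phi>: "\<phi> \<in> vforms" shows "vhomotopy \<phi> \<in> ACPE"
  unfolding vhomotopy_def using fibre_varsD(2) supp_fibre[OF \<phi>]
  by (intro ACPE_closed(3,10) fibre_ray_integral_ACPE vforms_ACPE[OF \<phi>]) auto

lemma vhomotopy_single: "vhomotopy (single w g) = coord w * fibre_ray_integral 0 g"
  by (simp add: vhomotopy_eq_sum[OF _ supp_subsets(5)] single_def)

lemma Dbar_fibre_ray_integral:
  assumes f: "f \<in> ACPE" and \<alpha>: "\<alpha> \<in> N"
  shows "Dbar \<alpha> (fibre_ray_integral n f) = fibre_ray_integral n (Dbar \<alpha> f)"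
proof -
  obtain S where S: "finite S" "S \<subseteq> {v. free_var m v}" "depends_on f S"
    using f smooth_obtain_dependence unfolding ACPE_def by metis
  have Dbar_eq: "Dbar \<alpha> g = (\<Sum>v\<in>S. tot_field \<alpha> v * partial v g)" if "depends_on g S" for g
    using \<alpha> lie_eq_sum[OF S(1) that] by (simp add: Dbar_def bar_field_def)
  have "fibre_ray_integral n (tot_field \<alpha> v * partial v f)
      = tot_field \<alpha> v * partial v (fibre_ray_integral n f)" if "v \<in> S" for v
  proof (cases v)
    case (X \<nu>)
    then show ?thesis
      using f partial_ray_integral linear_on_zero[OF linear_on_fibre_ray_integral subspace_ACPE]
      by (simp add: ACPE_def)
  qed (use f in \<open>simp_all add: ray_integral_mult_coord partial_ray_integral[OF f[unfolded ACPE_def]]\<close>)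
  moreover have "fibre_ray_integral n (\<Sum>v\<in>S. tot_field \<alpha> v * partial v f)
      = (\<Sum>v\<in>S. fibre_ray_integral n (tot_field \<alpha> v * partial v f))"
  proof (rule linear_on_sum[OF linear_on_fibre_ray_integral subspace_ACPE])
    show "tot_field \<alpha> v * partial v f \<in> ACPE" if "v \<in> S" for v
      using that S f \<alpha> bar_field_ACPE[of v \<alpha>] by (auto simp: bar_field_def intro!: ACPE_closed)
  qed
  ultimately show ?thesis by (simp add: Dbar_eq S(3) depends_on_ray_integral)
qed

lemma vhomotopy_lie_vform:
  assumes \<phi>: "\<phi> \<in> vforms" and \<alpha>: "\<alpha> \<in> N" shows "vhomotopy (lie_vform \<alpha> \<phi>) = Dbar \<alpha> (vhomotopy \<phi>)"
proof (rule linear_on_vforms_eqI[of "\<lambda>\<phi>. vhomotopy (lie_vform \<alpha> \<phi>)" "\<lambda>\<phi>. Dbar \<alpha> (vhomotopy \<phi>)", OF _ _ _ \<phi>])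
  show "linear_on vforms (\<lambda>\<phi>. vhomotopy (lie_vform \<alpha> \<phi>))"
    by (rule linear_on_compose[OF linear_on_lie_vform linear_on_vhomotopy
        lie_vform_vforms[OF _ N_imp_M[OF \<alpha>]]])
  show "linear_on vforms (\<lambda>\<phi>. Dbar \<alpha> (vhomotopy \<phi>))"
    by (rule linear_on_compose[OF linear_on_vhomotopy linear_on_Dbar vhomotopy_ACPE])
  fix w g assume w: "w \<in> fibre_vars" and g: "g \<in> ACPE"
  have "shiftv \<alpha> w \<in> fibre_vars" using w \<alpha> by (simp add: shiftv_fibre_vars del: Nset_iff)
  then have "vhomotopy (lie_vform \<alpha> (single w g))
      = coord w * fibre_ray_integral 0 (Dbar \<alpha> g) + coord (shiftv \<alpha> w) * fibre_ray_integral 0 g"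
    using w g \<alpha>
    by (simp add: lie_vform_single_N linear_on_add[OF linear_on_vhomotopy] single_vforms Dbar_ACPE
        vhomotopy_single)
  then show "vhomotopy (lie_vform \<alpha> (single w g)) = Dbar \<alpha> (vhomotopy (single w g))"
    using Dbar_mult[OF fibre_varsD(2)[OF w] fibre_ray_integral_ACPE[OF g]] fibre_varsD(1)[OF w]
    by (simp add: vhomotopy_single Dbar_coord_N[OF \<alpha>] Dbar_fibre_ray_integral[OF g \<alpha>] add.commute)
qed

lemma smooth_X_imp_ACPE: "f \<in> smooth (X ` {1..m}) \<Longrightarrow> f \<in> ACPE"
  unfolding ACPE_def by (erule smooth_mono[rotated]) (auto simp: free_var_simps)

lemma vhomotopy_dV:
  assumes f: "f \<in> ACPE" shows "f - vhomotopy (dV f) \<in> smooth (X ` {1..m})"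
proof -
  define f\<^sub>0 where "f\<^sub>0 = subst (\<lambda>v. if is_X v then coord v else 0) f"
  obtain S where S: "finite S" "S \<subseteq> {v. free_var m v}" "depends_on f S"
    using f smooth_obtain_dependence unfolding ACPE_def by metis
  have "f - vhomotopy (dV f) = f\<^sub>0"
  proof
    fix y
    have "supp (dV f) \<subseteq> S" using partial_outside[OF S(3)] by (auto simp: supp_def dV_def split: if_splits)
    then have "vhomotopy (dV f) y = (\<Sum>v\<in>S. y v * fibre_ray_integral 0 (dV f v) y)"
      by (simp add: vhomotopy_eq_sum[OF S(1)] pointwise)
    moreover have "\<dots> = (\<Sum>v\<in>S. if v \<in> {v. \<not> is_X v} then y v * fibre_ray_integral 0 (partial v f) y else 0)"
      using linear_on_zero[OF linear_on_fibre_ray_integral subspace_ACPE]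
      by (intro sum.cong) (auto simp: dV_def pointwise)
    moreover have "f (scale_coords {v. \<not> is_X v} 0 y) = f\<^sub>0 y"
      unfolding f\<^sub>0_def subst_def by (rule arg_cong[where f = f]) (auto simp: scale_coords_def pointwise)
    ultimately show "(f - vhomotopy (dV f)) y = f\<^sub>0 y"
      using ray_homotopy[OF f[unfolded ACPE_def] S(1,3), of y "{v. \<not> is_X v}"] S(1)
      by (simp add: pointwise sum.inter_restrict[OF S(1)])
  qed
  moreover have "f\<^sub>0 \<in> smooth (X ` {1..m})"
    unfolding f\<^sub>0_def
  proof (rule smooth_subst[OF f[unfolded ACPE_def]])
    fix v assume "v \<in> {v. free_var m v}"
    then show "(if is_X v then coord v else 0) \<in> smooth (X ` {1..m})"
      by (cases v) (auto simp: free_var_simps intro: smooth_closed)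
  qed
  ultimately show ?thesis by simp
qed

lemma Dbar_smooth_X:
  assumes "f \<in> smooth (X ` {1..m})" shows "Dbar \<mu> f = partial (X \<mu>) f"
proof -
  obtain S where S: "finite S" "S \<subseteq> X ` {1..m}" "depends_on f S"
    using smooth_obtain_dependence[OF assms] by metis
  have "Dbar \<mu> f = (\<Sum>v\<in>insert (X \<mu>) S. bar_field \<mu> v * partial v f)"
    unfolding Dbar_def using S depends_on_mono[OF S(3) subset_insertI] by (intro lie_eq_sum) auto
  also have "\<dots> = (\<Sum>v\<in>insert (X \<mu>) S. if v = X \<mu> then partial v f else 0)"
    using S(2) by (intro sum.cong) (auto dest!: subsetD)
  finally show ?thesis using S(1) by simp
qed

lemma subspace_divergences: "subspace (divergences A)"
  unfolding divergences_def by (rule subspace_span)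

lemma Dbar_divergences: "\<alpha> \<in> A \<Longrightarrow> g \<in> ACPE \<Longrightarrow> Dbar \<alpha> g \<in> divergences A"
  unfolding divergences_def by (blast intro: span_base)

lemma Dbar_ACPE_subset: "A \<subseteq> N \<Longrightarrow> (\<Union>\<alpha>\<in>A. Dbar \<alpha> ` ACPE) \<subseteq> ACPE"
  using Dbar_ACPE N_imp_M by blast

lemma obtain_antiderivative:
  assumes f: "f \<in> smooth (X ` I)" and I: "b \<in> I" "I \<subseteq> {1..m}"
  obtains F where "F \<in> smooth (X ` I)" "Dbar b F = f"
proof
  show F: "coord (X b) * ray_integral {X b} 0 f \<in> smooth (X ` I)"
    using I(1) by (intro smooth_closed smooth_ray_integral f) auto
  show "Dbar b (coord (X b) * ray_integral {X b} 0 f) = f"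
    using smooth_mono[OF image_mono[OF I(2)] F]
    by (simp add: Dbar_smooth_X partial_coord_mult_ray_integral[OF f])
qed

lemma smooth_X_divergences:
  assumes f: "f \<in> smooth (X ` {1..m})" and \<alpha>: "\<alpha> \<in> A" "A \<subseteq> N" shows "f \<in> divergences A"
proof -
  obtain F where "F \<in> smooth (X ` {1..m})" "Dbar \<alpha> F = f"
    using obtain_antiderivative[OF f _ order_refl] \<alpha> N_imp_M by blast
  then show ?thesis using Dbar_divergences[OF \<alpha>(1) smooth_X_imp_ACPE] by blast
qed

lemma divergences_iff_euler:
  assumes f: "f \<in> ACPE" and A: "A \<subseteq> N" "A \<noteq> {}"
  shows "f \<in> divergences A \<longleftrightarrow> euler A (dV f) = 0"
proof
  assume div: "f \<in> divergences A"
  have "dV f \<in> vdivergences A"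
  proof (rule linear_on_span[OF linear_on_dV subspace_ACPE subspace_vdivergences Dbar_ACPE_subset[OF A(1)]])
    show "dV g \<in> vdivergences A" if "g \<in> (\<Union>\<alpha>\<in>A. Dbar \<alpha> ` ACPE)" for g
      using that A(1) lie_vform_dV[OF _ N_imp_M] lie_vform_vdivergences[OF _ dV_vforms]
      by (auto simp flip: lie_vform_dV)
  qed (use div in \<open>simp add: divergences_def\<close>)
  then show "euler A (dV f) = 0" by (rule euler_vdivergences[OF A(1)])
next
  assume "euler A (dV f) = 0"
  then have div: "dV f \<in> vdivergences A" using euler_decomposition(2)[OF A(1) dV_vforms[OF f]] by simp
  have "vhomotopy (dV f) \<in> divergences A"
  proof (rule linear_on_span[OF linear_on_vhomotopy subspace_vforms subspace_divergences
      lie_vform_vdivergences_subset[OF A(1)]])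
    fix \<phi> assume "\<phi> \<in> (\<Union>\<alpha>\<in>A. lie_vform \<alpha> ` vforms)"
    then obtain \<alpha> \<psi> where "\<alpha> \<in> A" "\<psi> \<in> vforms" "\<phi> = lie_vform \<alpha> \<psi>" by blast
    then show "vhomotopy \<phi> \<in> divergences A"
      using A(1) Dbar_divergences[OF _ vhomotopy_ACPE]
      by (simp add: vhomotopy_lie_vform subsetD del: Nset_iff)
  qed (use div in \<open>simp add: vdivergences_def\<close>)
  moreover have "f - vhomotopy (dV f) \<in> divergences A"
    using A smooth_X_divergences[OF vhomotopy_dV[OF f]] by blast
  ultimately show "f \<in> divergences A" using subspace_add[OF subspace_divergences] by fastforce
qed

lemma Dbar_kernel:
  assumes f: "f \<in> ACPE" and A: "A \<subseteq> N" "A \<noteq> {}" and kernel: "\<And>\<alpha>. \<alpha> \<in> A \<Longrightarrow> Dbar \<alpha> f = 0"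
  shows "f \<in> smooth (X ` ({1..m} - A))"
proof -
  obtain \<alpha> where \<alpha>: "\<alpha> \<in> A" "\<alpha> \<in> N" using A by blast
  have "lie_vform \<alpha> (dV f) = 0"
    using kernel[OF \<alpha>(1)] lie_vform_dV[OF f N_imp_M[OF \<alpha>(2)]] linear_on_zero[OF linear_on_dV subspace_ACPE]
    by simp
  then have "dV f = 0" by (rule lie_vform_eq_0_imp[OF dV_vforms[OF f] \<alpha>(2)])
  then have "vhomotopy (dV f) = 0" using linear_on_zero[OF linear_on_vhomotopy subspace_vforms] by simp
  then have fX: "f \<in> smooth (X ` {1..m})" using vhomotopy_dV[OF f] by simp
  then show ?thesis
  proof (rule smooth_restrict)
    fix v assume v: "v \<notin> X ` ({1..m} - A)"
    show "partial v f = 0"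
    proof (cases "v \<in> X ` {1..m}")
      case True
      then obtain \<alpha> where "v = X \<alpha>" "\<alpha> \<in> A" using v by blast
      then show ?thesis using kernel Dbar_smooth_X[OF fX] by metis
    qed (use smooth_partial_outside[OF fX] in blast)
  qed
qed

section \<open>Horizontal forms\<close>

text \<open>Degrees are integers, so that the forms of degree \<open>- 1\<close> are just \<open>0\<close>.\<close>

definition forms :: "nat set \<Rightarrow> int \<Rightarrow> form set" where
  "forms A q = {\<omega>. \<forall>I. \<omega> I \<in> ACPE \<and> (\<omega> I \<noteq> 0 \<longrightarrow> I \<subseteq> A \<and> int (card I) = q)}"

definition dbar :: "nat set \<Rightarrow> form \<Rightarrow> form" where
  "dbar A \<omega> I = (if I \<subseteq> A then \<Sum>\<mu>\<in>I. sgn_ins \<mu> (I - {\<mu>}) *\<^sub>R Dbar \<mu> (\<omega> (I - {\<mu>})) else 0)"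

definition cocycles :: "nat set \<Rightarrow> int \<Rightarrow> form set" where
  "cocycles A q = {\<omega> \<in> forms A q. dbar A \<omega> = 0}"

definition coboundaries :: "nat set \<Rightarrow> int \<Rightarrow> form set" where
  "coboundaries A q = dbar A ` forms A (q - 1)"

definition Dform :: "nat \<Rightarrow> form \<Rightarrow> form" where
  "Dform \<mu> \<theta> I = Dbar \<mu> (\<theta> I)"

text \<open>\<open>join b \<theta> \<zeta>\<close> is \<open>\<theta> + dx\<^sup>b \<and> \<zeta>\<close>.\<close>

definition join :: "nat \<Rightarrow> form \<Rightarrow> form \<Rightarrow> form" where
  "join b \<theta> \<zeta> I = (if b \<in> I then \<zeta> (I - {b}) else \<theta> I)"

definition restr :: "nat \<Rightarrow> form \<Rightarrow> form" where
  "restr b \<omega> I = (if b \<in> I then 0 else \<omega> I)"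

definition contract :: "nat \<Rightarrow> form \<Rightarrow> form" where
  "contract b \<omega> I = (if b \<in> I then 0 else \<omega> (insert b I))"

lemma formsD: "\<omega> \<in> forms A q \<Longrightarrow> \<omega> I \<in> ACPE" "\<omega> \<in> forms A q \<Longrightarrow> \<not> I \<subseteq> A \<or> int (card I) \<noteq> q \<Longrightarrow> \<omega> I = 0"
  unfolding forms_def by blast+

lemma formsI:
  assumes "\<And>I. I \<subseteq> A \<Longrightarrow> int (card I) = q \<Longrightarrow> \<omega> I \<in> ACPE" "\<And>I. \<not> I \<subseteq> A \<or> int (card I) \<noteq> q \<Longrightarrow> \<omega> I = 0"
  shows "\<omega> \<in> forms A q"
proof -
  have "\<omega> I \<in> ACPE" for I
    using assms[of I] ACPE_closed(5) by (cases "I \<subseteq> A \<and> int (card I) = q") auto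
  then show ?thesis using assms(2) unfolding forms_def by blast
qed

lemma subspace_forms: "subspace (forms A q)"
  unfolding subspace_def
proof (intro conjI ballI allI)
  show "0 \<in> forms A q" by (rule formsI) (auto simp: zero_fun_apply ACPE_closed)
  show "\<omega> + \<eta> \<in> forms A q" if "\<omega> \<in> forms A q" "\<eta> \<in> forms A q" for \<omega> \<eta>
    using that by (intro formsI; subst plus_fun_apply) (auto simp: formsD ACPE_closed)
  show "c *\<^sub>R \<omega> \<in> forms A q" if "\<omega> \<in> forms A q" for c \<omega>
    using that by (intro formsI; subst scaleR_fun_apply) (auto simp: formsD ACPE_closed)
qed

lemmas forms_closed = subspace_0[OF subspace_forms] subspace_add[OF subspace_forms]
  subspace_diff[OF subspace_forms]

lemma linear_on_Dform: "linear_on (forms A q) (Dform \<mu>)"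
proof (rule linear_onI; rule ext)
  fix \<omega> I assume \<omega>: "\<omega> \<in> forms A q"
  show "Dform \<mu> (\<omega> + \<eta>) I = (Dform \<mu> \<omega> + Dform \<mu> \<eta>) I" if \<eta>: "\<eta> \<in> forms A q" for \<eta>
    by (simp add: Dform_def plus_fun_apply linear_on_add[OF linear_on_Dbar formsD(1)[OF \<omega>] formsD(1)[OF \<eta>]])
  show "Dform \<mu> (c *\<^sub>R \<omega>) I = (c *\<^sub>R Dform \<mu> \<omega>) I" for c
    by (simp add: Dform_def scaleR_fun_apply linear_on_scaleR[OF linear_on_Dbar formsD(1)[OF \<omega>]])
qed

lemma linear_on_dbar: "linear_on (forms A q) (dbar A)"
proof (rule linear_onI; rule ext)
  fix \<omega> I assume \<omega>: "\<omega> \<in> forms A q"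
  show "dbar A (\<omega> + \<eta>) I = (dbar A \<omega> + dbar A \<eta>) I" if \<eta>: "\<eta> \<in> forms A q" for \<eta>
    by (simp add: dbar_def plus_fun_apply linear_on_add[OF linear_on_Dbar formsD(1)[OF \<omega>] formsD(1)[OF \<eta>]]
        scaleR_add_right sum.distrib)
  show "dbar A (c *\<^sub>R \<omega>) I = (c *\<^sub>R dbar A \<omega>) I" for c
    by (simp add: dbar_def scaleR_fun_apply linear_on_scaleR[OF linear_on_Dbar formsD(1)[OF \<omega>]]
        scaleR_right.sum mult.commute)
qed

lemma Dform_forms: "\<omega> \<in> forms A q \<Longrightarrow> \<mu> \<in> {1..m} \<Longrightarrow> Dform \<mu> \<omega> \<in> forms A q"
  by (rule formsI) (auto simp: Dform_def formsD Dbar_ACPE)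

lemma dbar_forms:
  assumes A: "A \<subseteq> {1..m}" and \<omega>: "\<omega> \<in> forms A q" shows "dbar A \<omega> \<in> forms A (q + 1)"
proof (rule formsI)
  fix I
  show "dbar A \<omega> I \<in> ACPE"
    using A unfolding dbar_def by (auto intro!: ACPE_closed Dbar_ACPE formsD(1)[OF \<omega>])
  have "int (card (I - {\<mu>})) \<noteq> q" if "\<mu> \<in> I" "I \<subseteq> A" "int (card I) \<noteq> q + 1" for \<mu>
    using that finite_subset[OF that(2)] finite_subset[OF A] card_Suc_Diff1[of I \<mu>] by force
  then show "dbar A \<omega> I = 0" if "\<not> I \<subseteq> A \<or> int (card I) \<noteq> q + 1"
    using that formsD(2)[OF \<omega>] by (auto simp: dbar_def intro!: sum.neutral)
qed

lemma Dform_dbar: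
  assumes A: "A \<subseteq> {1..m}" and \<mu>: "\<mu> \<in> {1..m}" and \<omega>: "\<omega> \<in> forms A q"
  shows "Dform \<mu> (dbar A \<omega>) = dbar A (Dform \<mu> \<omega>)"
proof
  fix I
  show "Dform \<mu> (dbar A \<omega>) I = dbar A (Dform \<mu> \<omega>) I"
  proof (cases "I \<subseteq> A")
    case True
    then have I: "\<nu> \<in> {1..m}" if "\<nu> \<in> I" for \<nu> using that A by blast
    have D: "Dbar \<nu> (\<omega> (I - {\<nu>})) \<in> ACPE" if "\<nu> \<in> I" for \<nu>
      using formsD(1)[OF \<omega>] I[OF that] by (rule Dbar_ACPE)
    have "Dbar \<mu> (\<Sum>\<nu>\<in>I. sgn_ins \<nu> (I - {\<nu>}) *\<^sub>R Dbar \<nu> (\<omega> (I - {\<nu>})))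
        = (\<Sum>\<nu>\<in>I. Dbar \<mu> (sgn_ins \<nu> (I - {\<nu>}) *\<^sub>R Dbar \<nu> (\<omega> (I - {\<nu>}))))"
      using D by (intro linear_on_sum[OF linear_on_Dbar subspace_ACPE] ACPE_closed)
    also have "\<dots> = (\<Sum>\<nu>\<in>I. sgn_ins \<nu> (I - {\<nu>}) *\<^sub>R Dbar \<nu> (Dbar \<mu> (\<omega> (I - {\<nu>}))))"
      using D I by (intro sum.cong refl)
        (simp add: linear_on_scaleR[OF linear_on_Dbar] Dbar_commute[OF formsD(1)[OF \<omega>] \<mu>])
    finally show ?thesis using True by (simp add: Dform_def dbar_def)
  qed (simp add: Dform_def dbar_def)
qed

lemma restr_forms:
  assumes "\<omega> \<in> forms (insert b A) q" shows "restr b \<omega> \<in> forms A q"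
proof (rule formsI)
  show "restr b \<omega> I \<in> ACPE" for I using formsD(1)[OF assms] by (simp add: restr_def ACPE_closed)
  show "restr b \<omega> I = 0" if "\<not> I \<subseteq> A \<or> int (card I) \<noteq> q" for I
    using that formsD(2)[OF assms, of I] by (auto simp: restr_def)
qed

lemma contract_forms:
  assumes "finite A" "\<omega> \<in> forms (insert b A) q" shows "contract b \<omega> \<in> forms A (q - 1)"
proof (rule formsI)
  show "contract b \<omega> I \<in> ACPE" for I using assms by (simp add: contract_def formsD ACPE_closed)
  show "contract b \<omega> I = 0" if I: "\<not> I \<subseteq> A \<or> int (card I) \<noteq> q - 1" for I
  proof (cases "b \<in> I \<or> \<not> I \<subseteq> A")
    case True
    then show ?thesis using formsD(2)[OF assms(2), of "insert b I"] by (auto simp: contract_def)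
  next
    case False
    then have "int (card (insert b I)) \<noteq> q" using I finite_subset[OF _ assms(1)] by auto
    then show ?thesis using formsD(2)[OF assms(2)] by (simp add: contract_def)
  qed
qed

lemma join_restr_contract: "join b (restr b \<omega>) (contract b \<omega>) = \<omega>"
  by (auto simp: join_def restr_def contract_def insert_absorb)

lemma join_forms:
  assumes "finite A" "b \<notin> A" and \<theta>: "\<theta> \<in> forms A q" and \<zeta>: "\<zeta> \<in> forms A (q - 1)"
  shows "join b \<theta> \<zeta> \<in> forms (insert b A) q"
proof (rule formsI)
  show "join b \<theta> \<zeta> I \<in> ACPE" for I using \<theta> \<zeta> by (simp add: join_def formsD)
  show "join b \<theta> \<zeta> I = 0" if I: "\<not> I \<subseteq> insert b A \<or> int (card I) \<noteq> q" for I
  proof (cases "b \<in> I")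
    case True
    have "int (card (I - {b})) \<noteq> q - 1" if "I - {b} \<subseteq> A"
      using I True that card_Suc_Diff1[of I b] finite_subset[OF that assms(1)] by auto
    then show ?thesis using True formsD(2)[OF \<zeta>] by (auto simp: join_def)
  next
    case False
    then show ?thesis using I formsD(2)[OF \<theta>] by (auto simp: join_def)
  qed
qed

lemma join_eq_iff:
  assumes "b \<notin> A" "\<theta> \<in> forms A q" "\<zeta> \<in> forms A r" "\<theta>' \<in> forms A q'" "\<zeta>' \<in> forms A r'"
  shows "join b \<theta> \<zeta> = join b \<theta>' \<zeta>' \<longleftrightarrow> \<theta> = \<theta>' \<and> \<zeta> = \<zeta>'"
proof
  assume eq: "join b \<theta> \<zeta> = join b \<theta>' \<zeta>'"
  have zero: "\<omega> I = 0" if "\<omega> \<in> forms A s" "b \<in> I" for \<omega> s I using that assms(1) formsD(2) by blast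
  have "\<theta> I = \<theta>' I" for I
    using fun_cong[OF eq, of I] zero assms(2,4) by (cases "b \<in> I") (simp_all add: join_def)
  moreover have "\<zeta> I = \<zeta>' I" for I
    using fun_cong[OF eq, of "insert b I"] zero assms(3,5) by (cases "b \<in> I") (simp_all add: join_def)
  ultimately show "\<theta> = \<theta>' \<and> \<zeta> = \<zeta>'" by blast
qed simp

lemma sgn_ins_below:
  assumes "finite J" "\<And>\<nu>. \<nu> \<in> J \<Longrightarrow> b < \<nu>"
  shows "sgn_ins b J = 1" and "\<mu> \<in> J \<Longrightarrow> sgn_ins \<mu> (insert b (J - {\<mu>})) = - sgn_ins \<mu> (J - {\<mu>})"
proof -
  have "{\<nu> \<in> J. \<nu> < b} = {}" using assms(2) less_asym by blast
  then show "sgn_ins b J = 1" unfolding sgn_ins_def by (simp only: card.empty power_0)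
  assume "\<mu> \<in> J"
  then have "{\<nu> \<in> insert b (J - {\<mu>}). \<nu> < \<mu>} = insert b {\<nu> \<in> J - {\<mu>}. \<nu> < \<mu>}" "b \<notin> {\<nu> \<in> J - {\<mu>}. \<nu> < \<mu>}"
    using assms(2) by auto
  then show "sgn_ins \<mu> (insert b (J - {\<mu>})) = - sgn_ins \<mu> (J - {\<mu>})"
    using assms(1) by (simp add: sgn_ins_def)
qed

lemma join_insert_remove:
  assumes "finite J" "\<And>\<nu>. \<nu> \<in> J \<Longrightarrow> b < \<nu>" "\<mu> \<in> J"
  shows "join b \<theta> \<zeta> (insert b J - {\<mu>}) = \<zeta> (J - {\<mu>})"
    and "sgn_ins \<mu> (insert b J - {\<mu>}) = - sgn_ins \<mu> (J - {\<mu>})"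
proof -
  have "b \<notin> J" "b \<noteq> \<mu>" using assms(2,3) by blast+
  then have "insert b J - {\<mu>} = insert b (J - {\<mu>})" "insert b (J - {\<mu>}) - {b} = J - {\<mu>}" by auto
  then show "join b \<theta> \<zeta> (insert b J - {\<mu>}) = \<zeta> (J - {\<mu>})"
    "sgn_ins \<mu> (insert b J - {\<mu>}) = - sgn_ins \<mu> (J - {\<mu>})"
    using sgn_ins_below(2)[OF assms] by (simp_all add: join_def)
qed

lemma dbar_join:
  assumes A: "finite A" and b: "\<forall>\<alpha>\<in>A. b < \<alpha>" and \<theta>: "\<theta> \<in> forms A q"
  shows "dbar (insert b A) (join b \<theta> \<zeta>) = join b (dbar A \<theta>) (Dform b \<theta> - dbar A \<zeta>)"
proof
  fix I
  have "b \<notin> A" using b by blast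
  show "dbar (insert b A) (join b \<theta> \<zeta>) I = join b (dbar A \<theta>) (Dform b \<theta> - dbar A \<zeta>) I"
  proof (cases "b \<in> I")
    case False
    then show ?thesis by (auto simp: dbar_def join_def)
  next
    case True
    define J where "J = I - {b}"
    have I: "I = insert b J" "b \<notin> J" using True by (auto simp: J_def)
    show ?thesis
    proof (cases "J \<subseteq> A")
      case False
      then show ?thesis
        using formsD(2)[OF \<theta>, of J] I by (auto simp: dbar_def join_def Dform_def minus_apply)
    next
      case True
      then have J: "finite J" "\<And>\<nu>. \<nu> \<in> J \<Longrightarrow> b < \<nu>" using A b by (auto intro: finite_subset)
      have "dbar (insert b A) (join b \<theta> \<zeta>) I
          = (\<Sum>\<mu>\<in>insert b J. sgn_ins \<mu> (insert b J - {\<mu>}) *\<^sub>R Dbar \<mu> (join b \<theta> \<zeta> (insert b J - {\<mu>})))"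
        using True by (auto simp: dbar_def I(1))
      also have "\<dots> = Dbar b (\<theta> J) + (\<Sum>\<mu>\<in>J. - (sgn_ins \<mu> (J - {\<mu>}) *\<^sub>R Dbar \<mu> (\<zeta> (J - {\<mu>}))))"
        using I(2) J(1) by (simp add: join_insert_remove[OF J] sgn_ins_below(1)[OF J]) (simp add: join_def)
      finally show ?thesis
        using True I(2) by (simp add: I(1) join_def Dform_def dbar_def minus_apply sum_negf)
    qed
  qed
qed

lemma cocycles_join_iff:
  assumes A: "A \<subseteq> {1..m}" and b: "b \<in> {1..m}" "\<forall>\<alpha>\<in>A. b < \<alpha>"
    and \<theta>: "\<theta> \<in> forms A q" and \<zeta>: "\<zeta> \<in> forms A (q - 1)"
  shows "join b \<theta> \<zeta> \<in> cocycles (insert b A) q \<longleftrightarrow> \<theta> \<in> cocycles A q \<and> Dform b \<theta> = dbar A \<zeta>"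
proof -
  have fin: "finite A" and bA: "b \<notin> A" using A b finite_subset by blast+
  have "Dform b \<theta> - dbar A \<zeta> \<in> forms A q"
    using dbar_forms[OF A \<zeta>] Dform_forms[OF \<theta> b(1)] forms_closed(3) by simp
  from join_eq_iff[OF bA dbar_forms[OF A \<theta>] this forms_closed(1) forms_closed(1)]
  have "join b (dbar A \<theta>) (Dform b \<theta> - dbar A \<zeta>) = join b 0 0 \<longleftrightarrow> dbar A \<theta> = 0 \<and> Dform b \<theta> - dbar A \<zeta> = 0" .
  moreover have "join b 0 0 = 0" by (simp add: join_def fun_eq_iff zero_fun_apply)
  ultimately have "dbar (insert b A) (join b \<theta> \<zeta>) = 0 \<longleftrightarrow> dbar A \<theta> = 0 \<and> Dform b \<theta> = dbar A \<zeta>"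
    using dbar_join[OF fin b(2) \<theta>] by simp
  then show ?thesis using join_forms[OF fin bA \<theta> \<zeta>] \<theta> by (simp add: cocycles_def)
qed

lemma coboundaries_join_iff:
  assumes A: "A \<subseteq> {1..m}" and b: "b \<in> {1..m}" "\<forall>\<alpha>\<in>A. b < \<alpha>"
    and \<theta>: "\<theta> \<in> forms A q" and \<zeta>: "\<zeta> \<in> forms A (q - 1)"
  shows "join b \<theta> \<zeta> \<in> coboundaries (insert b A) q \<longleftrightarrow>
    (\<exists>\<eta>\<in>forms A (q - 1). \<theta> = dbar A \<eta> \<and> Dform b \<eta> - \<zeta> \<in> coboundaries A (q - 1))"
proof -
  have fin: "finite A" and bA: "b \<notin> A" using A b finite_subset by blast+
  have dbar: "dbar (insert b A) (join b \<eta> \<xi>) = join b \<theta> \<zeta> \<longleftrightarrow> \<theta> = dbar A \<eta> \<and> Dform b \<eta> - \<zeta> = dbar A \<xi>"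
    if \<eta>: "\<eta> \<in> forms A (q - 1)" and \<xi>: "\<xi> \<in> forms A (q - 1 - 1)" for \<eta> \<xi>
  proof -
    have "dbar A \<eta> \<in> forms A q" "Dform b \<eta> - dbar A \<xi> \<in> forms A (q - 1)"
      using dbar_forms[OF A \<eta>] dbar_forms[OF A \<xi>] Dform_forms[OF \<eta> b(1)] forms_closed(3) by simp_all
    from join_eq_iff[OF bA this \<theta> \<zeta>] show ?thesis
      unfolding dbar_join[OF fin b(2) \<eta>] by (auto simp: algebra_simps)
  qed
  show ?thesis
  proof
    assume "join b \<theta> \<zeta> \<in> coboundaries (insert b A) q"
    then obtain \<omega> where \<omega>: "\<omega> \<in> forms (insert b A) (q - 1)" "join b \<theta> \<zeta> = dbar (insert b A) \<omega>"
      by (auto simp: coboundaries_def)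
    then show "\<exists>\<eta>\<in>forms A (q - 1). \<theta> = dbar A \<eta> \<and> Dform b \<eta> - \<zeta> \<in> coboundaries A (q - 1)"
      using dbar[OF restr_forms contract_forms[OF fin], OF \<omega>(1) \<omega>(1)] restr_forms[OF \<omega>(1)]
        contract_forms[OF fin \<omega>(1)]
      by (auto simp: join_restr_contract coboundaries_def)
  next
    assume "\<exists>\<eta>\<in>forms A (q - 1). \<theta> = dbar A \<eta> \<and> Dform b \<eta> - \<zeta> \<in> coboundaries A (q - 1)"
    then obtain \<eta> \<xi> where \<eta>: "\<eta> \<in> forms A (q - 1)" "\<xi> \<in> forms A (q - 1 - 1)" "\<theta> = dbar A \<eta>"
      "Dform b \<eta> - \<zeta> = dbar A \<xi>"
      by (auto simp: coboundaries_def)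
    then show "join b \<theta> \<zeta> \<in> coboundaries (insert b A) q"
      using dbar[OF \<eta>(1,2)] join_forms[OF fin bA \<eta>(1,2)] unfolding coboundaries_def by force
  qed
qed

subsection \<open>Cohomology in the directions of a subset of \<open>N\<close>\<close>

definition monomial_form :: "nat set \<Rightarrow> fn \<Rightarrow> form" where
  "monomial_form A f I = (if I = A then f else 0)"

lemma finite_subset_N: "A \<subseteq> N \<Longrightarrow> finite A"
  using finite_subset finite_Nset by blast

lemma subset_N_imp_subset_M: "A \<subseteq> N \<Longrightarrow> A \<subseteq> {1..m}"
  using N_imp_M by blast

lemma monomial_form_top_coeff:
  assumes "finite A" "\<theta> \<in> forms A (int (card A))" shows "monomial_form A (\<theta> A) = \<theta>"
proof
  fix I
  have "I = A" if "I \<subseteq> A" "card I = card A" using that card_subset_eq[OF assms(1)] by blast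
  then show "monomial_form A (\<theta> A) I = \<theta> I"
    using formsD(2)[OF assms(2), of I] by (auto simp: monomial_form_def)
qed

lemma monomial_form_Dbar_coboundary:
  assumes A: "A \<subseteq> N" and \<alpha>: "\<alpha> \<in> A" and g: "g \<in> ACPE"
  shows "monomial_form A (Dbar \<alpha> g) \<in> coboundaries A (int (card A))"
proof -
  note fin = finite_subset_N[OF A]
  define s where "s = sgn_ins \<alpha> (A - {\<alpha>})"
  define \<eta> :: form where "\<eta> I = (if I = A - {\<alpha>} then s *\<^sub>R g else 0)" for I
  have \<eta>: "\<eta> \<in> forms A (int (card A) - 1)"
    using \<alpha> g card_Suc_Diff1[OF fin \<alpha>] by (intro formsI) (auto simp: \<eta>_def ACPE_closed)
  then have "dbar A \<eta> \<in> forms A (int (card A))" using dbar_forms[OF subset_N_imp_subset_M[OF A] \<eta>] by simp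
  then have "dbar A \<eta> = monomial_form A (dbar A \<eta> A)" by (rule monomial_form_top_coeff[OF fin, symmetric])
  moreover have "dbar A \<eta> A = Dbar \<alpha> g"
  proof -
    have "A - {\<mu>} = A - {\<alpha>} \<longleftrightarrow> \<mu> = \<alpha>" if "\<mu> \<in> A" for \<mu> using that \<alpha> by auto
    then have "dbar A \<eta> A = (\<Sum>\<mu>\<in>A. if \<mu> = \<alpha> then s *\<^sub>R Dbar \<mu> (s *\<^sub>R g) else 0)"
      by (auto simp: dbar_def \<eta>_def s_def intro!: sum.cong)
    also have "\<dots> = (s * s) *\<^sub>R Dbar \<alpha> g"
      using \<alpha> fin g by (simp add: linear_on_scaleR[OF linear_on_Dbar])
    finally show ?thesis by (simp add: s_def sgn_ins_def flip: power_add)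
  qed
  ultimately show ?thesis using \<eta> unfolding coboundaries_def by force
qed

lemma top_coboundaries_iff:
  assumes A: "A \<subseteq> N" and \<theta>: "\<theta> \<in> forms A (int (card A))"
  shows "\<theta> \<in> coboundaries A (int (card A)) \<longleftrightarrow> \<theta> A \<in> divergences A"
proof
  assume "\<theta> \<in> coboundaries A (int (card A))"
  then obtain \<eta> where \<eta>: "\<eta> \<in> forms A (int (card A) - 1)" "\<theta> = dbar A \<eta>" by (auto simp: coboundaries_def)
  show "\<theta> A \<in> divergences A"
    unfolding \<eta>(2) dbar_def using formsD(1)[OF \<eta>(1)]
    by (auto intro!: subspace_sum[OF subspace_divergences] subspace_scale[OF subspace_divergences]
        Dbar_divergences)
next
  assume div: "\<theta> A \<in> divergences A"
  have linear: "linear_on ACPE (monomial_form A)"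
    by (rule linear_onI) (auto simp: monomial_form_def fun_eq_iff pointwise)
  have "monomial_form A (\<theta> A) \<in> coboundaries A (int (card A))"
  proof (rule linear_on_span[OF linear subspace_ACPE _ Dbar_ACPE_subset[OF A]])
    show "subspace (coboundaries A (int (card A)))"
      unfolding coboundaries_def by (rule linear_on_subspace_image[OF linear_on_dbar subspace_forms])
  qed (use div monomial_form_Dbar_coboundary[OF A] in \<open>auto simp: divergences_def\<close>)
  then show "\<theta> \<in> coboundaries A (int (card A))"
    using monomial_form_top_coeff[OF finite_subset_N[OF A] \<theta>] by simp
qed

lemma forms_above_top:
  assumes "finite A" "\<theta> \<in> forms A q" "int (card A) < q" shows "\<theta> = 0"
proof -
  have "int (card I) \<noteq> q" if "I \<subseteq> A" for I using card_mono[OF assms(1) that] assms(3) by linarith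
  then have "\<theta> I = 0" for I using formsD(2)[OF assms(2)] by blast
  then show ?thesis by (simp add: fun_eq_iff zero_fun_apply)
qed

lemma subspace_coboundaries: "subspace (coboundaries A q)"
  unfolding coboundaries_def by (rule linear_on_subspace_image[OF linear_on_dbar subspace_forms])

lemma zero_cocycle: "0 \<in> cocycles A q"
  using linear_on_zero[OF linear_on_dbar subspace_forms] forms_closed(1) by (simp add: cocycles_def)

lemma obtain_function_antiderivative:
  assumes A: "A \<subseteq> N" "A \<noteq> {}" and b: "b \<in> {1..m} - A" and \<kappa>: "\<kappa> \<in> cocycles A 0"
  obtains \<eta> where "\<eta> \<in> cocycles A 0" "Dform b \<eta> = \<kappa>"
proof -
  have \<kappa>_form: "\<kappa> \<in> forms A 0" using \<kappa> by (simp add: cocycles_def)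
  have "Dbar \<alpha> (\<kappa> {}) = 0" if "\<alpha> \<in> A" for \<alpha>
  proof -
    have "dbar A \<kappa> {\<alpha>} = 0" using \<kappa> by (simp add: cocycles_def zero_fun_apply)
    then show ?thesis using that by (simp add: dbar_def sgn_ins_def)
  qed
  then have "\<kappa> {} \<in> smooth (X ` ({1..m} - A))" by (rule Dbar_kernel[OF formsD(1)[OF \<kappa>_form] A])
  then obtain F where F: "F \<in> smooth (X ` ({1..m} - A))" "Dbar b F = \<kappa> {}"
    using obtain_antiderivative b by blast
  have FX: "F \<in> smooth (X ` {1..m})" by (rule smooth_mono[OF _ F(1)]) blast
  define \<eta> where "\<eta> = monomial_form {} F"
  show thesis
  proof
    have D\<eta>: "Dbar \<mu> (\<eta> (I - {\<mu>})) = 0" if "\<mu> \<in> A" for \<mu> I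
      using that smooth_partial_outside[OF F(1), of "X \<mu>"] Dbar_smooth_X[OF FX, of \<mu>]
      by (auto simp: \<eta>_def monomial_form_def)
    have "dbar A \<eta> = 0"
    proof
      show "dbar A \<eta> I = 0 I" for I
        unfolding zero_fun_apply[of I] dbar_def using D\<eta> by (auto intro!: sum.neutral)
    qed
    moreover have "\<eta> \<in> forms A 0"
      using smooth_X_imp_ACPE[OF FX] finite_subset_N[OF A(1)]
      by (intro formsI) (auto simp: \<eta>_def monomial_form_def ACPE_closed finite_subset)
    ultimately show "\<eta> \<in> cocycles A 0" by (simp add: cocycles_def)
    show "Dform b \<eta> = \<kappa>"
    proof
      fix I
      have "\<kappa> I = 0" if "I \<noteq> {}"
        using that formsD(2)[OF \<kappa>_form, of I] finite_subset[OF _ finite_subset_N[OF A(1)], of I]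
          card_0_eq[of I] by linarith
      then show "Dform b \<eta> I = \<kappa> I" using F(2) by (simp add: Dform_def \<eta>_def monomial_form_def)
    qed
  qed
qed

lemma cocycles_eq_Dform_plus_coboundary:
  assumes A: "A \<subseteq> N" and b: "b \<in> {1..m} - A" and q: "q < int (card A)" and \<kappa>: "\<kappa> \<in> cocycles A q"
    and exact: "1 \<le> q \<Longrightarrow> cocycles A q \<subseteq> coboundaries A q"
  shows "\<exists>\<eta>\<in>cocycles A q. \<kappa> - Dform b \<eta> \<in> coboundaries A q"
proof -
  have zero: "Dform b 0 = 0" "0 \<in> coboundaries A q"
    using linear_on_zero[OF linear_on_Dform subspace_forms] subspace_0[OF subspace_coboundaries] by simp_all
  consider "q < 0" | "q = 0" | "1 \<le> q" by linarith
  then show ?thesis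
  proof cases
    assume "q < 0"
    then have "\<kappa> I = 0" for I using \<kappa> formsD(2)[of \<kappa> A q I] by (simp add: cocycles_def)
    then have "\<kappa> = 0" by (simp add: fun_eq_iff zero_fun_apply)
    then show ?thesis using zero zero_cocycle by force
  next
    assume "q = 0"
    then have \<kappa>0: "\<kappa> \<in> cocycles A 0" and "A \<noteq> {}" using \<kappa> q by auto
    then obtain \<eta> where "\<eta> \<in> cocycles A 0" "Dform b \<eta> = \<kappa>"
      by (metis obtain_function_antiderivative[OF A _ b \<kappa>0])
    then show ?thesis using zero(2) \<open>q = 0\<close> by (intro bexI[of _ \<eta>]) auto
  next
    assume "1 \<le> q"
    then have "\<kappa> - Dform b 0 \<in> coboundaries A q" using exact \<kappa> zero(1) by auto
    then show ?thesis using zero_cocycle by blast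
  qed
qed

lemma join_coboundary:
  assumes A: "A \<subseteq> N" and b: "b \<in> {1..m}" "\<forall>\<alpha>\<in>A. b < \<alpha>" and q: "q \<le> int (card A)"
    and \<theta>: "\<theta> \<in> coboundaries A q" and \<zeta>: "\<zeta> \<in> forms A (q - 1)" "Dform b \<theta> = dbar A \<zeta>"
    and exact: "1 \<le> q - 1 \<Longrightarrow> cocycles A (q - 1) \<subseteq> coboundaries A (q - 1)"
  shows "join b \<theta> \<zeta> \<in> coboundaries (insert b A) q"
proof -
  note AM = subset_N_imp_subset_M[OF A]
  obtain \<eta> where \<eta>: "\<eta> \<in> forms A (q - 1)" "\<theta> = dbar A \<eta>" using \<theta> by (auto simp: coboundaries_def)
  define \<kappa> where "\<kappa> = Dform b \<eta> - \<zeta>"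
  have "dbar A \<kappa> = 0"
    using \<zeta> \<eta> Dform_dbar[OF AM b(1) \<eta>(1)]
      linear_on_diff[OF linear_on_dbar subspace_forms Dform_forms[OF \<eta>(1) b(1)] \<zeta>(1)]
    by (simp add: \<kappa>_def)
  then have "\<kappa> \<in> cocycles A (q - 1)"
    using \<zeta> \<eta> b(1) by (simp add: \<kappa>_def cocycles_def forms_closed Dform_forms)
  then obtain \<gamma> where \<gamma>: "\<gamma> \<in> cocycles A (q - 1)" "\<kappa> - Dform b \<gamma> \<in> coboundaries A (q - 1)"
    using cocycles_eq_Dform_plus_coboundary[OF A _ _ _ exact, of b] b q by auto
  then have \<gamma>_form: "\<gamma> \<in> forms A (q - 1)" and "dbar A \<gamma> = 0" by (simp_all add: cocycles_def)
  then have "\<theta> = dbar A (\<eta> - \<gamma>)" "Dform b (\<eta> - \<gamma>) - \<zeta> = \<kappa> - Dform b \<gamma>"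
    using \<eta> linear_on_diff[OF linear_on_dbar subspace_forms \<eta>(1) \<gamma>_form]
      linear_on_diff[OF linear_on_Dform subspace_forms \<eta>(1) \<gamma>_form] by (simp_all add: \<kappa>_def)
  moreover have "\<theta> \<in> forms A q" using dbar_forms[OF AM \<eta>(1)] \<eta>(2) by simp
  moreover have "\<eta> - \<gamma> \<in> forms A (q - 1)" by (rule forms_closed(3)[OF \<eta>(1) \<gamma>_form])
  ultimately show ?thesis
    using \<gamma>(2) by (subst coboundaries_join_iff[OF AM b _ \<zeta>(1)]) auto
qed

lemma top_cocycle_coboundary:
  assumes A: "A \<subseteq> N" "A \<noteq> {}" and b: "b \<in> N - A"
    and \<theta>: "\<theta> \<in> forms A (int (card A))" "Dform b \<theta> \<in> coboundaries A (int (card A))"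
  shows "\<theta> \<in> coboundaries A (int (card A))"
proof -
  have bM: "b \<in> {1..m}" and bN: "b \<in> N" using b by auto
  note \<theta>A = formsD(1)[OF \<theta>(1), of A]
  have "Dbar b (\<theta> A) \<in> divergences A"
    using \<theta> top_coboundaries_iff[OF A(1) Dform_forms[OF \<theta>(1) bM]] by (simp add: Dform_def)
  then have "euler A (lie_vform b (dV (\<theta> A))) = 0"
    using divergences_iff_euler[OF Dbar_ACPE[OF \<theta>A bM] A] lie_vform_dV[OF \<theta>A bM] by simp
  then have "lie_vform b (euler A (dV (\<theta> A))) = 0" using euler_lie_vform[OF A(1) b dV_vforms[OF \<theta>A]] by simp
  then have "euler A (dV (\<theta> A)) = 0"
    by (rule lie_vform_eq_0_imp[OF base_vforms_imp_vforms[OF euler_decomposition(1)[OF A(1) dV_vforms[OF \<theta>A]]]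
        bN])
  then show ?thesis using divergences_iff_euler[OF \<theta>A A] top_coboundaries_iff[OF A(1) \<theta>(1)] by simp
qed

theorem cocycles_subset_coboundaries:
  assumes "A \<subseteq> N" "1 \<le> q" "q < int (card A)" shows "cocycles A q \<subseteq> coboundaries A q"
  using finite_subset_N[OF assms(1)] assms
proof (induction A arbitrary: q rule: finite_linorder_min_induct)
  case (insert b A)
  have A: "A \<subseteq> N" and AM: "A \<subseteq> {1..m}" and b: "b \<in> {1..m}" "\<forall>\<alpha>\<in>A. b < \<alpha>" and bN: "b \<in> N - A"
    using insert by auto
  have card: "card (insert b A) = Suc (card A)" using insert.hyps by auto
  show ?case
  proof
    fix \<omega> assume \<omega>: "\<omega> \<in> cocycles (insert b A) q"
    define \<theta> \<zeta> where "\<theta> = restr b \<omega>" and "\<zeta> = contract b \<omega>"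
    have \<omega>_join: "\<omega> = join b \<theta> \<zeta>" by (simp add: \<theta>_def \<zeta>_def join_restr_contract)
    have \<theta>: "\<theta> \<in> forms A q" and \<zeta>: "\<zeta> \<in> forms A (q - 1)"
      using \<omega> insert.hyps(1) by (simp_all add: \<theta>_def \<zeta>_def cocycles_def restr_forms contract_forms)
    have closed: "\<theta> \<in> cocycles A q" "Dform b \<theta> = dbar A \<zeta>"
      using \<omega> cocycles_join_iff[OF AM b \<theta> \<zeta>] by (simp_all add: \<omega>_join)
    have "\<theta> \<in> coboundaries A q"
    proof (cases "q < int (card A)")
      case True
      then show ?thesis using insert.IH[OF A] insert.prems closed(1) by blast
    next
      case False
      then have q: "q = int (card A)" using insert.prems(3) card by simp
      then have "A \<noteq> {}" using insert.prems(2) by auto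
      then show ?thesis
        using top_cocycle_coboundary[OF A _ bN] \<theta> \<zeta> closed(2) unfolding q coboundaries_def by blast
    qed
    then show "\<omega> \<in> coboundaries (insert b A) q"
      unfolding \<omega>_join using insert.prems card \<zeta> closed(2) insert.IH[OF A, of "q - 1"]
      by (intro join_coboundary[OF A b]) auto
  qed
qed simp

subsection \<open>Cohomology in all directions\<close>

lemma M_eq_insert: "{1..m} = insert 1 N"
  using two_le_m by auto

lemma one_less_N: "\<forall>\<alpha>\<in>N. 1 < \<alpha>"
  by auto

lemma card_N: "int (card N) = int m - 1"
  using two_le_m by (simp add: Nset_def of_nat_diff)

lemmas cocycles_join_N = cocycles_join_iff[OF subset_N_imp_subset_M[OF order_refl] one_in_M
    one_less_N, folded M_eq_insert]
lemmas coboundaries_join_N = coboundaries_join_iff[OF subset_N_imp_subset_M[OF order_refl] one_in_M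
    one_less_N, folded M_eq_insert]
lemmas join_coboundary_N = join_coboundary[OF order_refl one_in_M one_less_N, folded M_eq_insert]
lemmas join_forms_N = join_forms[OF finite_Nset[of m], of 1, folded M_eq_insert]
lemmas restr_forms_N = restr_forms[of _ 1 N, folded M_eq_insert]
lemmas contract_forms_N = contract_forms[OF finite_Nset[of m], of _ 1, folded M_eq_insert]

lemma cocycle_M_iff:
  assumes "\<omega> \<in> forms {1..m} q"
  shows "\<omega> \<in> cocycles {1..m} q \<longleftrightarrow> restr 1 \<omega> \<in> cocycles N q \<and> Dform 1 (restr 1 \<omega>) = dbar N (contract 1 \<omega>)"
  using cocycles_join_N[OF restr_forms_N[OF assms] contract_forms_N[OF assms]]
  by (simp add: join_restr_contract)

lemma coboundary_M_iff:
  assumes "\<omega> \<in> cocycles {1..m} q" "q \<le> int m - 1"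
  shows "\<omega> \<in> coboundaries {1..m} q \<longleftrightarrow> restr 1 \<omega> \<in> coboundaries N q"
proof -
  have \<omega>: "\<omega> \<in> forms {1..m} q" using assms(1) by (simp add: cocycles_def)
  note parts = restr_forms_N[OF \<omega>] contract_forms_N[OF \<omega>]
  have "Dform 1 (restr 1 \<omega>) = dbar N (contract 1 \<omega>)" using assms(1) cocycle_M_iff[OF \<omega>] by blast
  then have "join 1 (restr 1 \<omega>) (contract 1 \<omega>) \<in> coboundaries {1..m} q" if "restr 1 \<omega> \<in> coboundaries N q"
    using that parts assms(2) card_N cocycles_subset_coboundaries[OF order_refl, of "q - 1"]
    by (intro join_coboundary_N) auto
  moreover have "restr 1 \<omega> \<in> coboundaries N q" if "join 1 (restr 1 \<omega>) (contract 1 \<omega>) \<in> coboundaries {1..m} q"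
    using that coboundaries_join_N[OF parts] by (auto simp: coboundaries_def)
  ultimately show ?thesis by (auto simp: join_restr_contract)
qed

theorem cocycles_M_subset_coboundaries:
  assumes "1 \<le> q" "q \<le> int m - 2" shows "cocycles {1..m} q \<subseteq> coboundaries {1..m} q"
proof
  fix \<omega> assume \<omega>: "\<omega> \<in> cocycles {1..m} q"
  then have "restr 1 \<omega> \<in> cocycles N q" using cocycle_M_iff[of \<omega> q] by (simp add: cocycles_def)
  then have "restr 1 \<omega> \<in> coboundaries N q"
    using assms cocycles_subset_coboundaries[OF order_refl, of q] card_N by auto
  then show "\<omega> \<in> coboundaries {1..m} q" using coboundary_M_iff[OF \<omega>] assms by simp
qed

lemma obtain_cocycle_M:
  assumes \<theta>: "\<theta> \<in> cocycles N q" "Dform 1 \<theta> \<in> coboundaries N q"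
  obtains \<omega> where "\<omega> \<in> cocycles {1..m} q" "restr 1 \<omega> = \<theta>"
proof -
  obtain \<zeta> where \<zeta>: "\<zeta> \<in> forms N (q - 1)" "Dform 1 \<theta> = dbar N \<zeta>" using \<theta>(2) by (auto simp: coboundaries_def)
  have \<theta>_form: "\<theta> \<in> forms N q" using \<theta>(1) by (simp add: cocycles_def)
  show thesis
  proof
    show "join 1 \<theta> \<zeta> \<in> cocycles {1..m} q" using \<theta>(1) \<zeta> cocycles_join_N[OF \<theta>_form \<zeta>(1)] by blast
    have "1 \<notin> N" by simp
    then have "\<theta> I = 0" if "1 \<in> I" for I using that formsD(2)[OF \<theta>_form, of I] by blast
    then show "restr 1 (join 1 \<theta> \<zeta>) = \<theta>" by (auto simp: restr_def join_def)
  qed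
qed

lemma top_coboundary_M_iff:
  assumes \<omega>: "\<omega> \<in> forms {1..m} (int m)"
  shows "\<omega> \<in> coboundaries {1..m} (int m) \<longleftrightarrow>
    (\<exists>\<eta>\<in>forms N (int m - 1). Dform 1 \<eta> - contract 1 \<omega> \<in> coboundaries N (int m - 1))"
proof -
  have zero: "\<theta> = 0" if "\<theta> \<in> forms N (int m)" for \<theta>
    by (rule forms_above_top[OF finite_Nset that]) (simp add: card_N)
  have "dbar N \<eta> = 0" if "\<eta> \<in> forms N (int m - 1)" for \<eta>
    using zero dbar_forms[OF subset_N_imp_subset_M[OF order_refl] that] by simp
  then show ?thesis
    using coboundaries_join_N[OF restr_forms_N[OF \<omega>] contract_forms_N[OF \<omega>]] zero[OF restr_forms_N[OF \<omega>]]
    by (auto simp: join_restr_contract)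
qed

lemma cocycles_0_const:
  assumes "\<omega> \<in> cocycles {1..m} 0" obtains c where "\<omega> = monomial_form {} (\<lambda>_. c)"
proof -
  have \<omega>: "\<omega> \<in> forms {1..m} 0" using assms by (simp add: cocycles_def)
  have D: "Dbar \<mu> (\<omega> {}) = 0" if "\<mu> \<in> {1..m}" for \<mu>
  proof -
    have "dbar {1..m} \<omega> {\<mu>} = 0" using assms by (simp add: cocycles_def zero_fun_apply)
    then show ?thesis using that by (simp add: dbar_def sgn_ins_def)
  qed
  have "N \<noteq> {}" using two_le_m by auto
  then have "\<omega> {} \<in> smooth (X ` ({1..m} - N))"
    using D N_imp_M by (intro Dbar_kernel formsD(1)[OF \<omega>]) auto
  then have X: "\<omega> {} \<in> smooth (X ` {1..m})" by (rule smooth_mono[rotated]) blast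
  have "\<omega> {} \<in> smooth {}"
  proof (rule smooth_restrict[OF X])
    show "partial v (\<omega> {}) = 0" for v
      using smooth_partial_outside[OF X, of v] Dbar_smooth_X[OF X] D by (cases "v \<in> X ` {1..m}") auto
  qed
  then have "\<omega> {} y = \<omega> {} (\<lambda>_. 0)" for y using depends_onD[OF smooth_depends_on, of "\<omega> {}" "{}"] by blast
  moreover have "\<omega> I = 0" if "I \<noteq> {}" for I
    using that formsD(2)[OF \<omega>, of I] finite_subset[of I "{1..m}"] by fastforce
  ultimately show thesis by (intro that[of "\<omega> {} (\<lambda>_. 0)"]) (auto simp: monomial_form_def fun_eq_iff)
qed

section \<open>Variational derivatives\<close>

definition base_var :: "var \<Rightarrow> var" where
  "base_var v = (case v of X \<nu> \<Rightarrow> X \<nu> | U l i \<Rightarrow> U l (at1 (i 1)) | P i \<Rightarrow> P (at1 (i 1)))"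

definition j_part :: "var \<Rightarrow> mi" where
  "j_part v = (\<lambda>k. if k = 1 then 0 else idx k v)"

definition base_vars :: "var set" where
  "base_vars = {v \<in> fibre_vars. base_var v = v}"

lemma shiftj_simps [simp]:
  "shiftj (U l i) j = U l (\<lambda>k. i k + j k)" "shiftj (P i) j = P (\<lambda>k. i k + j k)" "shiftj v (\<lambda>_. 0) = v"
  by (cases v; simp add: shiftj_def)+

lemma shiftj_inc: "shiftj v (inc j \<alpha>) = shiftv \<alpha> (shiftj v j)"
  by (cases v) (auto simp: shiftj_def inc_def)

lemma base_var_shiftj: "j 1 = 0 \<Longrightarrow> base_var (shiftj v j) = base_var v"
  by (cases v) (simp_all add: base_var_def shiftj_def)

lemma idx_base_var: "base_var v = v \<Longrightarrow> \<mu> \<noteq> 1 \<Longrightarrow> idx \<mu> v = 0"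
  by (cases v) (auto simp: base_var_def at1_eq_iff)

lemma j_part_shiftj: "base_var v = v \<Longrightarrow> \<not> is_X v \<Longrightarrow> j 1 = 0 \<Longrightarrow> j_part (shiftj v j) = j"
  using idx_base_var[of v] by (cases v) (auto simp: j_part_def fun_eq_iff)

lemma shiftj_base_var: "shiftj (base_var w) (j_part w) = w"
  by (cases w) (auto simp: base_var_def j_part_def shiftj_def at1_def fun_eq_iff)

lemma base_var_fibre: "w \<in> fibre_vars \<Longrightarrow> base_var w \<in> base_vars"
  by (cases w) (auto simp: base_vars_def base_var_def fibre_vars_def free_var_simps valid_mi_def at1_def)

lemma validJ_j_part: "w \<in> fibre_vars \<Longrightarrow> validJ m (j_part w)"
  by (cases w) (auto simp: validJ_def j_part_def fibre_vars_def free_var_simps valid_mi_def)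

lemma base_vars_fibre: "v \<in> base_vars \<Longrightarrow> v \<in> fibre_vars"
  by (simp add: base_vars_def)

lemma shiftj_fibre: "v \<in> fibre_vars \<Longrightarrow> validJ m j \<Longrightarrow> shiftj v j \<in> fibre_vars"
  by (cases v) (auto simp: fibre_vars_def free_var_simps valid_mi_def validJ_def)

lemma single_base_vforms: "v \<in> base_vars \<Longrightarrow> g \<in> ACPE \<Longrightarrow> single v g \<in> base_vforms N"
  using supp_subsets(5)[of v g] idx_base_var[of v] by (auto simp: base_vforms_def base_vars_def single_vforms)

lemmas linear_on_euler_N = linear_on_euler[OF order_refl]

lemma euler_single_shiftv:
  assumes w: "w \<in> fibre_vars" and g: "g \<in> ACPE" and \<alpha>: "\<alpha> \<in> N"
  shows "euler N (single (shiftv \<alpha> w) g) = euler N (single w (- Dbar \<alpha> g))"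
proof -
  have "single (shiftv \<alpha> w) g = lie_vform \<alpha> (single w g) + single w (- Dbar \<alpha> g)"
    unfolding lie_vform_single_N[OF w g \<alpha>] by (auto simp: single_def fun_eq_iff pointwise)
  moreover have "euler N (lie_vform \<alpha> (single w g)) = 0"
    using euler_vdivergences[OF order_refl lie_vform_vdivergences[OF \<alpha> single_vforms[OF w g]]] .
  ultimately show ?thesis
    using w g \<alpha>
    by (simp add: linear_on_add[OF linear_on_euler_N] lie_vform_vforms single_vforms ACPE_closed Dbar_ACPE)
qed

lemma negDj_0: "negDj m (\<lambda>_. 0) g = g"
  unfolding negDj_def funpow_0 by (rule foldr_ignore)

lemma negDj_inc:
  assumes "\<alpha> \<in> N" "g \<in> ACPE" shows "negDj m (inc j \<alpha>) g = negDj m j (- Dbar \<alpha> g)"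
proof -
  define D where "D \<alpha> h = - Dt m \<alpha> h" for \<alpha> h
  have "D \<alpha> = (\<lambda>h y. - Dt m \<alpha> h y)" for \<alpha> by (simp add: D_def fun_eq_iff pointwise)
  then have negDj: "negDj m j g = foldr (\<lambda>\<alpha> g. (D \<alpha> ^^ j \<alpha>) g) [2..<Suc m] g" for j g
    by (simp add: negDj_def)
  have "D \<alpha> h \<in> ACPE" if "\<alpha> \<in> N" "h \<in> ACPE" for \<alpha> h
    using that Dt_ACPE[of h \<alpha>] by (simp add: D_def ACPE_closed)
  moreover have "D \<alpha> (D \<beta> h) = D \<beta> (D \<alpha> h)" if "\<alpha> \<in> N" "\<beta> \<in> N" "h \<in> ACPE" for \<alpha> \<beta> h
    using that Dt_commute[OF ACPE_AB[OF that(3)] N_imp_M N_imp_M, of \<alpha> \<beta>]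
    by (simp add: D_def linear_on_uminus[OF linear_on_Dt] ACPE_AB Dt_ACPE)
  ultimately have "negDj m (inc j \<alpha>) g = negDj m j (D \<alpha> g)"
    unfolding negDj using assms by (intro foldr_funpow_inc[of N ACPE]) auto
  moreover have "D \<alpha> g = - Dbar \<alpha> g" using assms Dbar_eq_Dt[of g \<alpha>] by (simp add: D_def)
  ultimately show ?thesis by simp
qed

lemma euler_single_shiftj:
  assumes v: "v \<in> base_vars" and j: "validJ m j" and g: "g \<in> ACPE"
  shows "euler N (single (shiftj v j) g) = single v (negDj m j g)"
proof -
  have "\<forall>k. k \<notin> N \<longrightarrow> j k = 0" using j valid_mi_outside_N by (simp add: validJ_def)
  with finite_Nset[of m] show ?thesis
    using g
  proof (induction j arbitrary: g rule: multi_index_induct)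
    case zero
    then show ?case
      using euler_base_vforms[OF order_refl single_base_vforms[OF v zero]] by (simp add: negDj_0)
  next
    case (inc j \<alpha>)
    have "validJ m j" using inc.hyps by (auto simp: validJ_def valid_mi_def)
    then have "shiftj v j \<in> fibre_vars" by (rule shiftj_fibre[OF base_vars_fibre[OF v]])
    then have "euler N (single (shiftj v (inc j \<alpha>)) g) = euler N (single (shiftj v j) (- Dbar \<alpha> g))"
      using euler_single_shiftv[OF _ inc.prems inc.hyps(2)] by (simp add: shiftj_inc)
    also have "\<dots> = single v (negDj m j (- Dbar \<alpha> g))"
      by (intro inc.IH ACPE_closed Dbar_ACPE inc.prems N_imp_M[OF inc.hyps(2)])
    finally show ?case by (simp add: negDj_inc[OF inc.hyps(2) inc.prems])
  qed
qed

lemma euler_apply: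
  assumes \<phi>: "\<phi> \<in> vforms" and v: "v \<in> base_vars"
  shows "euler N \<phi> v = (\<Sum>j | validJ m j \<and> \<phi> (shiftj v j) \<noteq> 0. negDj m j (\<phi> (shiftj v j)))"
proof -
  have w: "w \<in> fibre_vars" "\<phi> w \<in> ACPE" if "w \<in> supp \<phi>" for w
    using that supp_fibre[OF \<phi>] vforms_ACPE[OF \<phi>] by auto
  have "euler N \<phi> = euler N (\<Sum>w\<in>supp \<phi>. single w (\<phi> w))"
    by (simp add: vform_eq_sum_single[OF finite_supp[OF \<phi>] order_refl])
  also have "\<dots> = (\<Sum>w\<in>supp \<phi>. euler N (single w (\<phi> w)))"
    using w by (intro linear_on_sum[OF linear_on_euler_N subspace_vforms] single_vforms)
  also have "\<dots> = (\<Sum>w\<in>supp \<phi>. single (base_var w) (negDj m (j_part w) (\<phi> w)))"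
    using w euler_single_shiftj[OF base_var_fibre validJ_j_part, of w w "\<phi> w" for w]
    by (intro sum.cong) (auto simp: shiftj_base_var)
  finally have "euler N \<phi> v = (\<Sum>w\<in>supp \<phi>. if base_var w = v then negDj m (j_part w) (\<phi> w) else 0)"
    by (simp add: sum_fun_apply single_def eq_commute[of v])
  also have "\<dots> = (\<Sum>w\<in>{w \<in> supp \<phi>. base_var w = v}. negDj m (j_part w) (\<phi> w))"
    by (simp add: sum.inter_filter[OF finite_supp[OF \<phi>]])
  also have "\<dots> = (\<Sum>j | validJ m j \<and> \<phi> (shiftj v j) \<noteq> 0. negDj m j (\<phi> (shiftj v j)))"
  proof (rule sum.reindex_bij_witness[of _ "shiftj v" j_part])
    fix w assume "w \<in> {w \<in> supp \<phi>. base_var w = v}"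
    then have "base_var w = v" "w \<in> supp \<phi>" "w \<in> fibre_vars" using supp_fibre[OF \<phi>] by auto
    then show "shiftj v (j_part w) = w" "j_part w \<in> {j. validJ m j \<and> \<phi> (shiftj v j) \<noteq> 0}"
      "negDj m (j_part w) (\<phi> (shiftj v (j_part w))) = negDj m (j_part w) (\<phi> w)"
      using shiftj_base_var[of w] validJ_j_part by (auto simp: supp_def)
  next
    fix j assume "j \<in> {j. validJ m j \<and> \<phi> (shiftj v j) \<noteq> 0}"
    then have j: "validJ m j" "\<phi> (shiftj v j) \<noteq> 0" "j 1 = 0" by (auto simp: validJ_def)
    then show "j_part (shiftj v j) = j" "shiftj v j \<in> {w \<in> supp \<phi>. base_var w = v}"
      using v by (auto simp: base_vars_def fibre_vars_def supp_def base_var_shiftj j_part_shiftj)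
  qed
  finally show ?thesis .
qed

lemma vder_eq_euler:
  assumes "L \<in> AB m" "v \<in> base_vars" shows "vder m v L = euler N (dV (reduce L)) v"
proof -
  have partial: "partial (shiftj v j) (reduce L) = dV (reduce L) (shiftj v j)" for j
    using assms(2) by (cases v) (auto simp: dV_def base_vars_def fibre_vars_def)
  have "vder m v L = (\<Sum>j | validJ m j \<and> partial (shiftj v j) (reduce L) \<noteq> 0.
      negDj m j (partial (shiftj v j) (reduce L)))"
    unfolding vder_def nf_eq_reduce[OF assms(1)] Let_def zero_fun_def by (rule ext) (simp add: sum_fun_apply)
  then show ?thesis
    by (simp only: partial euler_apply[OF dV_vforms[OF reduce_ACPE[OF assms(1)]] assms(2)])
qed

section \<open>The linear system\<close>

lemma base_vars_iff:
  "U l i \<in> base_vars \<longleftrightarrow> l = 1 \<and> i = at1 0 \<or> l \<in> N \<and> (\<exists>k. i = at1 k)"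
  "P i \<in> base_vars \<longleftrightarrow> i = at1 0 \<or> i = at1 1"
  "X \<nu> \<notin> base_vars"
proof -
  have valid: "valid_mi m (at1 k)" for k using two_le_m by (simp add: valid_mi_def)
  have not_at1: "base_var (U l i) \<noteq> U l i" "base_var (P i) \<noteq> P i" if "\<not> (\<exists>k. i = at1 k)"
    using that by (simp_all add: base_var_def) metis+
  show "U l i \<in> base_vars \<longleftrightarrow> l = 1 \<and> i = at1 0 \<or> l \<in> N \<and> (\<exists>k. i = at1 k)"
  proof (cases "\<exists>k. i = at1 k")
    case True
    then show ?thesis
      using valid two_le_m
      by (auto simp: base_vars_def fibre_vars_def base_var_def free_var_simps simp del: at1_eqs)
  qed (use not_at1 in \<open>auto simp: base_vars_def\<close>)
  show "P i \<in> base_vars \<longleftrightarrow> i = at1 0 \<or> i = at1 1"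
  proof (cases "\<exists>k. i = at1 k")
    case True
    then show ?thesis
      using valid by (auto simp: base_vars_def fibre_vars_def base_var_def free_var_simps simp del: at1_eqs)
  qed (use not_at1 in \<open>auto simp: base_vars_def\<close>)
qed (simp add: base_vars_def fibre_vars_def)

lemma base_vars_memI:
  "U 1 (at1 0) \<in> base_vars" "\<alpha> \<in> N \<Longrightarrow> U \<alpha> (at1 k) \<in> base_vars" "P (at1 0) \<in> base_vars" "P (at1 1) \<in> base_vars"
  unfolding base_vars_iff by blast+

lemma base_vars_cases [consumes 1, case_names U1 U P0 P1]:
  assumes "v \<in> base_vars"
  obtains "v = U 1 (at1 0)" | \<alpha> k where "\<alpha> \<in> N" "v = U \<alpha> (at1 k)" | "v = P (at1 0)" | "v = P (at1 1)"
  using assms base_vars_iff by (cases v) metis+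

lemma supp_base_vforms:
  assumes "\<rho> \<in> base_vforms N" shows "supp \<rho> \<subseteq> base_vars"
proof
  fix v assume v: "v \<in> supp \<rho>"
  then have fibre: "v \<in> fibre_vars" and idx: "\<forall>\<alpha>\<in>N. idx \<alpha> v = 0"
    using assms supp_fibre[OF base_vforms_imp_vforms[OF assms]] by (auto simp: base_vforms_def)
  have "i = at1 (i 1)" if "valid_mi m i" "\<forall>\<alpha>\<in>N. i \<alpha> = 0" for i
  proof
    fix k
    have "k = 0 \<or> k = 1 \<or> k \<in> N \<or> m < k" by auto
    then show "i k = at1 (i 1) k" using that by (auto simp: valid_mi_def)
  qed
  then have "base_var v = v"
    using fibre idx by (cases v) (auto simp: base_var_def fibre_vars_def free_var_simps)
  then show "v \<in> base_vars" using fibre by (simp add: base_vars_def)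
qed

lemma linear_on_base_vforms_eqI:
  assumes T: "linear_on (base_vforms N) T" and T': "linear_on (base_vforms N) T'"
    and eq: "\<And>w g. w \<in> base_vars \<Longrightarrow> g \<in> ACPE \<Longrightarrow> T (single w g) = T' (single w g)"
    and \<rho>: "\<rho> \<in> base_vforms N"
  shows "T \<rho> = T' \<rho>"
proof (rule linear_on_eq_of_singles[OF T T' subspace_base_vforms
    finite_supp[OF base_vforms_imp_vforms[OF \<rho>]]])
  fix w assume "w \<in> supp \<rho>"
  then have "w \<in> base_vars" "\<rho> w \<in> ACPE"
    using supp_base_vforms[OF \<rho>] vforms_ACPE[OF base_vforms_imp_vforms[OF \<rho>]] by auto
  then show "single w (\<rho> w) \<in> base_vforms N" "T (single w (\<rho> w)) = T' (single w (\<rho> w))"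
    by (simp_all add: single_base_vforms eq)
qed

definition weighted_euler :: "fn \<Rightarrow> fn \<Rightarrow> var \<Rightarrow> fn" where
  "weighted_euler g f = euler N (fmul g (dV f))"

lemma linear_on_fmul: "linear_on V (fmul g)"
  by (rule linear_onI) (simp_all add: fmul_def fun_eq_iff pointwise algebra_simps)

lemma linear_on_weighted_euler:
  assumes "g \<in> ACPE" shows "linear_on ACPE (weighted_euler g)"
proof -
  have "linear_on ACPE (\<lambda>f. fmul g (dV f))" by (rule linear_on_compose[OF linear_on_dV linear_on_fmul UNIV_I])
  then have "linear_on ACPE (\<lambda>f. euler N (fmul g (dV f)))"
    by (rule linear_on_compose[OF _ linear_on_euler_N]) (rule fmul_vforms[OF assms dV_vforms])
  then show ?thesis by (simp add: weighted_euler_def[abs_def])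
qed

lemma weighted_euler_sum:
  "g \<in> ACPE \<Longrightarrow> (\<And>i. i \<in> I \<Longrightarrow> f i \<in> ACPE) \<Longrightarrow> weighted_euler g (\<Sum>i\<in>I. f i) = (\<Sum>i\<in>I. weighted_euler g (f i))"
  by (intro linear_on_sum[OF linear_on_weighted_euler subspace_ACPE])

lemma weighted_euler_mult:
  assumes "g \<in> ACPE" "f \<in> ACPE" "h \<in> ACPE"
  shows "weighted_euler g (f * h) = weighted_euler (g * h) f + weighted_euler (g * f) h"
proof -
  have "fmul g (dV (f * h)) = fmul (g * h) (dV f) + fmul (g * f) (dV h)"
    unfolding dV_mult[OF assms(2,3)] by (simp add: fmul_def fun_eq_iff pointwise algebra_simps)
  then show ?thesis
    using assms
    by (simp add: weighted_euler_def linear_on_add[OF linear_on_euler_N] fmul_vforms dV_vforms ACPE_closed)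
qed

lemma weighted_euler_coord: "\<not> is_X w \<Longrightarrow> weighted_euler g (coord w) = euler N (single w g)"
  by (simp add: weighted_euler_def single_eq_fmul_dV)

lemma weighted_euler_coord_base: "w \<in> base_vars \<Longrightarrow> g \<in> ACPE \<Longrightarrow> weighted_euler g (coord w) = single w g"
  by (simp add: weighted_euler_coord fibre_varsD(1) base_vars_fibre euler_base_vforms single_base_vforms)

lemma weighted_euler_coord_shiftv:
  assumes "w \<in> fibre_vars" "g \<in> ACPE" "\<alpha> \<in> N"
  shows "weighted_euler g (coord (shiftv \<alpha> w)) = weighted_euler (- Dbar \<alpha> g) (coord w)"
  using euler_single_shiftv[OF assms] fibre_varsD(1)[OF assms(1)] by (simp add: weighted_euler_coord)

lemma weighted_euler_coord_shiftv_base: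
  assumes "w \<in> base_vars" "g \<in> ACPE" "\<alpha> \<in> N"
  shows "weighted_euler g (coord (shiftv \<alpha> w)) = - single w (Dbar \<alpha> g)"
proof -
  have "- Dbar \<alpha> g \<in> ACPE" using assms by (intro ACPE_closed Dbar_ACPE N_imp_M)
  then have "weighted_euler g (coord (shiftv \<alpha> w)) = single w (- Dbar \<alpha> g)"
    using weighted_euler_coord_shiftv[OF base_vars_fibre] weighted_euler_coord_base assms by simp
  then show ?thesis by (simp add: single_def fun_eq_iff pointwise)
qed

lemma euler_lie_vform_1_single:
  assumes "w \<in> base_vars" "g \<in> ACPE"
  shows "euler N (lie_vform 1 (single w g)) = single w (Dbar 1 g) + weighted_euler g (cpe_field w)"
proof -
  have w: "w \<in> fibre_vars" "cpe_field w \<in> ACPE"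
    using base_vars_fibre[OF assms(1)] by (auto simp: fibre_vars_def intro: cpe_field_ACPE)
  have D: "Dbar 1 g \<in> ACPE" by (rule Dbar_ACPE[OF assms(2) one_in_M])
  have "lie_vform 1 (single w g) = single w (Dbar 1 g) + fmul g (dV (cpe_field w))"
    using lie_vform_single[OF w(1) assms(2) one_in_M] by (simp add: bar_field_def)
  then show ?thesis
    using linear_on_add[OF linear_on_euler_N single_vforms[OF w(1) D]
        fmul_vforms[OF assms(2) dV_vforms[OF w(2)]]]
    by (simp add: weighted_euler_def euler_base_vforms single_base_vforms assms(1) D[simplified])
qed

lemma free_coords_ACPE:
  "\<alpha> \<in> N \<Longrightarrow> \<mu> \<in> {1..m} \<Longrightarrow> coord (U \<alpha> (unit \<mu>)) \<in> ACPE" "\<alpha> \<in> N \<Longrightarrow> coord (U 1 (unit \<alpha>)) \<in> ACPE"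
  "\<alpha> \<in> N \<Longrightarrow> coord (P (inc (unit \<alpha>) \<alpha>)) \<in> ACPE"
  using two_le_m by (auto intro!: ACPE_closed simp: free_var_simps valid_mi_unit valid_mi_inc_iff)

lemma weighted_euler_coord_U_unit:
  assumes "\<alpha> \<in> N" "g \<in> ACPE"
  shows "l \<in> N \<Longrightarrow> weighted_euler g (coord (U l (unit \<alpha>))) = - single (U l (at1 0)) (Dbar \<alpha> g)"
    and "weighted_euler g (coord (U 1 (unit \<alpha>))) = - single (U 1 (at1 0)) (Dbar \<alpha> g)"
  using weighted_euler_coord_shiftv_base[OF base_vars_memI(2) assms(2,1), of l 0]
    weighted_euler_coord_shiftv_base[OF base_vars_memI(1) assms(2,1)]
  by (simp_all add: at1_eqs unit_def)

lemma weighted_euler_div_u: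
  assumes "g \<in> ACPE" shows "weighted_euler g div_u = - (\<Sum>\<alpha>\<in>N. single (U \<alpha> (at1 0)) (Dbar \<alpha> g))"
  unfolding div_u_def using free_coords_ACPE(1) N_imp_M assms
  by (subst weighted_euler_sum) (auto simp: weighted_euler_coord_U_unit sum_negf)

lemma weighted_euler_mixed_product:
  assumes g: "g \<in> ACPE" and \<alpha>: "\<alpha> \<in> N"
  shows "weighted_euler g (coord (U 1 (unit \<alpha>)) * coord (U \<alpha> (unit 1)))
    = single (U \<alpha> (at1 1)) (g * coord (U 1 (unit \<alpha>)))
      - single (U 1 (at1 0)) (Dbar \<alpha> (g * coord (U \<alpha> (unit 1))))"
proof -
  note ACPE = free_coords_ACPE(2)[OF \<alpha>] free_coords_ACPE(1)[OF \<alpha> one_in_M]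
  show ?thesis
    using weighted_euler_mult[OF g ACPE] weighted_euler_coord_U_unit(2)[OF \<alpha> ACPE_closed(3)[OF g ACPE(2)]]
      weighted_euler_coord_base[OF base_vars_memI(2)[OF \<alpha>, of 1] ACPE_closed(3)[OF g ACPE(1)]]
    by (simp add: at1_eqs(2))
qed

lemma weighted_euler_symmetric_product:
  assumes g: "g \<in> ACPE"
  shows "weighted_euler g (\<Sum>\<alpha>\<in>N. \<Sum>\<beta>\<in>N. coord (U \<alpha> (unit \<beta>)) * coord (U \<beta> (unit \<alpha>)))
    = - 2 *\<^sub>R (\<Sum>\<alpha>\<in>N. \<Sum>\<beta>\<in>N. single (U \<alpha> (at1 0)) (Dbar \<beta> (g * coord (U \<beta> (unit \<alpha>)))))"
proof -
  define s where "s \<alpha> \<beta> = single (U \<alpha> (at1 0)) (Dbar \<beta> (g * coord (U \<beta> (unit \<alpha>))))" for \<alpha> \<beta>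
  have ACPE: "coord (U \<alpha> (unit \<beta>)) \<in> ACPE" if "\<alpha> \<in> N" "\<beta> \<in> N" for \<alpha> \<beta>
    using that free_coords_ACPE(1) N_imp_M by blast
  have "weighted_euler g (coord (U \<alpha> (unit \<beta>)) * coord (U \<beta> (unit \<alpha>))) = - s \<beta> \<alpha> - s \<alpha> \<beta>"
    if "\<alpha> \<in> N" "\<beta> \<in> N" for \<alpha> \<beta>
    using that g ACPE
    by (simp add: s_def weighted_euler_mult weighted_euler_coord_U_unit ACPE_closed del: Nset_iff)
  then have "weighted_euler g (\<Sum>\<alpha>\<in>N. \<Sum>\<beta>\<in>N. coord (U \<alpha> (unit \<beta>)) * coord (U \<beta> (unit \<alpha>)))
      = (\<Sum>\<alpha>\<in>N. \<Sum>\<beta>\<in>N. - s \<beta> \<alpha> - s \<alpha> \<beta>)"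
    using g ACPE by (simp add: weighted_euler_sum ACPE_closed del: Nset_iff)
  also have "\<dots> = - (\<Sum>\<alpha>\<in>N. \<Sum>\<beta>\<in>N. s \<beta> \<alpha>) - (\<Sum>\<alpha>\<in>N. \<Sum>\<beta>\<in>N. s \<alpha> \<beta>)"
    by (simp add: sum_subtractf sum_negf)
  also have "(\<Sum>\<alpha>\<in>N. \<Sum>\<beta>\<in>N. s \<beta> \<alpha>) = (\<Sum>\<alpha>\<in>N. \<Sum>\<beta>\<in>N. s \<alpha> \<beta>)" by (rule sum.swap)
  finally show ?thesis by (simp add: s_def scaleR_2)
qed

lemma weighted_euler_P_double_shift:
  assumes g: "g \<in> ACPE" and \<alpha>: "\<alpha> \<in> N"
  shows "weighted_euler g (coord (P (inc (unit \<alpha>) \<alpha>))) = single (P (at1 0)) (Dbar \<alpha> (Dbar \<alpha> g))"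
proof -
  have D: "Dbar \<alpha> g \<in> ACPE" "- Dbar \<alpha> g \<in> ACPE"
    using \<alpha> g by (auto intro!: ACPE_closed Dbar_ACPE)
  have shift: "P (inc (unit \<alpha>) \<alpha>) = shiftv \<alpha> (shiftv \<alpha> (P (at1 0)))" by (simp add: at1_eqs unit_def)
  have "shiftv \<alpha> (P (at1 0)) \<in> fibre_vars"
    using base_vars_fibre[OF base_vars_memI(3)] \<alpha> by (subst shiftv_fibre_vars)
  then have "weighted_euler g (coord (P (inc (unit \<alpha>) \<alpha>)))
      = weighted_euler (- Dbar \<alpha> g) (coord (shiftv \<alpha> (P (at1 0))))"
    unfolding shift using g \<alpha> by (rule weighted_euler_coord_shiftv)
  also have "\<dots> = - single (P (at1 0)) (Dbar \<alpha> (- Dbar \<alpha> g))"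
    by (rule weighted_euler_coord_shiftv_base[OF base_vars_memI(3) D(2) \<alpha>])
  finally show ?thesis
    using D by (simp add: linear_on_uminus[OF linear_on_Dbar]) (simp add: single_def fun_eq_iff pointwise)
qed

lemma weighted_euler_cpe_Phi:
  assumes g: "g \<in> ACPE"
  shows "weighted_euler g cpe_Phi = (\<Sum>\<alpha>\<in>N. single (P (at1 0)) (Dbar \<alpha> (Dbar \<alpha> g))) + 2 *\<^sub>R (
      (\<Sum>\<alpha>\<in>N. single (U \<alpha> (at1 1)) (g * coord (U 1 (unit \<alpha>))))
      - (\<Sum>\<alpha>\<in>N. single (U 1 (at1 0)) (Dbar \<alpha> (g * coord (U \<alpha> (unit 1)))))
      - (\<Sum>\<alpha>\<in>N. single (U \<alpha> (at1 0)) (Dbar \<alpha> (g * div_u)))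
      - (\<Sum>\<alpha>\<in>N. \<Sum>\<beta>\<in>N. single (U \<alpha> (at1 0)) (Dbar \<beta> (g * coord (U \<beta> (unit \<alpha>))))))"
proof -
  define a where "a \<alpha> = coord (U 1 (unit \<alpha>)) * coord (U \<alpha> (unit 1))" for \<alpha>
  define b where "b = (\<Sum>\<alpha>\<in>N. \<Sum>\<beta>\<in>N. coord (U \<alpha> (unit \<beta>)) * coord (U \<beta> (unit \<alpha>)))"
  define p where "p \<alpha> = coord (P (inc (unit \<alpha>) \<alpha>))" for \<alpha>
  have ACPE: "p \<alpha> \<in> ACPE" "a \<alpha> \<in> ACPE" if "\<alpha> \<in> N" for \<alpha>
    unfolding p_def a_def using that free_coords_ACPE one_in_M by (blast intro: ACPE_closed(3))+
  have b_ACPE: "b \<in> ACPE"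
    unfolding b_def by (intro ACPE_closed(3,10) free_coords_ACPE(1) N_imp_M)
  have sums: "(\<Sum>\<alpha>\<in>N. p \<alpha>) \<in> ACPE" "(\<Sum>\<alpha>\<in>N. a \<alpha>) \<in> ACPE" "div_u * div_u \<in> ACPE"
    by (intro ACPE_closed(3,10) ACPE div_u_ACPE; assumption)+
  have "cpe_Phi = (\<Sum>\<alpha>\<in>N. p \<alpha>) + (div_u * div_u + 2 *\<^sub>R (\<Sum>\<alpha>\<in>N. a \<alpha>) + b)"
    by (simp add: cpe_Phi_def quad_u_def a_def b_def p_def)
  then have "weighted_euler g cpe_Phi
      = weighted_euler g (\<Sum>\<alpha>\<in>N. p \<alpha>) +
        (weighted_euler g (div_u * div_u) + 2 *\<^sub>R weighted_euler g (\<Sum>\<alpha>\<in>N. a \<alpha>) + weighted_euler g b)"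
    using sums b_ACPE g
    by (simp add: linear_on_add[OF linear_on_weighted_euler] linear_on_scaleR[OF linear_on_weighted_euler]
        ACPE_closed)
  moreover have "weighted_euler g (div_u * div_u) = - 2 *\<^sub>R (\<Sum>\<alpha>\<in>N. single (U \<alpha> (at1 0)) (Dbar \<alpha> (g * div_u)))"
    using g div_u_ACPE by (simp add: weighted_euler_mult weighted_euler_div_u ACPE_closed scaleR_2)
  moreover have "weighted_euler g (\<Sum>\<alpha>\<in>N. p \<alpha>) = (\<Sum>\<alpha>\<in>N. single (P (at1 0)) (Dbar \<alpha> (Dbar \<alpha> g)))"
    using ACPE weighted_euler_sum[OF g, of N p] weighted_euler_P_double_shift[OF g]
    by (simp add: p_def del: Nset_iff)
  moreover have "weighted_euler g (\<Sum>\<alpha>\<in>N. a \<alpha>) = (\<Sum>\<alpha>\<in>N. single (U \<alpha> (at1 1)) (g * coord (U 1 (unit \<alpha>))))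
      - (\<Sum>\<alpha>\<in>N. single (U 1 (at1 0)) (Dbar \<alpha> (g * coord (U \<alpha> (unit 1)))))"
    using ACPE weighted_euler_sum[OF g, of N a] weighted_euler_mixed_product[OF g]
    by (simp add: a_def sum_subtractf del: Nset_iff One_nat_def)
  ultimately show ?thesis using weighted_euler_symmetric_product[OF g] by (simp add: b_def algebra_simps)
qed

definition cpe_system :: "(var \<Rightarrow> fn) \<Rightarrow> var \<Rightarrow> fn" where
  "cpe_system \<rho> v = Dbar 1 (\<rho> v) + (case v of
      X _ \<Rightarrow> 0
    | U l i \<Rightarrow> if l = 1 then 2 *\<^sub>R (\<Sum>\<alpha>\<in>N. Dbar \<alpha> (\<rho> (P (at1 1)) * coord (U \<alpha> (unit 1))))
        else (if i 1 = 0 then Dbar l (\<rho> (U 1 (at1 0))) else \<rho> (U l (at1 (i 1 - 1))))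
          + 2 *\<^sub>R ((if i 1 = 0 then Dbar l (\<rho> (P (at1 1)) * div_u) else 0)
            - (if i 1 = 1 then \<rho> (P (at1 1)) * coord (U 1 (unit l)) else 0)
            + (if i 1 = 0 then \<Sum>\<beta>\<in>N. Dbar \<beta> (\<rho> (P (at1 1)) * coord (U \<beta> (unit l))) else 0))
    | P i \<Rightarrow> if i 1 = 0 then - (\<Sum>\<alpha>\<in>N. Dbar \<alpha> (Dbar \<alpha> (\<rho> (P (at1 1))))) else \<rho> (P (at1 0)))"

lemma linear_on_cpe_system:
  assumes "v \<in> base_vars" shows "linear_on (base_vforms N) (\<lambda>\<rho>. cpe_system \<rho> v)"
proof -
  have component: "linear_on (base_vforms N) (\<lambda>\<rho>. \<rho> w)" for w
    by (rule linear_onI) (simp_all add: plus_fun_apply scaleR_fun_apply)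
  have ACPE: "\<rho> w \<in> ACPE" if "\<rho> \<in> base_vforms N" for \<rho> w
    using that base_vforms_imp_vforms vforms_ACPE by blast
  have mult: "linear_on (base_vforms N) (\<lambda>\<rho>. \<rho> w * f)" for w f
    by (rule linear_onI) (simp_all add: plus_fun_apply scaleR_fun_apply distrib_right)
  have D: "linear_on (base_vforms N) (\<lambda>\<rho>. Dbar \<mu> (T \<rho>))"
    if "linear_on (base_vforms N) T" "\<And>\<rho>. \<rho> \<in> base_vforms N \<Longrightarrow> T \<rho> \<in> ACPE" for \<mu> T
    using that by (intro linear_on_compose[OF _ linear_on_Dbar])
  have zero: "linear_on (base_vforms N) (\<lambda>_. 0 :: fn)" by (rule linear_onI) simp_all
  note linear = linear_on_if_fun linear_on_add_fun linear_on_diff_fun linear_on_scaleR_fun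
    linear_on_uminus_fun linear_on_sum_fun
    component mult D zero ACPE_closed(3) ACPE Dbar_ACPE div_u_ACPE free_coords_ACPE N_imp_M one_in_M
  show ?thesis
  proof (cases v)
    case (U l i)
    then have "l \<noteq> 1 \<Longrightarrow> l \<in> N" using assms by (auto simp: base_vars_iff)
    then show ?thesis unfolding cpe_system_def U var.case by (intro linear)
  next
    case (P i)
    show ?thesis unfolding cpe_system_def P var.case by (intro linear)
  next
    case (X \<nu>)
    show ?thesis unfolding cpe_system_def X var.case by (intro linear)
  qed
qed

lemma weighted_euler_cpe_field:
  assumes g: "g \<in> ACPE"
  shows "weighted_euler g (cpe_field (U 1 (at1 0))) = (\<Sum>\<alpha>\<in>N. single (U \<alpha> (at1 0)) (Dbar \<alpha> g))"
    and "\<alpha> \<in> N \<Longrightarrow> weighted_euler g (cpe_field (U \<alpha> (at1 k))) = single (U \<alpha> (at1 (Suc k))) g"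
    and "weighted_euler g (cpe_field (P (at1 0))) = single (P (at1 1)) g"
    and "weighted_euler g (cpe_field (P (at1 1))) = - weighted_euler g cpe_Phi"
proof -
  have "cpe_field (U 1 (at1 0)) = - div_u" by (simp add: cpe_field_def div_u_def at1_eqs unit_def)
  then show "weighted_euler g (cpe_field (U 1 (at1 0))) = (\<Sum>\<alpha>\<in>N. single (U \<alpha> (at1 0)) (Dbar \<alpha> g))"
    using linear_on_uminus[OF linear_on_weighted_euler[OF g] div_u_ACPE] weighted_euler_div_u[OF g] by simp
  show "weighted_euler g (cpe_field (U \<alpha> (at1 k))) = single (U \<alpha> (at1 (Suc k))) g" if "\<alpha> \<in> N"
    using that weighted_euler_coord_base[OF base_vars_memI(2)[OF that] g, of "Suc k"]
    by (simp add: cpe_field_def at1_eqs)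
  show "weighted_euler g (cpe_field (P (at1 0))) = single (P (at1 1)) g"
    using weighted_euler_coord_base[OF base_vars_memI(4) g] at1_eqs(3)[of 0] by (simp add: cpe_field_def)
  have "(at1 1)(1 := 0) = (\<lambda>_. 0)" by (auto simp: fun_eq_iff)
  then have "cpe_field (P (at1 1)) = - cpe_Phi" by (simp add: cpe_field_def)
  then show "weighted_euler g (cpe_field (P (at1 1))) = - weighted_euler g cpe_Phi"
    using linear_on_uminus[OF linear_on_weighted_euler[OF g] cpe_Phi_ACPE] by simp
qed

lemma sum_single: "(\<Sum>i\<in>I. single w (h i)) = single w (\<Sum>i\<in>I. h i)"
  by (auto simp: single_def sum_fun_apply fun_eq_iff zero_fun_apply)

lemma sum_single_apply:
  "(\<Sum>\<alpha>\<in>N. single (U \<alpha> i) (h \<alpha>)) v = (case v of U l i' \<Rightarrow> if l \<in> N \<and> i' = i then h l else 0 | _ \<Rightarrow> 0)"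
  by (cases v) (auto simp: sum_fun_apply single_def if_distrib)

lemma euler_lie_vform_1:
  assumes \<rho>: "\<rho> \<in> base_vforms N" and v: "v \<in> base_vars" shows "euler N (lie_vform 1 \<rho>) v = cpe_system \<rho> v"
proof (rule linear_on_base_vforms_eqI[of "\<lambda>\<rho>. euler N (lie_vform 1 \<rho>) v",
      OF _ linear_on_cpe_system[OF v] _ \<rho>])
  have "linear_on (base_vforms N) (lie_vform 1)"
    by (rule linear_on_subset[OF linear_on_lie_vform]) (auto intro: base_vforms_imp_vforms)
  then have "linear_on (base_vforms N) (\<lambda>\<rho>. euler N (lie_vform 1 \<rho>))"
    by (rule linear_on_compose[OF _ linear_on_euler_N])
      (rule lie_vform_vforms[OF base_vforms_imp_vforms one_in_M])
  then show "linear_on (base_vforms N) (\<lambda>\<rho>. euler N (lie_vform 1 \<rho>) v)"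
    by (simp add: linear_on_def plus_fun_apply scaleR_fun_apply)
  fix w g assume w: "w \<in> base_vars" and g: "g \<in> ACPE"
  show "euler N (lie_vform 1 (single w g)) v = cpe_system (single w g) v"
    using w
  proof (cases rule: base_vars_cases)
    case U1
    show ?thesis
      using v unfolding euler_lie_vform_1_single[OF w g] unfolding U1 weighted_euler_cpe_field[OF g]
      by (cases rule: base_vars_cases)
        (auto simp: plus_fun_apply sum_single_apply single_def cpe_system_def)
  next
    case (U \<alpha> k)
    show ?thesis
      using v U(1) unfolding euler_lie_vform_1_single[OF w g]
      unfolding U(2) weighted_euler_cpe_field(2)[OF g U(1)]
      by (cases rule: base_vars_cases)
        (auto simp: plus_fun_apply sum_single_apply single_def cpe_system_def)
  next
    case P0
    show ?thesis
      using v unfolding euler_lie_vform_1_single[OF w g] unfolding P0 weighted_euler_cpe_field[OF g]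
      by (cases rule: base_vars_cases)
        (auto simp: plus_fun_apply sum_single_apply single_def cpe_system_def)
  next
    case P1
    show ?thesis
      using v unfolding euler_lie_vform_1_single[OF w g]
      unfolding P1 weighted_euler_cpe_field[OF g] weighted_euler_cpe_Phi[OF g]
      by (cases rule: base_vars_cases)
        (auto simp: plus_fun_apply minus_apply uminus_apply scaleR_fun_apply sum_single sum_single_apply
            single_def cpe_system_def)
  qed
qed

subsection \<open>Families of coefficients\<close>

definition form_of :: "fam \<Rightarrow> var \<Rightarrow> fn" where
  "form_of a v = (case a of (u, c, p0, p1) \<Rightarrow> if v \<notin> base_vars then 0 else (case v of
      X _ \<Rightarrow> 0
    | U l i \<Rightarrow> reduce (if l = 1 then u else c (i 1) l)
    | P i \<Rightarrow> reduce (if i 1 = 0 then p0 else p1)))"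

definition fam_of :: "(var \<Rightarrow> fn) \<Rightarrow> fam" where
  "fam_of \<rho> = (\<rho> (U 1 (at1 0)), \<lambda>k \<alpha>. if \<alpha> \<in> N then \<rho> (U \<alpha> (at1 k)) else 0, \<rho> (P (at1 0)), \<rho> (P (at1 1)))"

lemma form_of_simps:
  "form_of (u, c, p0, p1) (U 1 (at1 0)) = reduce u"
  "\<alpha> \<in> N \<Longrightarrow> form_of (u, c, p0, p1) (U \<alpha> (at1 k)) = reduce (c k \<alpha>)"
  "form_of (u, c, p0, p1) (P (at1 0)) = reduce p0"
  "form_of (u, c, p0, p1) (P (at1 1)) = reduce p1"
  "v \<notin> base_vars \<Longrightarrow> form_of a v = 0"
  using base_vars_memI by (auto simp: form_of_def split: prod.split)

lemma supp_form_of: "supp (form_of a) \<subseteq> base_vars"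
  unfolding supp_def using form_of_simps(5) by blast

lemma form_of_ext:
  assumes "\<And>v. v \<in> base_vars \<Longrightarrow> form_of a v = \<rho> v" "\<And>v. v \<notin> base_vars \<Longrightarrow> \<rho> v = 0" shows "form_of a = \<rho>"
  using assms form_of_simps(5) by (intro ext) metis

lemma eqJ_0_iff: "f \<in> AB m \<Longrightarrow> eqJ m f (\<lambda>_. 0) \<longleftrightarrow> reduce f = 0"
  using eqJ_iff[of f "\<lambda>_. 0"] AB_closed(2)[of 0] by (simp add: zero_fun_def)

lemma ball_base_vars:
  "(\<forall>v\<in>base_vars. Q v) \<longleftrightarrow>
    Q (U 1 (at1 0)) \<and> (\<forall>k. \<forall>\<alpha>\<in>N. Q (U \<alpha> (at1 k))) \<and> Q (P (at1 0)) \<and> Q (P (at1 1))" (is "?L \<longleftrightarrow> ?R")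
proof
  show ?R if ?L using that base_vars_memI by blast
  show ?L if ?R
  proof
    fix v assume "v \<in> base_vars"
    then show "Q v" using that by (cases rule: base_vars_cases) blast+
  qed
qed

lemma Fams_iff:
  "(u, c, p0, p1) \<in> Fams m \<longleftrightarrow> u \<in> AB m \<and> p0 \<in> AB m \<and> p1 \<in> AB m
    \<and> (\<forall>k. \<forall>\<alpha>\<in>N. c k \<alpha> \<in> AB m) \<and> (\<forall>k \<alpha>. \<alpha> \<notin> N \<longrightarrow> c k \<alpha> = 0) \<and> (\<exists>K. \<forall>k\<ge>K. \<forall>\<alpha>\<in>N. reduce (c k \<alpha>) = 0)"
proof -
  have zero: "(\<lambda>_. 0) = (0 :: fn)" by (simp add: zero_fun_def)
  have "eqJ m (c k \<alpha>) 0 \<longleftrightarrow> reduce (c k \<alpha>) = 0" if "c k \<alpha> \<in> AB m" for k \<alpha>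
    using eqJ_0_iff[OF that] by (simp only: zero)
  then have "(\<exists>K. \<forall>k\<ge>K. \<forall>\<alpha>\<in>N. eqJ m (c k \<alpha>) 0) \<longleftrightarrow> (\<exists>K. \<forall>k\<ge>K. \<forall>\<alpha>\<in>N. reduce (c k \<alpha>) = 0)"
    if "\<forall>k. \<forall>\<alpha>\<in>N. c k \<alpha> \<in> AB m"
    using that by simp
  then show ?thesis unfolding Fams_def zero mem_Collect_eq prod.case by blast
qed

lemma form_of_base_vforms:
  assumes "a \<in> Fams m" shows "form_of a \<in> base_vforms N"
proof -
  obtain u c p0 p1 where a: "a = (u, c, p0, p1)" by (cases a)
  have AB: "u \<in> AB m" "p0 \<in> AB m" "p1 \<in> AB m" "\<And>k \<alpha>. \<alpha> \<in> N \<Longrightarrow> c k \<alpha> \<in> AB m"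
    using assms unfolding a Fams_iff by simp_all
  obtain K where K: "\<And>k \<alpha>. K \<le> k \<Longrightarrow> \<alpha> \<in> N \<Longrightarrow> reduce (c k \<alpha>) = 0"
    using assms unfolding a Fams_iff by blast
  let ?S = "{U 1 (at1 0), P (at1 0), P (at1 1)} \<union> (\<lambda>(k, \<alpha>). U \<alpha> (at1 k)) ` ({..<K} \<times> N)"
  have "form_of a \<in> vforms"
  proof (rule vformsI)
    show "finite ?S" by simp
    show "?S \<subseteq> fibre_vars" using base_vars_memI base_vars_fibre by auto
    show "supp (form_of a) \<subseteq> ?S"
    proof
      fix v assume v: "v \<in> supp (form_of a)"
      then have "v \<in> base_vars" using supp_form_of by blast
      then show "v \<in> ?S"
      proof (cases rule: base_vars_cases)
        case (U \<alpha> k)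
        then have "k < K" using v K[of k \<alpha>] by (auto simp: supp_def a form_of_simps not_le[symmetric])
        then show ?thesis using U by auto
      qed auto
    qed
    show "form_of a v \<in> ACPE" if "v \<in> ?S" for v
      using that AB reduce_ACPE by (auto simp: a form_of_simps simp flip: One_nat_def)
  qed
  moreover have "idx \<alpha> v = 0" if "v \<in> supp (form_of a)" "\<alpha> \<in> N" for v \<alpha>
  proof -
    have "v \<in> base_vars" using that(1) supp_form_of by blast
    then show ?thesis using idx_base_var[of v \<alpha>] that(2) by (simp add: base_vars_def)
  qed
  ultimately show ?thesis by (simp add: base_vforms_def)
qed

lemma famEqJ_iff:
  assumes "a \<in> Fams m" "b \<in> Fams m" shows "famEqJ m a b \<longleftrightarrow> form_of a = form_of b"
proof -
  obtain u c p0 p1 where a: "a = (u, c, p0, p1)" by (cases a)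
  obtain u' c' p0' p1' where b: "b = (u', c', p0', p1')" by (cases b)
  have "famEqJ m a b \<longleftrightarrow> reduce u = reduce u' \<and> (\<forall>k. \<forall>\<alpha>\<in>N. reduce (c k \<alpha>) = reduce (c' k \<alpha>))
      \<and> reduce p0 = reduce p0' \<and> reduce p1 = reduce p1'"
    using assms unfolding a b famEqJ_def Fams_def by (auto simp: eqJ_iff)
  also have "\<dots> \<longleftrightarrow> (\<forall>v\<in>base_vars. form_of a v = form_of b v)"
    unfolding a b by (simp add: ball_base_vars form_of_simps del: Nset_iff One_nat_def)
  also have "\<dots> \<longleftrightarrow> form_of a = form_of b"
    using form_of_ext[of a "form_of b"] form_of_simps(5) by metis
  finally show ?thesis .
qed

lemma fam_of_Fams:
  assumes "\<rho> \<in> base_vforms N" shows "fam_of \<rho> \<in> Fams m"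
proof -
  have AB: "\<rho> v \<in> AB m" for v using vforms_ACPE[OF base_vforms_imp_vforms[OF assms]] ACPE_AB by blast
  have "finite (idx 1 ` supp \<rho>)" using finite_supp[OF base_vforms_imp_vforms[OF assms]] by simp
  then obtain K where "\<And>v. v \<in> supp \<rho> \<Longrightarrow> idx 1 v < K" by (meson finite_nat_set_iff_bounded imageI)
  then have "\<rho> (U \<alpha> (at1 k)) = 0" if "K \<le> k" for \<alpha> k using that by (fastforce simp: supp_def)
  then have "\<forall>k\<ge>K. \<forall>\<alpha>\<in>N. reduce (\<rho> (U \<alpha> (at1 k))) = 0" by simp
  then show ?thesis using AB unfolding fam_of_def Fams_iff by auto
qed

lemma form_of_fam_of:
  assumes "\<rho> \<in> base_vforms N" shows "form_of (fam_of \<rho>) = \<rho>"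
proof (rule form_of_ext)
  have "reduce (\<rho> v) = \<rho> v" for v by (rule reduce_id[OF vforms_ACPE[OF base_vforms_imp_vforms[OF assms]]])
  then have "\<forall>v\<in>base_vars. form_of (fam_of \<rho>) v = \<rho> v"
    unfolding ball_base_vars by (simp add: fam_of_def form_of_simps del: Nset_iff One_nat_def)
  then show "form_of (fam_of \<rho>) v = \<rho> v" if "v \<in> base_vars" for v using that by blast
  show "\<rho> v = 0" if "v \<notin> base_vars" for v using that supp_base_vforms[OF assms] by (auto simp: supp_def)
qed

lemma euler_dV_base_vforms: "L \<in> ACPE \<Longrightarrow> euler N (dV L) \<in> base_vforms N"
  by (rule euler_decomposition(1)[OF order_refl dV_vforms])

lemma vdfam_eq: "L \<in> AB m \<Longrightarrow> vdfam m L = fam_of (euler N (dV (reduce L)))"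
  using vder_eq_euler base_vars_memI by (auto simp: vdfam_def fam_of_def at1_eqs zero_fun_def fun_eq_iff)

lemma vdfam_Fams: "L \<in> AB m \<Longrightarrow> vdfam m L \<in> Fams m"
  by (simp add: vdfam_eq fam_of_Fams euler_dV_base_vforms reduce_ACPE)

lemma form_of_vdfam: "L \<in> AB m \<Longrightarrow> form_of (vdfam m L) = euler N (dV (reduce L))"
  by (simp add: vdfam_eq form_of_fam_of euler_dV_base_vforms reduce_ACPE)

lemma Hspace_iff:
  assumes "a \<in> Fams m" shows "a \<in> Hspace m \<longleftrightarrow> (\<exists>L\<in>ACPE. form_of a = euler N (dV L))"
proof -
  have "a \<in> Hspace m \<longleftrightarrow> (\<exists>L\<in>AB m. form_of a = euler N (dV (reduce L)))"
    using assms by (auto simp: Hspace_def famEqJ_iff vdfam_Fams form_of_vdfam)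
  also have "\<dots> \<longleftrightarrow> (\<exists>L\<in>ACPE. form_of a = euler N (dV L))"
    using reduce_ACPE ACPE_AB reduce_id by metis
  finally show ?thesis .
qed

lemma reduce_Dt: "f \<in> AB m \<Longrightarrow> \<mu> \<in> {1..m} \<Longrightarrow> reduce (Dt m \<mu> f) = Dbar \<mu> (reduce f)"
  by (simp add: Dbar_reduce)

lemma reduce_free_coords:
  "\<alpha> \<in> N \<Longrightarrow> \<mu> \<in> {1..m} \<Longrightarrow> reduce_coord (U \<alpha> (unit \<mu>)) = coord (U \<alpha> (unit \<mu>))"
  "\<alpha> \<in> N \<Longrightarrow> reduce_coord (U 1 (unit \<alpha>)) = coord (U 1 (unit \<alpha>))"
  "reduce div_u = div_u"
  using reduce_id[OF free_coords_ACPE(1)] reduce_id[OF free_coords_ACPE(2)] reduce_id[OF div_u_ACPE]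
  by simp_all

lemma eqJ_system_iff:
  assumes "(u, c, p0, p1) \<in> Fams m"
  shows "eqJ m (\<lambda>y. Dt m 1 u y + 2 * (\<Sum>\<alpha>\<in>N. Dt m \<alpha> (mulf (coord (U \<alpha> (unit 1))) p1) y)) (\<lambda>_. 0)
      \<longleftrightarrow> cpe_system (form_of (u, c, p0, p1)) (U 1 (at1 0)) = 0"
    and "eqJ m (\<lambda>y. Dt m 1 p0 y - (\<Sum>\<alpha>\<in>N. Dt m \<alpha> (Dt m \<alpha> p1) y)) (\<lambda>_. 0)
      \<longleftrightarrow> cpe_system (form_of (u, c, p0, p1)) (P (at1 0)) = 0"
    and "eqJ m (\<lambda>y. Dt m 1 p1 y + p0 y) (\<lambda>_. 0) \<longleftrightarrow> cpe_system (form_of (u, c, p0, p1)) (P (at1 1)) = 0"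
proof -
  have AB: "u \<in> AB m" "p0 \<in> AB m" "p1 \<in> AB m" using assms by (auto simp: Fams_def)
  have coord_AB: "coord (U \<alpha> (unit 1)) \<in> AB m" if "\<alpha> \<in> N" for \<alpha>
    by (rule ACPE_AB[OF free_coords_ACPE(1)[OF that one_in_M]])
  note closed = AB_closed(3,6,7,9,10) Dt_AB AB coord_AB one_in_M N_imp_M
  have "(\<lambda>y. Dt m 1 u y + 2 * (\<Sum>\<alpha>\<in>N. Dt m \<alpha> (mulf (coord (U \<alpha> (unit 1))) p1) y))
      = Dt m 1 u + 2 *\<^sub>R (\<Sum>\<alpha>\<in>N. Dt m \<alpha> (coord (U \<alpha> (unit 1)) * p1))" (is "?f = ?g")
    by (simp add: fun_eq_iff pointwise mulf_def times_fun_def)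
  moreover have "?g \<in> AB m" by (intro closed)
  moreover have "reduce ?g = cpe_system (form_of (u, c, p0, p1)) (U 1 (at1 0))"
    using closed
    by (simp add: reduce_Dt reduce_free_coords cpe_system_def form_of_simps mult.commute del: One_nat_def)
  ultimately show "eqJ m ?f (\<lambda>_. 0) \<longleftrightarrow> cpe_system (form_of (u, c, p0, p1)) (U 1 (at1 0)) = 0"
    by (simp add: eqJ_0_iff)
  have "(\<lambda>y. Dt m 1 p0 y - (\<Sum>\<alpha>\<in>N. Dt m \<alpha> (Dt m \<alpha> p1) y)) = Dt m 1 p0 - (\<Sum>\<alpha>\<in>N. Dt m \<alpha> (Dt m \<alpha> p1))"
    (is "?f = ?g")
    by (simp add: fun_eq_iff pointwise)
  moreover have "?g \<in> AB m" by (intro closed)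
  moreover have "reduce ?g = cpe_system (form_of (u, c, p0, p1)) (P (at1 0))"
    using closed by (simp add: reduce_Dt cpe_system_def form_of_simps del: One_nat_def)
  ultimately show "eqJ m ?f (\<lambda>_. 0) \<longleftrightarrow> cpe_system (form_of (u, c, p0, p1)) (P (at1 0)) = 0"
    by (simp add: eqJ_0_iff)
  have "(\<lambda>y. Dt m 1 p1 y + p0 y) = Dt m 1 p1 + p0" (is "?f = ?g") by (simp add: fun_eq_iff pointwise)
  moreover have "?g \<in> AB m" by (intro closed)
  moreover have "reduce ?g = cpe_system (form_of (u, c, p0, p1)) (P (at1 1))"
    using closed by (simp add: reduce_Dt cpe_system_def form_of_simps del: One_nat_def)
  ultimately show "eqJ m ?f (\<lambda>_. 0) \<longleftrightarrow> cpe_system (form_of (u, c, p0, p1)) (P (at1 1)) = 0"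
    by (simp add: eqJ_0_iff)
qed

lemma eqJ_system_U_iff:
  assumes "(u, c, p0, p1) \<in> Fams m" and \<alpha>: "\<alpha> \<in> N"
  shows "eqJ m (\<lambda>y. Dt m 1 (c k \<alpha>) y
        + (if k = 0 then Dt m \<alpha> u y else 0)
        + (if k = 0 then 0 else c (k - 1) \<alpha> y)
        + 2 * ((if k = 0 then Dt m \<alpha> (\<lambda>z. (\<Sum>\<beta>\<in>N. z (U \<beta> (unit \<beta>))) * p1 z) y else 0)
               - (if k = 1 then y (U 1 (unit \<alpha>)) * p1 y else 0)
               + (if k = 0 then (\<Sum>\<beta>\<in>N. Dt m \<beta> (mulf (coord (U \<beta> (unit \<alpha>))) p1) y) else 0)))
      (\<lambda>_. 0) \<longleftrightarrow> cpe_system (form_of (u, c, p0, p1)) (U \<alpha> (at1 k)) = 0"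
    (is "eqJ m ?f _ \<longleftrightarrow> _")
proof -
  have AB: "u \<in> AB m" "p1 \<in> AB m" "c k \<alpha> \<in> AB m" for k using assms by (auto simp: Fams_def)
  have coord_AB: "coord (U \<beta> (unit \<alpha>)) \<in> AB m" if "\<beta> \<in> N" for \<beta>
    by (rule ACPE_AB[OF free_coords_ACPE(1)[OF that N_imp_M[OF \<alpha>]]])
  have closed: "0 \<in> AB m" "coord (U 1 (unit \<alpha>)) \<in> AB m" "div_u \<in> AB m"
    using AB_closed(5) ACPE_AB free_coords_ACPE(2)[OF \<alpha>] div_u_ACPE by blast+
  let ?g = "Dt m 1 (c k \<alpha>) + (if k = 0 then Dt m \<alpha> u else c (k - 1) \<alpha>)
    + 2 *\<^sub>R ((if k = 0 then Dt m \<alpha> (div_u * p1) else 0) - (if k = 1 then coord (U 1 (unit \<alpha>)) * p1 else 0)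
      + (if k = 0 then \<Sum>\<beta>\<in>N. Dt m \<beta> (coord (U \<beta> (unit \<alpha>)) * p1) else 0))"
  have products: "(\<lambda>z. (\<Sum>\<beta>\<in>N. z (U \<beta> (unit \<beta>))) * p1 z) = div_u * p1" "mulf f p1 = f * p1" for f
    by (simp_all add: div_u_def mulf_def fun_eq_iff pointwise)
  have "?f = ?g" unfolding products by (simp add: fun_eq_iff pointwise)
  moreover have "?g \<in> AB m"
    using AB closed coord_AB \<alpha> one_in_M by (auto intro!: AB_closed(3,6,7,9,10) Dt_AB simp del: One_nat_def)
  moreover have "\<alpha> \<noteq> 1" using \<alpha> by auto
  then have "reduce ?g = cpe_system (form_of (u, c, p0, p1)) (U \<alpha> (at1 k))"
    using AB closed coord_AB \<alpha> one_in_M N_imp_M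
    by (auto simp: reduce_Dt reduce_free_coords cpe_system_def form_of_simps mult.commute AB_closed(3)
        simp del: One_nat_def Nset_iff)
  ultimately show ?thesis by (simp only: eqJ_0_iff)
qed

lemma Sspace_iff:
  assumes "a \<in> Fams m" shows "a \<in> Sspace m \<longleftrightarrow> euler N (lie_vform 1 (form_of a)) = 0"
proof -
  obtain u c p0 p1 where a: "a = (u, c, p0, p1)" by (cases a)
  note a_base = form_of_base_vforms[OF assms]
  have "euler N (lie_vform 1 (form_of a)) \<in> base_vforms N"
    by (rule euler_decomposition(1)[OF order_refl lie_vform_vforms[OF base_vforms_imp_vforms[OF a_base]
        one_in_M]])
  from supp_base_vforms[OF this] have "euler N (lie_vform 1 (form_of a)) = 0
      \<longleftrightarrow> (\<forall>v\<in>base_vars. euler N (lie_vform 1 (form_of a)) v = 0)"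
    by (auto simp: supp_def fun_eq_iff[of _ "0 :: var \<Rightarrow> fn"] zero_fun_apply)
  also have "\<dots> \<longleftrightarrow> (\<forall>v\<in>base_vars. cpe_system (form_of a) v = 0)" using euler_lie_vform_1[OF a_base] by simp
  also have "\<dots> \<longleftrightarrow> a \<in> Sspace m"
    using eqJ_system_iff[OF assms[unfolded a]] eqJ_system_U_iff[OF assms[unfolded a]] assms
    unfolding a ball_base_vars Sspace_def by simp
  finally show ?thesis ..
qed

section \<open>Representatives\<close>

definition reduce_form :: "form \<Rightarrow> form" where
  "reduce_form \<omega> I = reduce (\<omega> I)"

lemma formsOn_iff:
  "\<omega> \<in> formsOn m A q \<longleftrightarrow> (\<forall>I. if I \<subseteq> A \<and> card I = q then \<omega> I \<in> AB m else \<omega> I = 0)"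
  by (simp add: formsOn_def zero_fun_def)

lemma formsOn_AB:
  assumes "\<omega> \<in> formsOn m A q" shows "\<omega> I \<in> AB m"
  using assms[unfolded formsOn_iff, THEN spec[of _ I]] AB_closed(5) by (auto split: if_splits)

lemma formsOn_outside: "\<omega> \<in> formsOn m A q \<Longrightarrow> \<not> I \<subseteq> A \<or> card I \<noteq> q \<Longrightarrow> \<omega> I = 0"
  unfolding formsOn_iff by meson

lemma formsOnI: "(\<And>I. \<omega> I \<in> AB m) \<Longrightarrow> (\<And>I. \<not> I \<subseteq> A \<or> card I \<noteq> q \<Longrightarrow> \<omega> I = 0) \<Longrightarrow> \<omega> \<in> formsOn m A q"
  unfolding formsOn_iff by simp

lemma forms_formsOn: "\<theta> \<in> forms A (int q) \<Longrightarrow> \<theta> \<in> formsOn m A q"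
  unfolding formsOn_iff using formsD ACPE_AB by fastforce

lemma reduce_form_forms: "\<omega> \<in> formsOn m A q \<Longrightarrow> reduce_form \<omega> \<in> forms A (int q)"
  using formsOn_AB reduce_ACPE by (intro formsI) (auto simp: reduce_form_def formsOn_iff)

lemma reduce_form_id: "\<theta> \<in> forms A q \<Longrightarrow> reduce_form \<theta> = \<theta>"
  using formsD(1) reduce_id by (auto simp: reduce_form_def)

lemma reduce_form_linear:
  "reduce_form (\<omega> + \<eta>) = reduce_form \<omega> + reduce_form \<eta>" "reduce_form (c *\<^sub>R \<omega>) = c *\<^sub>R reduce_form \<omega>"
  "reduce_form (\<omega> - \<eta>) = reduce_form \<omega> - reduce_form \<eta>"
  by (rule ext; simp add: reduce_form_def plus_fun_apply scaleR_fun_apply minus_apply)+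

lemma formEqJ_iff:
  assumes "\<And>I. \<omega> I \<in> AB m" "\<And>I. \<eta> I \<in> AB m" shows "formEqJ m \<omega> \<eta> \<longleftrightarrow> reduce_form \<omega> = reduce_form \<eta>"
  using assms by (simp add: formEqJ_def eqJ_iff reduce_form_def fun_eq_iff[of "reduce_form \<omega>"])

lemma dOn_eq: "dOn m A \<omega> I = (if I \<subseteq> A then \<Sum>\<mu>\<in>I. sgn_ins \<mu> (I - {\<mu>}) *\<^sub>R Dt m \<mu> (\<omega> (I - {\<mu>})) else 0)"
  by (simp add: dOn_def fun_eq_iff pointwise)

lemma dOn_AB: "A \<subseteq> {1..m} \<Longrightarrow> \<omega> \<in> formsOn m A q \<Longrightarrow> dOn m A \<omega> I \<in> AB m"
  unfolding dOn_eq using formsOn_AB by (auto intro!: AB_closed Dt_AB)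

lemma reduce_form_dOn:
  assumes "A \<subseteq> {1..m}" "\<omega> \<in> formsOn m A q" shows "reduce_form (dOn m A \<omega>) = dbar A (reduce_form \<omega>)"
proof
  fix I
  have "\<mu> \<in> {1..m}" if "I \<subseteq> A" "\<mu> \<in> I" for \<mu> using that assms(1) by blast
  then show "reduce_form (dOn m A \<omega>) I = dbar A (reduce_form \<omega>) I"
    using formsOn_AB[OF assms(2)] by (simp add: reduce_form_def dOn_eq dbar_def reduce_Dt)
qed

lemma formEqJ_0_iff: "(\<And>I. \<omega> I \<in> AB m) \<Longrightarrow> formEqJ m \<omega> (\<lambda>_ _. 0) \<longleftrightarrow> reduce_form \<omega> = 0"
  by (simp add: formEqJ_def eqJ_0_iff fun_zero_iff[of "reduce_form \<omega>"] reduce_form_def)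

lemma formEqJ_dOn_0_iff:
  assumes "A \<subseteq> {1..m}" "\<omega> \<in> formsOn m A q"
  shows "formEqJ m (dOn m A \<omega>) (\<lambda>_ _. 0) \<longleftrightarrow> reduce_form \<omega> \<in> cocycles A (int q)"
  using formEqJ_0_iff[OF dOn_AB[OF assms]] reduce_form_dOn[OF assms] reduce_form_forms[OF assms(2)]
  by (simp add: cocycles_def)

lemma formEqJ_exact_iff:
  assumes A: "A \<subseteq> {1..m}" and \<omega>: "\<omega> \<in> formsOn m A q"
  shows "(if q = 0 then formEqJ m \<omega> (\<lambda>_ _. 0) else \<exists>\<eta>\<in>formsOn m A (q - 1). formEqJ m \<omega> (dOn m A \<eta>))
    \<longleftrightarrow> reduce_form \<omega> \<in> coboundaries A (int q)"
proof (cases "q = 0")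
  case True
  have "\<eta> = 0" if "\<eta> \<in> forms A (- 1)" for \<eta>
    using formsD(2)[OF that] unfolding fun_zero_iff[of \<eta>] by simp
  then have "coboundaries A 0 = {0}"
    using linear_on_zero[OF linear_on_dbar subspace_forms] forms_closed(1) by (force simp: coboundaries_def)
  then show ?thesis using True formEqJ_0_iff[OF formsOn_AB[OF \<omega>]] by simp
next
  case False
  then have q: "int q - 1 = int (q - 1)" by simp
  have "formEqJ m \<omega> (dOn m A \<eta>) \<longleftrightarrow> reduce_form \<omega> = dbar A (reduce_form \<eta>)" if "\<eta> \<in> formsOn m A (q - 1)" for \<eta>
    using formEqJ_iff[OF formsOn_AB[OF \<omega>] dOn_AB[OF A that]] reduce_form_dOn[OF A that] by simp
  then show ?thesis
    using False reduce_form_forms[of _ A "q - 1"] forms_formsOn[of _ A "q - 1"] reduce_form_id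
    unfolding coboundaries_def q by (simp add: image_iff) metis
qed

lemma Hcocycles_iff: "\<omega> \<in> Hcocycles m q \<longleftrightarrow> \<omega> \<in> formsOn m {1..m} q \<and> reduce_form \<omega> \<in> cocycles {1..m} (int q)"
  unfolding Hcocycles_def Mset_def mem_Collect_eq
  by (rule conj_cong[OF refl formEqJ_dOn_0_iff[OF order_refl]])

lemma Hcobound_iff: "\<omega> \<in> Hcobound m q \<longleftrightarrow> \<omega> \<in> formsOn m {1..m} q \<and> reduce_form \<omega> \<in> coboundaries {1..m} (int q)"
  unfolding Hcobound_def Mset_def mem_Collect_eq by (rule conj_cong[OF refl formEqJ_exact_iff[OF order_refl]])

lemma Tcocycles_iff: "\<theta> \<in> Tcocycles m q \<longleftrightarrow> \<theta> \<in> formsOn m N q \<and> reduce_form \<theta> \<in> cocycles N (int q)"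
  unfolding Tcocycles_def mem_Collect_eq
  by (rule conj_cong[OF refl formEqJ_dOn_0_iff[OF subset_N_imp_subset_M[OF order_refl]]])

lemma Tcobound_iff: "\<theta> \<in> Tcobound m q \<longleftrightarrow> \<theta> \<in> formsOn m N q \<and> reduce_form \<theta> \<in> coboundaries N (int q)"
  unfolding Tcobound_def mem_Collect_eq
  by (rule conj_cong[OF refl formEqJ_exact_iff[OF subset_N_imp_subset_M[OF order_refl]]])

lemma fadd_eq: "fadd \<omega> \<eta> = \<omega> + \<eta>" and fscale_eq: "fscale c \<omega> = c *\<^sub>R \<omega>"
  by (simp_all add: fadd_def fscale_def fun_eq_iff pointwise)

lemma diff_formsOn: "\<omega> \<in> formsOn m A q \<Longrightarrow> \<eta> \<in> formsOn m A q \<Longrightarrow> \<omega> - \<eta> \<in> formsOn m A q"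
  by (rule formsOnI; subst minus_apply) (auto simp: formsOn_outside intro: AB_closed formsOn_AB)

lemma reduce_form_restr_contract:
  "reduce_form (restr b \<omega>) = restr b (reduce_form \<omega>)"
    "reduce_form (contract b \<omega>) = contract b (reduce_form \<omega>)"
  by (rule ext; simp add: reduce_form_def restr_def contract_def)+

lemma restr_formsOn:
  assumes "\<omega> \<in> formsOn m {1..m} q" shows "restr 1 \<omega> \<in> formsOn m N q"
proof (rule formsOnI)
  show "restr 1 \<omega> I \<in> AB m" for I using formsOn_AB[OF assms] AB_closed(5) by (simp add: restr_def)
  show "restr 1 \<omega> I = 0" if "\<not> I \<subseteq> N \<or> card I \<noteq> q" for I
    using that formsOn_outside[OF assms, of I] M_eq_insert by (auto simp: restr_def)
qed

lemma contract_formsOn: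
  assumes "\<omega> \<in> formsOn m {1..m} (Suc q)" shows "contract 1 \<omega> \<in> formsOn m N q"
proof (rule formsOnI)
  show "contract 1 \<omega> I \<in> AB m" for I using formsOn_AB[OF assms] AB_closed(5) by (simp add: contract_def)
  show "contract 1 \<omega> I = 0" if "\<not> I \<subseteq> N \<or> card I \<noteq> q" for I
  proof (cases "1 \<in> I \<or> \<not> I \<subseteq> N")
    case False
    then have "card (insert 1 I) \<noteq> Suc q" using that finite_subset[OF _ finite_Nset] by auto
    then show ?thesis using formsOn_outside[OF assms] by (simp add: contract_def)
  qed (use formsOn_outside[OF assms, of "insert 1 I"] M_eq_insert in \<open>auto simp: contract_def\<close>)
qed

lemma restr_contract_linear:
  "restr b (\<omega> + \<eta>) = restr b \<omega> + restr b \<eta>" "restr b (c *\<^sub>R \<omega>) = c *\<^sub>R restr b \<omega>"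
  "contract b (\<omega> + \<eta>) = contract b \<omega> + contract b \<eta>" "contract b (c *\<^sub>R \<omega>) = c *\<^sub>R contract b \<omega>"
  by (simp_all add: restr_def contract_def fun_eq_iff pointwise)

lemma D1form_formsOn: "\<theta> \<in> formsOn m A q \<Longrightarrow> D1form m \<theta> \<in> formsOn m A q"
  using linear_on_zero[OF linear_on_Dt subspace_AB] one_in_M
  by (auto simp: formsOn_iff D1form_def intro: Dt_AB)

lemma reduce_form_D1form: "\<theta> \<in> formsOn m A q \<Longrightarrow> reduce_form (D1form m \<theta>) = Dform 1 (reduce_form \<theta>)"
  using formsOn_AB one_in_M
  by (auto simp: reduce_form_def D1form_def Dform_def reduce_Dt simp del: One_nat_def)

lemma card_N_nat: "int (m - 1) = int (card N)"
  using card_N two_le_m by simp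

lemma top_cocycle:
  assumes "finite A" "A \<subseteq> {1..m}" "\<theta> \<in> forms A (int (card A))" shows "\<theta> \<in> cocycles A (int (card A))"
  using assms forms_above_top[OF assms(1) dbar_forms[OF assms(2,3)]] by (simp add: cocycles_def)

lemma Tcocycles_top_iff: "\<theta> \<in> Tcocycles m (m - 1) \<longleftrightarrow> \<theta> \<in> formsOn m N (m - 1)"
  using top_cocycle[OF finite_Nset subset_N_imp_subset_M[OF order_refl]] reduce_form_forms[of \<theta> N "m - 1"]
  unfolding Tcocycles_iff card_N_nat by blast

lemma kerD1_iff:
  "\<theta> \<in> kerD1 m \<longleftrightarrow> \<theta> \<in> formsOn m N (m - 1) \<and> Dform 1 (reduce_form \<theta>) \<in> coboundaries N (int (m - 1))"
  unfolding kerD1_def mem_Collect_eq Tcocycles_top_iff Tcobound_iff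
  using D1form_formsOn reduce_form_D1form by metis

lemma reduce_form_top: "\<theta> \<in> formsOn m N (m - 1) \<Longrightarrow> reduce_form \<theta> \<in> forms N (int (card N))"
  using reduce_form_forms[of \<theta> N "m - 1"] by (simp only: card_N_nat)

lemma N_nonempty: "N \<noteq> {}"
  using two_le_m by auto

lemma Tcobound_iff_euler:
  assumes "\<theta> \<in> formsOn m N (m - 1)" shows "\<theta> \<in> Tcobound m (m - 1) \<longleftrightarrow> euler N (dV (reduce (\<theta> N))) = 0"
  using assms top_coboundaries_iff[OF order_refl reduce_form_top[OF assms]] N_nonempty
    divergences_iff_euler[OF reduce_ACPE[OF formsOn_AB[OF assms]] order_refl, of N]
  unfolding Tcobound_iff card_N_nat by (simp add: reduce_form_def)

lemma kerD1_iff_Sspace: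
  assumes \<theta>: "\<theta> \<in> formsOn m N (m - 1)" shows "\<theta> \<in> kerD1 m \<longleftrightarrow> vdfam m (\<theta> N) \<in> Sspace m"
proof -
  define f where "f = reduce (\<theta> N)"
  have AB: "\<theta> N \<in> AB m" by (rule formsOn_AB[OF \<theta>])
  have f: "f \<in> ACPE" unfolding f_def by (rule reduce_ACPE[OF AB])
  have "\<theta> \<in> kerD1 m \<longleftrightarrow> Dform 1 (reduce_form \<theta>) N \<in> divergences N"
    unfolding kerD1_iff card_N_nat
    using \<theta> top_coboundaries_iff[OF order_refl Dform_forms[OF reduce_form_top[OF \<theta>] one_in_M]]
    by blast
  also have "\<dots> \<longleftrightarrow> euler N (dV (Dbar 1 f)) = 0"
    using divergences_iff_euler[OF Dbar_ACPE[OF f one_in_M] order_refl N_nonempty]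
    by (simp add: Dform_def reduce_form_def f_def)
  also have "\<dots> \<longleftrightarrow> euler N (lie_vform 1 (euler N (dV f))) = 0"
    using euler_lie_vform_euler[OF order_refl one_in_M dV_vforms[OF f]] lie_vform_dV[OF f one_in_M] by simp
  also have "\<dots> \<longleftrightarrow> vdfam m (\<theta> N) \<in> Sspace m"
    using Sspace_iff[OF vdfam_Fams[OF AB]] form_of_vdfam[OF AB] by (simp add: f_def)
  finally show ?thesis .
qed

lemma zero_fam: "(\<lambda>_. 0, \<lambda>_ _ _. 0, \<lambda>_. 0, \<lambda>_. 0) = fam_of 0"
  by (auto simp: fam_of_def fun_eq_iff pointwise)

lemma famEqJ_0_iff: "a \<in> Fams m \<Longrightarrow> famEqJ m a (\<lambda>_. 0, \<lambda>_ _ _. 0, \<lambda>_. 0, \<lambda>_. 0) \<longleftrightarrow> form_of a = 0"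
  unfolding zero_fam
  using famEqJ_iff[OF _ fam_of_Fams] form_of_fam_of subspace_0[OF subspace_base_vforms] by metis

lemma famEqJ_vdfam_0_iff:
  assumes "\<theta> \<in> formsOn m N (m - 1)"
  shows "famEqJ m (vdfam m (\<theta> N)) (\<lambda>_. 0, \<lambda>_ _ _. 0, \<lambda>_. 0, \<lambda>_. 0) \<longleftrightarrow> \<theta> \<in> Tcobound m (m - 1)"
  using famEqJ_0_iff[OF vdfam_Fams] form_of_vdfam formsOn_AB[OF assms] Tcobound_iff_euler[OF assms] by simp

lemma vdfam_Hspace: "L \<in> AB m \<Longrightarrow> vdfam m L \<in> Hspace m"
  using Hspace_iff[OF vdfam_Fams] form_of_vdfam reduce_ACPE by blast

lemma obtain_kerD1:
  assumes "a \<in> Sspace m \<inter> Hspace m" obtains \<theta> where "\<theta> \<in> kerD1 m" "famEqJ m a (vdfam m (\<theta> N))"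
proof -
  have a: "a \<in> Fams m" using assms by (simp add: Hspace_def)
  then obtain L where L: "L \<in> ACPE" "form_of a = euler N (dV L)" using assms Hspace_iff by blast
  define \<theta> where "\<theta> = monomial_form N L"
  have "\<theta> \<in> forms N (int (card N))"
    using L(1) by (intro formsI) (auto simp: \<theta>_def monomial_form_def ACPE_closed(5))
  then have \<theta>: "\<theta> \<in> formsOn m N (m - 1)" using forms_formsOn[of \<theta> N "m - 1"] by (simp only: card_N_nat)
  have "\<theta> N = L" by (simp add: \<theta>_def monomial_form_def)
  then have form: "form_of a = form_of (vdfam m (\<theta> N))"
    using L form_of_vdfam[OF ACPE_AB[OF L(1)]] by (simp add: reduce_id)
  have Fams: "vdfam m (\<theta> N) \<in> Fams m" by (rule vdfam_Fams[OF formsOn_AB[OF \<theta>]])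
  show thesis
  proof
    show "famEqJ m a (vdfam m (\<theta> N))" using famEqJ_iff[OF a Fams] form by simp
    have "vdfam m (\<theta> N) \<in> Sspace m" using assms Sspace_iff[OF a] Sspace_iff[OF Fams] form by simp
    then show "\<theta> \<in> kerD1 m" using kerD1_iff_Sspace[OF \<theta>] by simp
  qed
qed

section \<open>The horizontal cohomology\<close>

lemma Hcocycles_subset_Hcobound:
  assumes "(1 \<le> q \<and> q \<le> m - 2) \<or> m < q" shows "Hcocycles m q \<subseteq> Hcobound m q"
proof
  fix \<omega> assume \<omega>: "\<omega> \<in> Hcocycles m q"
  then have closed: "\<omega> \<in> formsOn m {1..m} q" "reduce_form \<omega> \<in> cocycles {1..m} (int q)"
    by (simp_all add: Hcocycles_iff)
  consider "1 \<le> q" "int q \<le> int m - 2" | "m < q" using assms by linarith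
  then have "reduce_form \<omega> \<in> coboundaries {1..m} (int q)"
  proof cases
    case 1
    then show ?thesis using closed(2) cocycles_M_subset_coboundaries[of "int q"] by auto
  next
    case 2
    then have "reduce_form \<omega> = 0" using forms_above_top[OF _ reduce_form_forms[OF closed(1)]] by simp
    then show ?thesis using subspace_0[OF subspace_coboundaries] by simp
  qed
  then show "\<omega> \<in> Hcobound m q" using closed by (simp add: Hcobound_iff)
qed

lemma reduce_const_form:
  "reduce_form (\<lambda>I. if I = {} then (\<lambda>_. c) else (\<lambda>_. 0)) = monomial_form {} (\<lambda>_. c)"
  by (auto simp: reduce_form_def monomial_form_def zero_fun_def)

lemma Hcocycles_0_const:
  assumes "\<omega> \<in> Hcocycles m 0" shows "\<exists>c. formEqJ m \<omega> (\<lambda>I. if I = {} then (\<lambda>_. c) else (\<lambda>_. 0))"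
proof -
  have \<omega>: "\<omega> \<in> formsOn m {1..m} 0" "reduce_form \<omega> \<in> cocycles {1..m} 0"
    using assms by (simp_all add: Hcocycles_iff)
  obtain c where "reduce_form \<omega> = monomial_form {} (\<lambda>_. c)" using cocycles_0_const[OF \<omega>(2)] .
  then have "formEqJ m \<omega> (\<lambda>I. if I = {} then (\<lambda>_. c) else (\<lambda>_. 0))"
    using formsOn_AB[OF \<omega>(1)] reduce_const_form by (subst formEqJ_iff) (simp_all add: AB_closed(2))
  then show ?thesis by blast
qed

lemma const_form_eq_0:
  assumes "formEqJ m (\<lambda>I. if I = {} then (\<lambda>_. c) else (\<lambda>_. 0)) (\<lambda>_ _. 0)" shows "c = 0"
proof -
  have "monomial_form {} (\<lambda>_. c) = 0"
    using assms reduce_const_form by (subst (asm) formEqJ_0_iff) (simp_all add: AB_closed(2))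
  then have "monomial_form {} (\<lambda>_. c) {} y = 0" for y by (simp add: pointwise)
  then show ?thesis by (simp add: monomial_form_def)
qed

lemma restr_Hcocycle:
  assumes "\<omega> \<in> Hcocycles m (m - 1)" shows "restr 1 \<omega> \<in> kerD1 m"
proof -
  have \<omega>: "\<omega> \<in> formsOn m {1..m} (m - 1)" "reduce_form \<omega> \<in> cocycles {1..m} (int (m - 1))"
    using assms by (simp_all add: Hcocycles_iff)
  note form = reduce_form_forms[OF \<omega>(1)]
  have "Dform 1 (restr 1 (reduce_form \<omega>)) = dbar N (contract 1 (reduce_form \<omega>))"
    using \<omega>(2) cocycle_M_iff[OF form] by blast
  then show ?thesis
    using contract_forms_N[OF form] restr_formsOn[OF \<omega>(1)]
    unfolding kerD1_iff coboundaries_def reduce_form_restr_contract by blast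
qed

lemma Hcobound_iff_restr:
  assumes "\<omega> \<in> Hcocycles m (m - 1)" shows "\<omega> \<in> Hcobound m (m - 1) \<longleftrightarrow> restr 1 \<omega> \<in> Tcobound m (m - 1)"
proof -
  have \<omega>: "\<omega> \<in> formsOn m {1..m} (m - 1)" "reduce_form \<omega> \<in> cocycles {1..m} (int (m - 1))"
    using assms by (simp_all add: Hcocycles_iff)
  have "int (m - 1) \<le> int m - 1" using two_le_m by simp
  from coboundary_M_iff[OF \<omega>(2) this] show ?thesis
    using \<omega>(1) restr_formsOn[OF \<omega>(1)] by (simp add: Hcobound_iff Tcobound_iff reduce_form_restr_contract)
qed

lemma obtain_Hcocycle:
  assumes "\<theta> \<in> kerD1 m" obtains \<omega> where "\<omega> \<in> Hcocycles m (m - 1)" "restr 1 \<omega> = reduce_form \<theta>"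
proof -
  have \<theta>: "reduce_form \<theta> \<in> cocycles N (int (m - 1))" "Dform 1 (reduce_form \<theta>) \<in> coboundaries N (int (m - 1))"
    using assms Tcocycles_top_iff[of \<theta>] by (auto simp: kerD1_iff Tcocycles_iff)
  obtain \<omega> where \<omega>: "\<omega> \<in> cocycles {1..m} (int (m - 1))" "restr 1 \<omega> = reduce_form \<theta>"
    using obtain_cocycle_M[OF \<theta>] .
  then have form: "\<omega> \<in> forms {1..m} (int (m - 1))" by (simp add: cocycles_def)
  then have "\<omega> \<in> Hcocycles m (m - 1)"
    using \<omega>(1) forms_formsOn[OF form] reduce_form_id[OF form] by (simp add: Hcocycles_iff)
  then show thesis using \<omega>(2) by (rule that)
qed

lemma reduce_form_idem: "\<omega> \<in> formsOn m A q \<Longrightarrow> reduce_form (reduce_form \<omega>) = reduce_form \<omega>"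
  by (rule reduce_form_id[OF reduce_form_forms])

lemma Tcobound_diff_reduce_form:
  assumes "\<theta> \<in> formsOn m N q" shows "fadd \<theta> (fscale (- 1) (reduce_form \<theta>)) \<in> Tcobound m q"
proof -
  have "\<theta> - reduce_form \<theta> \<in> formsOn m N q"
    by (rule diff_formsOn[OF assms forms_formsOn[OF reduce_form_forms[OF assms]]])
  moreover have "reduce_form (\<theta> - reduce_form \<theta>) = 0"
    by (simp add: reduce_form_linear reduce_form_idem[OF assms])
  ultimately show ?thesis
    using subspace_0[OF subspace_coboundaries] by (simp add: Tcobound_iff fadd_eq fscale_eq)
qed

lemma kerD1_formsOn: "\<theta> \<in> kerD1 m \<Longrightarrow> \<theta> \<in> formsOn m N (m - 1)"
  by (simp add: kerD1_iff)

lemma quot_iso_Hcocycles_kerD1: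
  "quot_iso fadd fscale (Hcocycles m (m - 1)) (Hcobound m (m - 1)) fadd fscale (kerD1 m) (Tcobound m (m - 1))"
  unfolding quot_iso_def
proof (intro exI[of _ "restr 1"] conjI ballI allI)
  fix \<theta> assume \<theta>: "\<theta> \<in> kerD1 m"
  then obtain \<omega> where \<omega>: "\<omega> \<in> Hcocycles m (m - 1)" "restr 1 \<omega> = reduce_form \<theta>" by (rule obtain_Hcocycle)
  have "fadd \<theta> (fscale (- 1) (restr 1 \<omega>)) \<in> Tcobound m (m - 1)"
    unfolding \<omega>(2) by (rule Tcobound_diff_reduce_form[OF kerD1_formsOn[OF \<theta>]])
  then show "\<exists>\<omega>\<in>Hcocycles m (m - 1). fadd \<theta> (fscale (- 1) (restr 1 \<omega>)) \<in> Tcobound m (m - 1)"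
    using \<omega>(1) by blast
qed (simp_all add: restr_Hcocycle Hcobound_iff_restr fadd_eq fscale_eq restr_contract_linear del: One_nat_def)

lemma vdfam_Hcocycle_eq: "vdfam m (\<omega> N) = vdfam m (restr 1 \<omega> N)"
  by (simp add: restr_def)

lemma vdfam_kerD1: "\<theta> \<in> kerD1 m \<Longrightarrow> vdfam m (\<theta> N) \<in> Sspace m \<inter> Hspace m"
  using kerD1_iff_Sspace[OF kerD1_formsOn] vdfam_Hspace[OF formsOn_AB[OF kerD1_formsOn]] by blast

lemma vdfam_linear:
  assumes "L \<in> AB m"
  shows "K \<in> AB m \<Longrightarrow> vdfam m (L + K) = famadd (vdfam m L) (vdfam m K)"
    and "vdfam m (c *\<^sub>R L) = famscale c (vdfam m L)"
proof -
  have euler_dV: "linear_on ACPE (\<lambda>f. euler N (dV f))"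
    by (rule linear_on_compose[OF linear_on_dV linear_on_euler_N dV_vforms])
  show "vdfam m (L + K) = famadd (vdfam m L) (vdfam m K)" if "K \<in> AB m"
    using assms that linear_on_add[OF euler_dV reduce_ACPE reduce_ACPE]
    by (simp add: vdfam_eq AB_closed) (auto simp: fam_of_def famadd_def fun_eq_iff pointwise)
  show "vdfam m (c *\<^sub>R L) = famscale c (vdfam m L)"
    using assms linear_on_scaleR[OF euler_dV reduce_ACPE]
    by (simp add: vdfam_eq AB_closed) (auto simp: fam_of_def famscale_def fun_eq_iff pointwise)
qed

lemma famadd_famscale_minus_1:
  assumes "a \<in> Fams m" "b \<in> Fams m"
  shows "famadd a (famscale (- 1) b) \<in> Fams m"
    and "form_of (famadd a (famscale (- 1) b)) = form_of a - form_of b"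
proof -
  obtain u c p0 p1 where a: "a = (u, c, p0, p1)" by (cases a)
  obtain u' c' p0' p1' where b: "b = (u', c', p0', p1')" by (cases b)
  have diff: "famadd a (famscale (- 1) b) = (u - u', \<lambda>k \<alpha>. c k \<alpha> - c' k \<alpha>, p0 - p0', p1 - p1')"
    by (simp add: a b famadd_def famscale_def fun_eq_iff pointwise)
  obtain K K' where K: "\<And>k \<alpha>. K \<le> k \<Longrightarrow> \<alpha> \<in> N \<Longrightarrow> reduce (c k \<alpha>) = 0"
    "\<And>k \<alpha>. K' \<le> k \<Longrightarrow> \<alpha> \<in> N \<Longrightarrow> reduce (c' k \<alpha>) = 0"
    using assms unfolding a b Fams_iff by metis
  have "\<exists>K. \<forall>k\<ge>K. \<forall>\<alpha>\<in>N. reduce (c k \<alpha>) = reduce (c' k \<alpha>)"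
    using K by (intro exI[of _ "max K K'"]) simp
  then show "famadd a (famscale (- 1) b) \<in> Fams m"
    using assms[unfolded a b Fams_iff] unfolding diff Fams_iff by (auto intro: AB_closed(7))
  show "form_of (famadd a (famscale (- 1) b)) = form_of a - form_of b"
    unfolding diff by (rule ext) (auto simp: a b form_of_def minus_apply split: var.split)
qed

lemma quot_iso_kerD1_system:
  "quot_iso fadd fscale (kerD1 m) (Tcobound m (m - 1)) famadd famscale (Sspace m \<inter> Hspace m) (famZeroJ m)"
  unfolding quot_iso_def
proof (intro exI[of _ "\<lambda>\<theta>. vdfam m (\<theta> N)"] conjI ballI allI)
  fix \<theta> assume \<theta>: "\<theta> \<in> kerD1 m"
  note AB = formsOn_AB[OF kerD1_formsOn]
  show "vdfam m (\<theta> N) \<in> Sspace m \<inter> Hspace m" by (rule vdfam_kerD1[OF \<theta>])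
  show "vdfam m (fadd \<theta> \<theta>' N) = famadd (vdfam m (\<theta> N)) (vdfam m (\<theta>' N))" if "\<theta>' \<in> kerD1 m" for \<theta>'
    using vdfam_linear(1)[OF AB[OF \<theta>] AB[OF that]] by (simp add: fadd_eq plus_fun_apply)
  show "vdfam m (fscale c \<theta> N) = famscale c (vdfam m (\<theta> N))" for c
    using vdfam_linear(2)[OF AB[OF \<theta>]] by (simp add: fscale_eq scaleR_fun_apply)
  show "vdfam m (\<theta> N) \<in> famZeroJ m \<longleftrightarrow> \<theta> \<in> Tcobound m (m - 1)"
    using famEqJ_vdfam_0_iff[OF kerD1_formsOn[OF \<theta>]] vdfam_Fams[OF AB[OF \<theta>]] by (simp add: famZeroJ_def)
next
  fix a assume a: "a \<in> Sspace m \<inter> Hspace m"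
  then obtain \<theta> where \<theta>: "\<theta> \<in> kerD1 m" "famEqJ m a (vdfam m (\<theta> N))" by (rule obtain_kerD1)
  have Fams: "a \<in> Fams m" "vdfam m (\<theta> N) \<in> Fams m"
    using a vdfam_Fams[OF formsOn_AB[OF kerD1_formsOn[OF \<theta>(1)]]] by (simp_all add: Hspace_def)
  have "famadd a (famscale (- 1) (vdfam m (\<theta> N))) \<in> famZeroJ m"
    using famEqJ_iff[OF Fams] \<theta>(2) famadd_famscale_minus_1[OF Fams] by (simp add: famZeroJ_def famEqJ_0_iff)
  then show "\<exists>\<theta>\<in>kerD1 m. famadd a (famscale (- 1) (vdfam m (\<theta> N))) \<in> famZeroJ m" using \<theta>(1) by blast
qed

lemma Hcocycles_top_iff: "\<omega> \<in> Hcocycles m m \<longleftrightarrow> \<omega> \<in> formsOn m {1..m} m"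
  using top_cocycle[of "{1..m}" "reduce_form \<omega>"] reduce_form_forms[of \<omega> "{1..m}" m]
  by (auto simp: Hcocycles_iff simp del: One_nat_def)

lemma m_minus_1_eqs: "Suc (m - 1) = m" "int m - 1 = int (m - 1)"
  using two_le_m by simp_all

lemma formEqJ_plus_D1form_iff:
  assumes "\<theta> \<in> formsOn m A q" "\<beta> \<in> formsOn m A q" "\<zeta> \<in> formsOn m A q"
  shows "formEqJ m \<theta> (\<lambda>I y. \<beta> I y + D1form m \<zeta> I y) \<longleftrightarrow> reduce_form \<theta> = reduce_form \<beta> + Dform 1 (reduce_form \<zeta>)"
proof -
  have sum: "(\<lambda>I y. \<beta> I y + D1form m \<zeta> I y) = \<beta> + D1form m \<zeta>" by (simp add: fun_eq_iff pointwise)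
  have "(\<beta> + D1form m \<zeta>) I \<in> AB m" for I
    using assms D1form_formsOn formsOn_AB by (subst plus_fun_apply) (blast intro: AB_closed(6))
  then show ?thesis
    unfolding sum using formEqJ_iff[OF formsOn_AB[OF assms(1)]]
    by (simp add: reduce_form_linear reduce_form_D1form[OF assms(3)])
qed

lemma TcoboundPlusImD1_iff:
  assumes "\<theta> \<in> formsOn m N (m - 1)"
  shows "\<theta> \<in> TcoboundPlusImD1 m \<longleftrightarrow>
    (\<exists>\<eta>\<in>forms N (int (m - 1)). Dform 1 \<eta> - reduce_form \<theta> \<in> coboundaries N (int (m - 1)))"
proof -
  note eq = formEqJ_plus_D1form_iff[OF assms]
  have neg: "\<gamma> \<in> coboundaries N q \<longleftrightarrow> - \<gamma> \<in> coboundaries N q" for \<gamma> q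
    using subspace_neg[OF subspace_coboundaries] by fastforce
  show ?thesis
  proof
    assume "\<theta> \<in> TcoboundPlusImD1 m"
    then obtain \<beta> \<zeta> where \<beta>: "\<beta> \<in> Tcobound m (m - 1)" "\<zeta> \<in> formsOn m N (m - 1)"
      "formEqJ m \<theta> (\<lambda>I y. \<beta> I y + D1form m \<zeta> I y)"
      using Tcocycles_top_iff unfolding TcoboundPlusImD1_def by blast
    then have "Dform 1 (reduce_form \<zeta>) - reduce_form \<theta> = - reduce_form \<beta>" using eq by (simp add: Tcobound_iff)
    then show "\<exists>\<eta>\<in>forms N (int (m - 1)). Dform 1 \<eta> - reduce_form \<theta> \<in> coboundaries N (int (m - 1))"
      using \<beta>(1) reduce_form_forms[OF \<beta>(2)] neg[of "reduce_form \<beta>"]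
      by (intro bexI[of _ "reduce_form \<zeta>"]) (simp_all add: Tcobound_iff)
  next
    assume "\<exists>\<eta>\<in>forms N (int (m - 1)). Dform 1 \<eta> - reduce_form \<theta> \<in> coboundaries N (int (m - 1))"
    then obtain \<eta> where \<eta>: "\<eta> \<in> forms N (int (m - 1))"
      "Dform 1 \<eta> - reduce_form \<theta> \<in> coboundaries N (int (m - 1))" by blast
    define \<beta> where "\<beta> = reduce_form \<theta> - Dform 1 \<eta>"
    have \<beta>_form: "\<beta> \<in> forms N (int (m - 1))"
      unfolding \<beta>_def by (intro forms_closed(3) reduce_form_forms assms Dform_forms \<eta>(1) one_in_M)
    have "\<beta> \<in> coboundaries N (int (m - 1))" using \<eta>(2) neg[of \<beta>] by (simp add: \<beta>_def)
    then have "\<beta> \<in> Tcobound m (m - 1)"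
      using forms_formsOn[OF \<beta>_form] reduce_form_id[OF \<beta>_form] by (simp add: Tcobound_iff)
    moreover have "formEqJ m \<theta> (\<lambda>I y. \<beta> I y + D1form m \<eta> I y)"
      using eq[OF forms_formsOn[OF \<beta>_form] forms_formsOn[OF \<eta>(1)]] reduce_form_id[OF \<beta>_form]
        reduce_form_id[OF \<eta>(1)]
      by (simp add: \<beta>_def)
    ultimately show "\<theta> \<in> TcoboundPlusImD1 m"
      using Tcocycles_top_iff assms forms_formsOn[OF \<eta>(1)] unfolding TcoboundPlusImD1_def by blast
  qed
qed

lemma Tcobound_subset_TcoboundPlusImD1: "Tcobound m (m - 1) \<subseteq> TcoboundPlusImD1 m"
proof
  fix \<theta> assume \<theta>: "\<theta> \<in> Tcobound m (m - 1)"
  then have "Dform 1 0 - reduce_form \<theta> \<in> coboundaries N (int (m - 1))"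
    using linear_on_zero[OF linear_on_Dform subspace_forms] subspace_neg[OF subspace_coboundaries]
    by (simp add: Tcobound_iff)
  then show "\<theta> \<in> TcoboundPlusImD1 m"
    using TcoboundPlusImD1_iff[of \<theta>] \<theta> forms_closed(1) unfolding Tcobound_iff by blast
qed

lemma Hcobound_top_iff:
  assumes "\<omega> \<in> formsOn m {1..m} m" shows "\<omega> \<in> Hcobound m m \<longleftrightarrow> contract 1 \<omega> \<in> TcoboundPlusImD1 m"
proof -
  have "contract 1 \<omega> \<in> formsOn m N (m - 1)"
    using contract_formsOn[of \<omega> "m - 1"] assms by (simp only: m_minus_1_eqs)
  from TcoboundPlusImD1_iff[OF this] show ?thesis
    using assms top_coboundary_M_iff[OF reduce_form_forms[OF assms]]
    by (simp add: Hcobound_iff reduce_form_restr_contract m_minus_1_eqs(2) del: One_nat_def)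
qed

lemma quot_iso_top:
  "quot_iso fadd fscale (Hcocycles m m) (Hcobound m m) fadd fscale (Tcocycles m (m - 1)) (TcoboundPlusImD1 m)"
  unfolding quot_iso_def
proof (intro exI[of _ "contract 1"] conjI ballI allI)
  fix \<omega> assume \<omega>: "\<omega> \<in> Hcocycles m m"
  then have \<omega>: "\<omega> \<in> formsOn m {1..m} m" by (simp only: Hcocycles_top_iff)
  show "contract 1 \<omega> \<in> Tcocycles m (m - 1)"
    using contract_formsOn[of \<omega> "m - 1"] \<omega> by (simp only: m_minus_1_eqs Tcocycles_top_iff)
  show "contract 1 \<omega> \<in> TcoboundPlusImD1 m \<longleftrightarrow> \<omega> \<in> Hcobound m m" by (simp add: Hcobound_top_iff[OF \<omega>])
next
  fix \<theta> assume "\<theta> \<in> Tcocycles m (m - 1)"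
  then have \<theta>: "\<theta> \<in> formsOn m N (m - 1)" by (simp only: Tcocycles_top_iff)
  define \<omega> where "\<omega> = join 1 0 (reduce_form \<theta>)"
  note form = reduce_form_forms[OF \<theta>]
  have "1 \<notin> N" by simp
  then have "reduce_form \<theta> I = 0" if "1 \<in> I" for I using that formsD(2)[OF form, of I] by blast
  then have contract: "contract 1 \<omega> = reduce_form \<theta>" by (auto simp: \<omega>_def join_def contract_def)
  have "\<omega> \<in> forms {1..m} (int m)"
    unfolding \<omega>_def using form by (intro join_forms_N forms_closed(1)) (auto simp: m_minus_1_eqs(2))
  then have "\<omega> \<in> Hcocycles m m" using forms_formsOn Hcocycles_top_iff by blast
  moreover have "fadd \<theta> (fscale (- 1) (contract 1 \<omega>)) \<in> TcoboundPlusImD1 m"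
    using Tcobound_diff_reduce_form[OF \<theta>] Tcobound_subset_TcoboundPlusImD1 contract by auto
  ultimately show "\<exists>\<omega>\<in>Hcocycles m m. fadd \<theta> (fscale (- 1) (contract 1 \<omega>)) \<in> TcoboundPlusImD1 m" by blast
qed (simp_all add: fadd_eq fscale_eq restr_contract_linear del: One_nat_def)

lemma vdfam_Hcocycle: "\<omega> \<in> Hcocycles m (m - 1) \<Longrightarrow> vdfam m (\<omega> N) \<in> Sspace m \<inter> Hspace m"
  using vdfam_kerD1[OF restr_Hcocycle] vdfam_Hcocycle_eq by metis

lemma famEqJ_vdfam_Hcocycle_0_iff:
  assumes "\<omega> \<in> Hcocycles m (m - 1)"
  shows "famEqJ m (vdfam m (\<omega> N)) (\<lambda>_. 0, \<lambda>_ _ _. 0, \<lambda>_. 0, \<lambda>_. 0) \<longleftrightarrow> \<omega> \<in> Hcobound m (m - 1)"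
  unfolding vdfam_Hcocycle_eq[of \<omega>] Hcobound_iff_restr[OF assms]
  by (rule famEqJ_vdfam_0_iff[OF kerD1_formsOn[OF restr_Hcocycle[OF assms]]])

lemma ex_Hcocycle_vdfam:
  assumes "a \<in> Sspace m \<inter> Hspace m" shows "\<exists>\<omega>\<in>Hcocycles m (m - 1). famEqJ m a (vdfam m (\<omega> N))"
proof -
  obtain \<theta> where \<theta>: "\<theta> \<in> kerD1 m" "famEqJ m a (vdfam m (\<theta> N))" using assms by (rule obtain_kerD1)
  obtain \<omega> where \<omega>: "\<omega> \<in> Hcocycles m (m - 1)" "restr 1 \<omega> = reduce_form \<theta>" using \<theta>(1) by (rule obtain_Hcocycle)
  have AB: "\<theta> N \<in> AB m" by (rule formsOn_AB[OF kerD1_formsOn[OF \<theta>(1)]])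
  have "\<omega> N = reduce (\<theta> N)" using fun_cong[OF \<omega>(2), of N] by (simp add: restr_def reduce_form_def)
  then have "vdfam m (\<omega> N) = vdfam m (\<theta> N)"
    using AB reduce_AB[OF AB] reduce_id[OF reduce_ACPE[OF AB]] by (simp add: vdfam_eq)
  then show ?thesis using \<theta>(2) \<omega>(1) by metis
qed

end

theorem mainTheorem5:
  fixes m :: nat
  assumes "2 \<le> m"
  shows
    \<comment> \<open>H^q = 0 for 1 \<le> q \<le> m-2 and q > m\<close>
    "(\<forall>q. (1 \<le> q \<and> q \<le> m - 2) \<or> m < q \<longrightarrow> Hcocycles m q \<subseteq> Hcobound m q)
   \<comment> \<open>H^0 = R: the classes of constants\<close>
   \<and> (\<forall>\<omega>\<in>Hcocycles m 0. \<exists>c::real. formEqJ m \<omega> (\<lambda>I. if I = {} then (\<lambda>_. c) else (\<lambda>_. 0)))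
   \<and> (\<forall>c::real. formEqJ m (\<lambda>I. if I = {} then (\<lambda>_. c) else (\<lambda>_. 0)) (\<lambda>_ _. 0) \<longrightarrow> c = 0)
   \<comment> \<open>H^{m-1} = S \<inter> H via [J^mu d_mu x] \<mapsto> variational derivatives of J^1\<close>
   \<and> (\<forall>\<omega>\<in>Hcocycles m (m - 1). vdfam m (\<omega> (Nset m)) \<in> Sspace m \<inter> Hspace m)
   \<and> (\<forall>\<omega>\<in>Hcocycles m (m - 1).
        famEqJ m (vdfam m (\<omega> (Nset m))) (\<lambda>_. 0, \<lambda>_ _ _. 0, \<lambda>_. 0, \<lambda>_. 0) \<longleftrightarrow> \<omega> \<in> Hcobound m (m - 1))
   \<and> (\<forall>ch\<in>Sspace m \<inter> Hspace m. \<exists>\<omega>\<in>Hcocycles m (m - 1). famEqJ m ch (vdfam m (\<omega> (Nset m))))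
   \<comment> \<open>H^{m-1} = ker D_1^{m-1} = S \<inter> H\<close>
   \<and> quot_iso fadd fscale (Hcocycles m (m - 1)) (Hcobound m (m - 1))
              fadd fscale (kerD1 m) (Tcobound m (m - 1))
   \<and> quot_iso fadd fscale (kerD1 m) (Tcobound m (m - 1))
              famadd famscale (Sspace m \<inter> Hspace m) (famZeroJ m)
   \<comment> \<open>H^m = H^{m-1}(Theta) / im D_1^{m-1}\<close>
   \<and> quot_iso fadd fscale (Hcocycles m m) (Hcobound m m)
              fadd fscale (Tcocycles m (m - 1)) (TcoboundPlusImD1 m)"
proof -
  interpret cpe m by unfold_locales (fact assms)
  show ?thesis
    by (intro conjI allI ballI impI Hcocycles_subset_Hcobound Hcocycles_0_const const_form_eq_0
        vdfam_Hcocycle famEqJ_vdfam_Hcocycle_0_iff ex_Hcocycle_vdfam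
        quot_iso_Hcocycles_kerD1 quot_iso_kerD1_system quot_iso_top; assumption)
qed

end
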